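(* Let $G=(V,E)$ be an undirected graph with $n$ vertices and let $f\ge 2\log^2 n$ be an integer. There are randomized labeling functions $L_V:V\to\{0,1\}^{O(\log n)}$ and $L_E:E\to\{0,1\}^{O(\log^2 n\,\log(f/\log^2 n))}$ such that, for any query $\langle s,t,F\rangle$ with $s,t\in V$, $F\subset E$, $|F|\le f$, with high probability (i.e., with probability $1-1/\mathrm{poly}(n)$ over the randomness of the labeling) one can determine whether $s$ and $t$ are connected in $G-F$ by inspecting only $L_V(s)$, $L_V(t)$ and $\{L_E(e)\mid e\in F\}$.
   Context: $G-F$ is the graph obtained from $G$ by deleting the edges of $F$. Labels are assigned in preprocessing (knowing $G$ and $f$, using random bits); queries are answered by a fixed decoding procedure with access only to the stated labels. *)

theory Defs
  imports "HOL-Probability.Probability"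
begin

definition ugraph :: "'a set \<Rightarrow> 'a set set \<Rightarrow> bool" where
  "ugraph V E \<longleftrightarrow> finite V \<and> (\<forall>e\<in>E. e \<subseteq> V \<and> card e = 2)"

text \<open>Existence of a walk from \<open>s\<close> to \<open>t\<close> along the edges in \<open>E\<close>, possibly of length 0.\<close>

definition connected_by :: "'a set set \<Rightarrow> 'a \<Rightarrow> 'a \<Rightarrow> bool" where
  "connected_by E s t \<longleftrightarrow> (s, t) \<in> {(u, v). {u, v} \<in> E}\<^sup>*"

type_synonym label = "bool list"

text \<open>The joint distribution of \<open>(L\<^sub>V, L\<^sub>E)\<close>: vertex and edge labels may share randomness.\<close>

type_synonym 'a random_labeling = "(('a \<Rightarrow> label) \<times> ('a set \<Rightarrow> label)) pmf"

text \<open>A decoder maps \<open>L\<^sub>V(s)\<close>, \<open>L\<^sub>V(t)\<close> and the set \<open>{L\<^sub>E(e) | e \<in> F}\<close> to an answer. It has no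
  access to the graph, to \<open>n\<close>, to \<open>f\<close>, or to the random choices.\<close>

type_synonym decoder = "label \<Rightarrow> label \<Rightarrow> label set \<Rightarrow> bool"

text \<open>Every outcome is a pair of functions \<open>V \<rightarrow> {0,1}\<^sup>b\<close> and \<open>E \<rightarrow> {0,1}\<^sup>b\<^sup>'\<close>.\<close>

definition label_lengths ::
  "'a set \<Rightarrow> 'a set set \<Rightarrow> nat \<Rightarrow> nat \<Rightarrow> 'a random_labeling \<Rightarrow> bool" where
  "label_lengths V E b b' P \<longleftrightarrow>
     (\<forall>(L\<^sub>V, L\<^sub>E) \<in> set_pmf P.
        (\<forall>v\<in>V. length (L\<^sub>V v) = b) \<and> (\<forall>e\<in>E. length (L\<^sub>E e) = b'))"

text \<open>The probability that a fixed query is answered correctly, whichever answer is right.\<close>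

definition success_prob ::
  "decoder \<Rightarrow> 'a set set \<Rightarrow> 'a random_labeling \<Rightarrow> 'a \<Rightarrow> 'a \<Rightarrow> 'a set set \<Rightarrow> real" where
  "success_prob D E P s t F =
     measure_pmf.prob P
       {(L\<^sub>V, L\<^sub>E). D (L\<^sub>V s) (L\<^sub>V t) (L\<^sub>E ` F) \<longleftrightarrow> connected_by (E - F) s t}"

end

theory Submission
  imports Defs "HOL-Library.Z2" "HOL-Library.Function_Algebras" "HOL-Library.Nat_Bijection"
begin

text \<open>
  Fix a rooted spanning forest. Every edge \<open>e\<close> carries a random vector over \<open>GF(2)\<close>, and its label
  stores this vector together with the sum of the vectors of all edges leaving the subtree below \<open>e\<close>.
  The sum of the vectors on a cut is linear in the indicator function of its side. A vertex set that
  splits no component of the forest minus \<open>F\<close> is, up to complement, a symmetric difference of subtrees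
  below edges of \<open>F\<close>, so the labels of \<open>F\<close> determine the sum over the edges of \<open>G - F\<close> leaving that set.

  The decoder first runs about \<open>log (f / log\<^sup>2 n)\<close> Boruvka rounds of \<open>O(log\<^sup>2 n)\<close> bits each. At level
  \<open>j < 2 log n\<close> an edge is sampled with probability \<open>2 ^ -j\<close>, and a sampled edge contributes a random
  codeword from a Sidon set; the sum of two or more such codewords is unlikely to be a codeword, so
  false edges are rarely accepted, while a constant fraction of the components isolate a leaving edge
  at the level matching their degree. The number of components therefore decreases geometrically,
  with exponentially small failure probability, to \<open>O(log\<^sup>2 n)\<close>. The remaining \<open>O(log\<^sup>2 n)\<close> bits of the
  vectors are uniform, and a union bound over all unions of the remaining components shows that they
  vanish only on empty cuts.
\<close>

section \<open>Bit vectors and their encodings\<close>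


text \<open>Neither phase suffices alone. A union bound over unions of up to \<open>f + 1\<close>
  pieces needs about \<open>f\<close> check bits. Merging to the end needs about
  \<open>log f\<close> rounds, and with few components a round is only known to progress with
  constant probability. Stopping at about \<open>log\<^sup>2 n\<close> components makes the check as
  cheap as one round and leaves enough components for concentration.

  No single round is required to succeed. One exponential moment of the number of components with a
  leaving edge is carried through all rounds. The \<open>2 ^ k\<close> of the final union bound has
  the same exponential form, so slow progress and an accidentally vanishing check are bounded
  together. Every round has fresh randomness, since the components it meets depend on the earlier
  rounds.

  The decoder sees nothing but labels: vertex labels therefore also carry \<open>n\<close> and the
  root, edge labels a number that determines the rounds. Only label lengths count, so the decoder
  may search exhaustively.\<close>

declare add_bit_eq_xor [simp del] mult_bit_eq_and [simp del]

type_synonym vec = "nat \<Rightarrow> bit"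

lemma bit_add_self [simp]: "(x :: bit) + x = 0"
  by (cases x) auto

lemma vec_add_self [simp]: "(x :: 'a \<Rightarrow> bit) + x = 0"
  by (simp add: fun_eq_iff)

lemma bit_add_eq_iff: "(x :: bit) + y = z \<longleftrightarrow> x = z + y"
  by (cases x; cases y; cases z) simp_all

lemma vec_add_eq_iff: "(x :: 'a \<Rightarrow> bit) + y = z \<longleftrightarrow> x = z + y"
  by (simp add: fun_eq_iff bit_add_eq_iff)

lemma of_bool_add_bit: "(of_bool P + of_bool Q :: bit) = of_bool (P \<noteq> Q)"
  by simp

lemma sum_fun_apply: "(\<Sum>i\<in>A. f i) x = (\<Sum>i\<in>A. f i x)"
  by (induction A rule: infinite_finite_induct) auto

text \<open>Length is a support condition on infinite sequences, so vectors of all lengths share one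
  type and one addition.\<close>

definition vecs :: "nat \<Rightarrow> vec set" where
  "vecs b = {f. \<forall>p\<ge>b. f p = 0}"

lemma vecs_add: "x \<in> vecs b \<Longrightarrow> y \<in> vecs b \<Longrightarrow> x + y \<in> vecs b"
  by (simp add: vecs_def)

lemma vecs_0 [simp]: "0 \<in> vecs b"
  by (simp add: vecs_def)

lemma vecs_sum: "(\<And>i. i \<in> A \<Longrightarrow> f i \<in> vecs b) \<Longrightarrow> (\<Sum>i\<in>A. f i) \<in> vecs b"
  by (induction A rule: infinite_finite_induct) (auto intro: vecs_add)

lemma UNIV_bit: "(UNIV :: bit set) = {0, 1}"
  by (auto intro: bit.exhaust)

lemma vecs_eq: "vecs b = PiE_dflt {..<b} 0 (\<lambda>_. UNIV)"
  by (auto simp: vecs_def PiE_dflt_def)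

lemma finite_vecs [simp, intro]: "finite (vecs b)"
  unfolding vecs_eq by (intro finite_PiE_dflt) (auto simp: UNIV_bit)

lemma card_vecs [simp]: "card (vecs b) = 2 ^ b"
  unfolding vecs_eq by (subst card_PiE_dflt) (auto simp: UNIV_bit numeral_2_eq_2)

definition nat_of_vec :: "nat \<Rightarrow> vec \<Rightarrow> nat" where
  "nat_of_vec b r = horner_sum of_bool 2 (map (\<lambda>p. r p = 1) [0..<b])"

definition vec_of_nat :: "nat \<Rightarrow> vec" where
  "vec_of_nat x = (\<lambda>p. of_bool (bit x p))"

lemma nat_of_vec_less: "nat_of_vec b r < 2 ^ b"
  unfolding nat_of_vec_def
  by (metis horner_sum_of_bool_2_less length_map length_upt minus_nat.diff_0)

lemma vec_of_nat_of_vec: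
  assumes "r \<in> vecs b"
  shows "vec_of_nat (nat_of_vec b r) = r"
proof
  fix p
  show "vec_of_nat (nat_of_vec b r) p = r p"
    using assms
    by (cases "r p"; cases "p < b")
      (auto simp: vec_of_nat_def nat_of_vec_def bit_horner_sum_bit_iff vecs_def)
qed

section \<open>Binary labels and the cost of pairing\<close>

definition label_of_nat :: "nat \<Rightarrow> nat \<Rightarrow> label" where
  "label_of_nat b x = map (bit x) [0..<b]"

definition nat_of_label :: "label \<Rightarrow> nat" where
  "nat_of_label = horner_sum of_bool 2"

lemma length_label_of_nat [simp]: "length (label_of_nat b x) = b"
  by (simp add: label_of_nat_def)

lemma nat_of_label_of_nat: "x < 2 ^ b \<Longrightarrow> nat_of_label (label_of_nat b x) = x"
  by (simp add: label_of_nat_def nat_of_label_def horner_sum_bit_eq_take_bit take_bit_nat_eq_self)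

text \<open>Cantor pairing grows quadratically, so one pairing doubles the bit length and adds two.
  Labels nest pairings to constant depth, hence this costs a constant factor.\<close>

lemma prod_encode_less:
  assumes "x < 2 ^ a" "y < 2 ^ a"
  shows "prod_encode (x, y) < 2 ^ (2 * a + 2)"
proof -
  have "prod_encode (x, y) \<le> (x + y) * Suc (x + y) + x"
    by (simp add: prod_encode_def triangle_def)
  also have "\<dots> < (2 * 2 ^ a) * (2 * 2 ^ a)"
  proof -
    define A :: nat where "A = 2 ^ a"
    have xy: "x + y + 2 \<le> 2 * A" "x < A" using assms by (auto simp: A_def)
    have "(x + y) * Suc (x + y) + x < (x + y + 2) * (x + y + 2)" by (simp add: algebra_simps)
    also have "\<dots> \<le> (2 * A) * (2 * A)" using xy by (intro mult_mono) auto
    finally show ?thesis by (simp add: A_def)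
  qed
  also have "\<dots> = 2 ^ (2 * a + 2)"
    by (simp only: power_add power_mult power2_eq_square[symmetric] power_mult_distrib)
      (simp add: power2_eq_square flip: power_mult_distrib)
  finally show ?thesis .
qed

section \<open>Sidon codes\<close>


text \<open>Sidon sets in characteristic 2. The proviso \<open>a \<noteq> b\<close> sets aside the
  trivial coincidences \<open>a + a = c + c = 0\<close>.\<close>

definition sidon :: "('a \<Rightarrow> bit) set \<Rightarrow> bool" where
  "sidon W \<longleftrightarrow> (\<forall>a\<in>W. \<forall>b\<in>W. \<forall>c\<in>W. \<forall>d\<in>W. a + b = c + d \<and> a \<noteq> b \<longrightarrow> {a, b} = {c, d})"

lemma card_triples_le:
  assumes "finite W"
  shows "card ((\<lambda>(x, y, z). x + y + z) ` (W \<times> W \<times> W)) \<le> card W ^ 3"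
  using card_image_le[of "W \<times> W \<times> W" "\<lambda>(x, y, z). x + y + z"] assms
  by (simp add: card_cartesian_product power3_eq_cube mult.assoc)

text \<open>If \<open>w\<close> occurs once in \<open>a + b = c + d\<close>, solving for it makes it
  a sum of three old words; if it occurs twice, \<open>a \<noteq> b\<close> puts it on both sides
  and it cancels.\<close>

lemma sidon_insert:
  fixes W :: "('a \<Rightarrow> bit) set"
  assumes W: "sidon W" and w: "w \<notin> (\<lambda>(x, y, z). x + y + z) ` (W \<times> W \<times> W)"
  shows "sidon (insert w W)"
proof -
  have n: "w \<noteq> x + y + z" if "x \<in> W" "y \<in> W" "z \<in> W" for x y z
    using w image_eqI[of w "\<lambda>(x, y, z). x + y + z" "(x, y, z)" "W \<times> W \<times> W"] that by auto
  show ?thesis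
    unfolding sidon_def
  proof (intro ballI impI, elim conjE)
    fix a b c d
    assume *: "a \<in> insert w W" "b \<in> insert w W" "c \<in> insert w W" "d \<in> insert w W"
      and eq: "a + b = c + d" and ne: "a \<noteq> b"
    have ne': "c \<noteq> d" using eq ne vec_add_eq_iff[of a b 0] by auto
    have cancel: "b = d" if "a = c" using eq that by simp
    have cancel': "b = c" if "a = d" using eq that by (metis add.commute add_left_cancel)
    have cancel2: "a = d" if "b = c" using eq that by (metis add.commute add_left_cancel)
    have cancel3: "a = c" if "b = d" using eq that by simp
    consider "a = c" | "a = d" | "b = c" | "b = d" | "a \<in> W" "b \<in> W" "c \<in> W" "d \<in> W"
      | "a = w" "b \<in> W" "c \<in> W" "d \<in> W" | "a \<in> W" "b = w" "c \<in> W" "d \<in> W"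
      | "a \<in> W" "b \<in> W" "c = w" "d \<in> W" | "a \<in> W" "b \<in> W" "c \<in> W" "d = w"
      using * ne ne' by auto
    then show "{a, b} = {c, d}"
    proof cases
      case 1
      show ?thesis using cancel[OF 1] 1 by simp
    next
      case 2
      show ?thesis using cancel'[OF 2] 2 by (simp add: insert_commute)
    next
      case 3
      show ?thesis using cancel2[OF 3] 3 by (simp add: insert_commute)
    next
      case 4
      show ?thesis using cancel3[OF 4] 4 by simp
    next
      case 5
      then show ?thesis using W eq ne unfolding sidon_def by blast
    next
      case 6
      then show ?thesis using n[of c d b] eq vec_add_eq_iff[of w b "c + d"] by simp
    next
      case 7
      then show ?thesis using n[of c d a] eq vec_add_eq_iff[of w a "c + d"] by (simp add: add.commute)
    next
      case 8
      then show ?thesis using n[of a b d] eq[symmetric] vec_add_eq_iff[of w d "a + b"] by simp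
    next
      case 9
      then show ?thesis using n[of a b c] eq[symmetric] vec_add_eq_iff[of w c "a + b"]
        by (simp add: add.commute)
    qed
  qed
qed

text \<open>Greedy choice: the words chosen so far exclude at most \<open>card X ^ 3\<close> triple
  sums and the zero vector, and the cube of the next cardinality has room for this extra
  one.\<close>

lemma ex_sidon_code:
  assumes "finite X" "card X ^ 3 < 2 ^ m"
  shows "\<exists>w :: 'x \<Rightarrow> vec. inj_on w X \<and> w ` X \<subseteq> vecs m - {0} \<and> sidon (w ` X)"
  using assms
proof (induction X rule: finite_induct)
  case empty
  then show ?case by (auto simp: sidon_def)
next
  case (insert x X)
  have lt: "card X ^ 3 + 1 \<le> card (insert x X) ^ 3"
    using insert.hyps power_strict_mono[of "card X" "card (insert x X)" 3] by simp
  with insert obtain w where w: "inj_on w X" "w ` X \<subseteq> vecs m - {0}" "sidon (w ` X)"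
    by (metis add_leD1 le_less_trans)
  define B where "B = insert 0 ((\<lambda>(x, y, z). x + y + z) ` (w ` X \<times> w ` X \<times> w ` X))"
  have "card (w ` X) ^ 3 \<le> card X ^ 3"
    using insert.hyps by (intro power_mono card_image_le) auto
  moreover have "card B \<le> card (w ` X) ^ 3 + 1"
    using card_triples_le[of "w ` X"] insert.hyps unfolding B_def by (simp add: card_insert_if le_SucI)
  ultimately have "card B < 2 ^ m"
    using lt insert.prems by linarith
  moreover have "finite B" using insert.hyps by (auto simp: B_def)
  ultimately have "\<not> vecs m \<subseteq> B" using card_mono[of B "vecs m"] by auto
  then obtain u where u: "u \<in> vecs m" "u \<notin> B" by auto
  \<comment> \<open>An old word is itself a triple sum, since \<open>u + u + u = u\<close>; avoiding
    triple sums thus also gives injectivity.\<close>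
  have uX: "u \<notin> w ` X"
  proof
    assume "u \<in> w ` X"
    then have "u + u + u \<in> B"
      unfolding B_def by (intro insertI2 image_eqI[where x = "(u, u, u)"]) simp_all
    then show False using u by simp
  qed
  define w' where "w' = w(x := u)"
  have im: "w' ` insert x X = insert u (w ` X)" using insert.hyps by (auto simp: w'_def)
  have "inj_on w' (insert x X)"
    using w(1) uX insert.hyps by (auto simp: w'_def inj_on_def)
  moreover have "w' ` insert x X \<subseteq> vecs m - {0}"
    using w(2) u unfolding im by (auto simp: B_def)
  moreover have "sidon (w' ` insert x X)"
    unfolding im using u(2) unfolding B_def by (intro sidon_insert[OF w(3)]) blast
  ultimately show ?case by (intro exI[of _ w'] conjI)
qed

text \<open>Such a \<open>w\<close> represents \<open>y\<close> as the sum of the two words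
  \<open>w\<close> and \<open>w + y\<close>, and the Sidon property allows only one unordered pair
  with that sum.\<close>

lemma sidon_translate_card:
  fixes W :: "('a \<Rightarrow> bit) set"
  assumes W: "sidon W" "finite W" and y: "y \<noteq> 0"
  shows "card {w \<in> W. w + y \<in> W} \<le> 2"
proof (cases "{w \<in> W. w + y \<in> W} = {}")
  case False
  then obtain a where a: "a \<in> W" "a + y \<in> W" by auto
  have "{w \<in> W. w + y \<in> W} \<subseteq> {a, a + y}"
  proof clarsimp
    fix w assume w: "w \<in> W" "w + y \<in> W" "w \<noteq> a"
    have "a + (a + y) = w + (w + y)" by (metis add.assoc vec_add_self add_0)
    moreover have "a \<noteq> a + y" using y by (metis add.right_neutral add_left_cancel)
    ultimately have "{a, a + y} = {w, w + y}" using W a w unfolding sidon_def by blast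
    then show "w = a + y" using w by auto
  qed
  then have "card {w \<in> W. w + y \<in> W} \<le> card {a, a + y}" by (intro card_mono) auto
  also have "\<dots> \<le> 2" by (simp add: card_insert_if)
  finally show ?thesis .
next
  case True
  show ?thesis unfolding True by simp
qed

section \<open>Rooted spanning forests\<close>


lemma connected_by_refl [simp]: "connected_by E u u"
  by (simp add: connected_by_def)

lemma connected_by_trans: "connected_by E u v \<Longrightarrow> connected_by E v w \<Longrightarrow> connected_by E u w"
  unfolding connected_by_def by (rule rtrancl_trans)

lemma connected_by_edge: "{u, v} \<in> E \<Longrightarrow> connected_by E u v"
  unfolding connected_by_def by (intro r_into_rtrancl) simp

lemma connected_by_sym: "connected_by E u v \<Longrightarrow> connected_by E v u"
proof -
  have "sym {(u, v). {u, v} \<in> E}" by (auto simp: sym_def insert_commute)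
  then show "connected_by E u v \<Longrightarrow> connected_by E v u"
    unfolding connected_by_def by (meson sym_rtrancl symD)
qed

lemma connected_by_commute: "connected_by E u v \<longleftrightarrow> connected_by E v u"
  by (blast intro: connected_by_sym)

lemma connected_by_mono: "connected_by E u v \<Longrightarrow> E \<subseteq> E' \<Longrightarrow> connected_by E' u v"
  unfolding connected_by_def by (erule rtrancl_mono[THEN subsetD, rotated]) auto

definition crosses :: "'a set \<Rightarrow> 'a set \<Rightarrow> bool" where
  "crosses e C \<longleftrightarrow> e \<inter> C \<noteq> {} \<and> \<not> e \<subseteq> C"

definition closed_under :: "'a set set \<Rightarrow> 'a set \<Rightarrow> bool" where
  "closed_under H C \<longleftrightarrow> (\<forall>e\<in>H. \<not> crosses e C)"

lemma crosses_pair: "crosses {u, v} C \<longleftrightarrow> (u \<in> C) \<noteq> (v \<in> C)"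
  by (auto simp: crosses_def)

lemma closed_under_connected:
  assumes "closed_under H C" "connected_by H u v"
  shows "u \<in> C \<longleftrightarrow> v \<in> C"
  using assms(2) unfolding connected_by_def
proof (induction rule: rtrancl_induct)
  case (step y z)
  then show ?case using assms(1) by (auto simp: closed_under_def crosses_pair)
qed simp

lemma connected_by_leaves:
  assumes "connected_by H u v" "u \<in> S" "v \<notin> S"
  shows "\<exists>x y. x \<in> S \<and> y \<notin> S \<and> {x, y} \<in> H"
  using assms unfolding connected_by_def
proof (induction rule: rtrancl_induct)
  case (step y z)
  then show ?case by (cases "y \<in> S") auto
qed simp

text \<open>\<open>P v\<close> is the set of edges on the path of a rooted spanning forest from \<open>v\<close> up to its root
  \<open>rt v\<close>, and the list is a preorder of the forest, so the vertices below an edge are consecutive.\<close>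

locale rooted_forest =
  fixes E :: "'a set set" and rt :: "'a \<Rightarrow> 'a" and xs :: "'a list" and P :: "'a \<Rightarrow> 'a set set"
  assumes distinct: "distinct xs"
    and path_subset: "v \<in> set xs \<Longrightarrow> P v \<subseteq> E"
    and path_vertices: "v \<in> set xs \<Longrightarrow> \<Union>(P v) \<subseteq> set xs"
    and root_in: "v \<in> set xs \<Longrightarrow> rt v \<in> set xs"
    and root_root: "v \<in> set xs \<Longrightarrow> rt (rt v) = rt v"
    and path_root: "v \<in> set xs \<Longrightarrow> P (rt v) = {}"
    and path_edge: "v \<in> set xs \<Longrightarrow> e \<in> P v \<Longrightarrow>
      \<exists>u w. u \<in> set xs \<and> w \<in> set xs \<and> e = {u, w} \<and> P w = insert e (P u)"
    and telescope: "v \<in> set xs \<Longrightarrow> (\<Sum>e\<in>P v. \<Sum>u\<in>e. \<phi> u :: bit) = \<phi> v + \<phi> (rt v)"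
    and path_connects: "u \<in> set xs \<Longrightarrow> v \<in> set xs \<Longrightarrow> rt u = rt v \<Longrightarrow>
      connected_by ((P u - P v) \<union> (P v - P u)) u v"
    and common_edge_root: "u \<in> set xs \<Longrightarrow> v \<in> set xs \<Longrightarrow> e \<in> P u \<Longrightarrow> e \<in> P v \<Longrightarrow> rt u = rt v"
    and below_consecutive: "\<exists>ys zs ws. xs = ys @ zs @ ws \<and> {v \<in> set xs. e \<in> P v} = set zs"
    and card_signatures: "finite F \<Longrightarrow>
      card ((\<lambda>v. P v \<inter> F) ` set xs) \<le> card (F \<inter> \<Union>(P ` set xs)) + 1"

lemma rooted_forest_Nil: "rooted_forest E rt [] P"
  by unfold_locales auto

lemma rooted_forest_root:
  assumes R: "rooted_forest E rt xs P" and w: "w \<notin> set xs" "rt w = w" "\<And>u. u \<in> set xs \<Longrightarrow> rt u \<noteq> w"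
  shows "rooted_forest E rt (xs @ [w]) (P(w := {}))"
proof -
  interpret rooted_forest E rt xs P by (rule R)
  let ?P = "P(w := {})"
  have P: "?P v = P v" if "v \<in> set xs" for v using that w by auto
  have in_xs: "v \<in> set xs" if "v \<in> set (xs @ [w])" "v \<noteq> w" for v using that by auto
  have S: "{v \<in> set (xs @ [w]). e \<in> ?P v} = {v \<in> set xs. e \<in> P v}" for e using w(1) by auto
  show ?thesis
  proof
    show "distinct (xs @ [w])" using distinct w(1) by simp
    show "?P v \<subseteq> E" if "v \<in> set (xs @ [w])" for v
      using path_subset[of v] that by auto
    show "\<Union>(?P v) \<subseteq> set (xs @ [w])" if "v \<in> set (xs @ [w])" for v
      using path_vertices[of v] that by (cases "v = w") auto
    show "rt v \<in> set (xs @ [w])" if "v \<in> set (xs @ [w])" for v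
      using root_in[of v] w(2) that by (cases "v = w") auto
    show "rt (rt v) = rt v" if "v \<in> set (xs @ [w])" for v
      using root_root[of v] w(2) that by (cases "v = w") auto
    show "?P (rt v) = {}" if "v \<in> set (xs @ [w])" for v
      using path_root[of v] w(2) that by (cases "v = w") auto
    show "(\<Sum>e\<in>?P v. \<Sum>u\<in>e. \<phi> u :: bit) = \<phi> v + \<phi> (rt v)" if "v \<in> set (xs @ [w])" for v \<phi>
      using telescope[of v \<phi>] w(2) that by (cases "v = w") auto
    show "\<exists>u z. u \<in> set (xs @ [w]) \<and> z \<in> set (xs @ [w]) \<and> e = {u, z} \<and> ?P z = insert e (?P u)"
      if "v \<in> set (xs @ [w])" "e \<in> ?P v" for v e
    proof -
      have "v \<in> set xs" "e \<in> P v" using that by (auto split: if_splits)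
      from path_edge[OF this] obtain u z
        where "u \<in> set xs" "z \<in> set xs" "e = {u, z}" "P z = insert e (P u)" by metis
      then show ?thesis by (intro exI[of _ u] exI[of _ z]) (simp add: P del: fun_upd_apply)
    qed
    show "connected_by ((?P u - ?P v) \<union> (?P v - ?P u)) u v"
      if "u \<in> set (xs @ [w])" "v \<in> set (xs @ [w])" "rt u = rt v" for u v
    proof (cases "u = w \<or> v = w")
      case True
      then have "u = v" using that w(2) w(3)[of u] w(3)[of v] by auto
      then show ?thesis by simp
    next
      case False
      then show ?thesis using that path_connects[of u v] by simp
    qed
    show "rt u = rt v"
      if "u \<in> set (xs @ [w])" "v \<in> set (xs @ [w])" "e \<in> ?P u" "e \<in> ?P v" for u v e
    proof -
      have "u \<noteq> w" "v \<noteq> w" using that by auto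
      then show ?thesis using common_edge_root[of u v e] that by simp
    qed
    show "\<exists>ys zs ws. xs @ [w] = ys @ zs @ ws \<and> {v \<in> set (xs @ [w]). e \<in> ?P v} = set zs" for e
    proof -
      obtain ys zs ws where "xs = ys @ zs @ ws" "{v \<in> set xs. e \<in> P v} = set zs"
        using below_consecutive by metis
      then show ?thesis unfolding S by (intro exI[of _ ys] exI[of _ zs] exI[of _ "ws @ [w]"]) simp
    qed
    fix F :: "'a set set" assume F: "finite F"
    have im: "(\<lambda>v. ?P v \<inter> F) ` set (xs @ [w]) = insert {} ((\<lambda>v. P v \<inter> F) ` set xs)"
    proof -
      have *: "(\<lambda>v. ?P v \<inter> F) ` set xs = (\<lambda>v. P v \<inter> F) ` set xs"
        by (rule image_cong) (simp_all add: P del: fun_upd_apply)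
      show ?thesis unfolding set_append image_Un * by simp
    qed
    have un: "\<Union>(?P ` set (xs @ [w])) = \<Union>(P ` set xs)"
    proof -
      have *: "?P ` set xs = P ` set xs" by (rule image_cong) (simp_all add: P del: fun_upd_apply)
      show ?thesis unfolding set_append image_Un Union_Un_distrib * by simp
    qed
    show "card ((\<lambda>v. ?P v \<inter> F) ` set (xs @ [w])) \<le> card (F \<inter> \<Union>(?P ` set (xs @ [w]))) + 1"
    proof (cases "xs = []")
      case False
      then have h: "hd xs \<in> set xs" by simp
      \<comment> \<open>The new root has the empty signature, which every earlier root already has,
        so no signature is added.\<close>
      have "{} \<in> (\<lambda>v. P v \<inter> F) ` set xs"
        using root_in[OF h] path_root[OF h] by (intro image_eqI[of _ _ "rt (hd xs)"]) auto
      then show ?thesis unfolding im un using card_signatures[OF F] by (simp add: insert_absorb)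
    qed simp
  qed
qed

text \<open>Placing a leaf directly behind its parent keeps subtrees consecutive: exactly the blocks
  containing the parent grow. A new signature can appear only if the new tree edge lies in
  \<open>F\<close>, which pays for it.\<close>

lemma rooted_forest_leaf:
  assumes R: "rooted_forest E rt xs P" and p: "p \<in> set xs" and v: "v \<notin> set xs" "rt v = rt p"
    and e: "{p, v} \<in> E"
  shows "\<exists>xs'. set xs' = insert v (set xs) \<and> rooted_forest E rt xs' (P(v := insert {p, v} (P p)))"
proof -
  interpret rooted_forest E rt xs P by (rule R)
  let ?e = "{p, v}" and ?P = "P(v := insert {p, v} (P p))"
  obtain as bs where xs: "xs = as @ p # bs" using p by (meson split_list)
  define xs' where "xs' = as @ p # v # bs"
  have set: "set xs' = insert v (set xs)" by (auto simp: xs xs'_def)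
  have P: "?P u = P u" if "u \<in> set xs" for u using that v by auto
  have Pv: "?P v = insert ?e (P p)" by simp
  have new: "?e \<notin> P u" if "u \<in> set xs" for u using path_vertices[OF that] v(1) by auto
  have pv: "p \<noteq> v" using p v by auto
  have fin: "finite (P u)" if "u \<in> set xs" for u
  proof (rule finite_subset)
    show "P u \<subseteq> Pow (set xs)" using path_vertices[OF that] by auto
  qed simp
  have split_unique: "as = as' \<and> bs = bs'" if "xs = as' @ p # bs'" for as' bs'
  proof -
    have "p \<notin> set as" "p \<notin> set bs" using distinct xs by auto
    then show ?thesis using append_Cons_eq_iff[of p as bs as' bs'] that xs by simp
  qed
  have leaf: "connected_by ((P u - ?P v) \<union> (?P v - P u)) u v" if u: "u \<in> set xs" "rt u = rt v" for u
  proof (rule connected_by_trans)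
    show "connected_by ((P u - ?P v) \<union> (?P v - P u)) u p"
      using path_connects[OF u(1) p] u(2) v(2) new[OF u(1)] by (auto elim!: connected_by_mono)
    show "connected_by ((P u - ?P v) \<union> (?P v - P u)) p v"
      using new[OF u(1)] by (intro connected_by_edge) auto
  qed
  have "rooted_forest E rt xs' ?P"
  proof (unfold_locales, unfold set)
    show "distinct xs'" using distinct v by (auto simp: xs xs'_def)
    show "?P u \<subseteq> E" if "u \<in> insert v (set xs)" for u
      using path_subset[of u] path_subset[OF p] e that by auto
    show "\<Union>(?P u) \<subseteq> insert v (set xs)" if "u \<in> insert v (set xs)" for u
      using path_vertices[of u] path_vertices[OF p] p that by (cases "u = v") auto
    show "rt u \<in> insert v (set xs)" if "u \<in> insert v (set xs)" for u
      using root_in[of u] root_in[OF p] v(2) that by auto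
    show "rt (rt u) = rt u" if "u \<in> insert v (set xs)" for u
      using root_root[of u] root_root[OF p] v(2) that by auto
    show "?P (rt u) = {}" if "u \<in> insert v (set xs)" for u
    proof (cases "u = v")
      case True
      then show ?thesis using path_root[OF p] root_in[OF p] v P[of "rt p"] by simp
    next
      case False
      then have "u \<in> set xs" using that by simp
      then show ?thesis using path_root root_in P by metis
    qed
    show "\<exists>u w. u \<in> insert v (set xs) \<and> w \<in> insert v (set xs) \<and> e = {u, w} \<and> ?P w = insert e (?P u)"
      if "x \<in> insert v (set xs)" "e \<in> ?P x" for x e
    proof (cases "e = ?e")
      case True
      show ?thesis unfolding True using p P[OF p] by (intro exI[of _ p] exI[of _ v]) simp
    next
      case False
      have "\<exists>x'. x' \<in> set xs \<and> e \<in> P x'"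
      proof (cases "x = v")
        case True
        then show ?thesis using that(2) False p by (intro exI[of _ p]) simp
      next
        case False
        then show ?thesis using that by (intro exI[of _ x]) simp
      qed
      then obtain x' where "x' \<in> set xs" "e \<in> P x'" by blast
      from path_edge[OF this] obtain u z
        where "u \<in> set xs" "z \<in> set xs" "e = {u, z}" "P z = insert e (P u)" by metis
      then show ?thesis by (intro exI[of _ u] exI[of _ z]) (simp add: P del: fun_upd_apply)
    qed
    show "(\<Sum>e\<in>?P x. \<Sum>u\<in>e. \<phi> u :: bit) = \<phi> x + \<phi> (rt x)" if "x \<in> insert v (set xs)" for x \<phi>
    proof (cases "x = v")
      case True
      have "(\<Sum>e\<in>?P v. \<Sum>u\<in>e. \<phi> u) = (\<phi> p + \<phi> v) + (\<phi> p + \<phi> (rt p))"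
        using telescope[OF p, of \<phi>] fin[OF p] new[OF p] pv by simp
      also have "\<dots> = \<phi> v + \<phi> (rt v)"
        unfolding v(2) by (cases "\<phi> p"; cases "\<phi> v") simp_all
      finally show ?thesis using True by simp
    next
      case False
      then show ?thesis using telescope[of x \<phi>] that by simp
    qed
    show "connected_by ((?P a - ?P b) \<union> (?P b - ?P a)) a b"
      if ab: "a \<in> insert v (set xs)" "b \<in> insert v (set xs)" "rt a = rt b" for a b
    proof -
      consider "a \<noteq> v" "b \<noteq> v" | "a \<noteq> v" "b = v" | "a = v" "b \<noteq> v" | "a = v" "b = v" by blast
      then show ?thesis
      proof cases
        case 1
        then show ?thesis using ab path_connects[of a b] by simp
      next
        case 2
        then show ?thesis using ab leaf[of a] by simp
      next
        case 3
        then have "connected_by ((P b - ?P v) \<union> (?P v - P b)) b v" using ab by (intro leaf) auto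
        then show ?thesis using 3 connected_by_sym by (simp add: Un_commute)
      qed simp
    qed
    show "rt a = rt b"
      if ab: "a \<in> insert v (set xs)" "b \<in> insert v (set xs)" "e \<in> ?P a" "e \<in> ?P b" for a b e
    proof -
      have *: "\<exists>a'\<in>set xs. rt a' = rt a \<and> (e \<in> P a' \<or> a = v \<and> e = ?e)"
        if "a \<in> insert v (set xs)" "e \<in> ?P a" for a
        using that p v(2) by (cases "a = v") auto
      obtain a' where a': "a' \<in> set xs" "rt a' = rt a" "e \<in> P a' \<or> a = v \<and> e = ?e" using *[OF ab(1,3)] by blast
      obtain b' where b': "b' \<in> set xs" "rt b' = rt b" "e \<in> P b' \<or> b = v \<and> e = ?e" using *[OF ab(2,4)] by blast
      show ?thesis using a' b' common_edge_root[of a' b' e] new by auto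
    qed
    show "\<exists>ys zs ws. xs' = ys @ zs @ ws \<and> {u \<in> insert v (set xs). e \<in> ?P u} = set zs" for e
    proof -
      obtain ys zs ws where d: "xs = ys @ zs @ ws" "{u \<in> set xs. e \<in> P u} = set zs"
        using below_consecutive by metis
      show ?thesis
      proof (cases "e = ?e")
        case True
        have "xs' = (as @ [p]) @ [v] @ bs" by (simp add: xs'_def)
        moreover have "{u \<in> insert v (set xs). e \<in> ?P u} = set [v]"
          unfolding True using new by auto
        ultimately show ?thesis by (intro exI conjI)
      next
        case False
        then have S: "{u \<in> insert v (set xs). e \<in> ?P u} = set zs \<union> (if p \<in> set zs then {v} else {})"
          using d(2) p v by auto
        from p d(1) consider "p \<in> set zs" | "p \<in> set ys" "p \<notin> set zs" | "p \<in> set ws" "p \<notin> set zs" by auto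
        then show ?thesis
        proof cases
          case 1
          then obtain z1 z2 where z: "zs = z1 @ p # z2" by (meson split_list)
          have "xs' = ys @ (z1 @ p # v # z2) @ ws"
            using split_unique[of "ys @ z1" "z2 @ ws"] d(1) z by (simp add: xs'_def)
          moreover have "set (z1 @ p # v # z2) = set zs \<union> (if p \<in> set zs then {v} else {})" using z by auto
          ultimately show ?thesis unfolding S by (intro exI conjI) (assumption, rule sym)
        next
          case 2
          then obtain z1 z2 where z: "ys = z1 @ p # z2" by (meson split_list)
          have "xs' = (z1 @ p # v # z2) @ zs @ ws"
            using split_unique[of z1 "z2 @ zs @ ws"] d(1) z by (simp add: xs'_def)
          then show ?thesis unfolding S using 2(2) by (intro exI conjI) (assumption, simp)
        next
          case 3
          then obtain z1 z2 where z: "ws = z1 @ p # z2" by (meson split_list)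
          have "xs' = ys @ zs @ (z1 @ p # v # z2)"
            using split_unique[of "ys @ zs @ z1" z2] d(1) z by (simp add: xs'_def)
          then show ?thesis unfolding S using 3(2) by (intro exI conjI) (assumption, simp)
        qed
      qed
    qed
    fix F :: "'a set set" assume F: "finite F"
    have im: "(\<lambda>u. ?P u \<inter> F) ` insert v (set xs) = insert (?P v \<inter> F) ((\<lambda>u. P u \<inter> F) ` set xs)"
    proof -
      have *: "(\<lambda>u. ?P u \<inter> F) ` set xs = (\<lambda>u. P u \<inter> F) ` set xs"
        by (rule image_cong) (simp_all add: P del: fun_upd_apply)
      show ?thesis unfolding image_insert * ..
    qed
    have un: "\<Union>(?P ` insert v (set xs)) = insert ?e (\<Union>(P ` set xs))"
    proof -
      have *: "?P ` set xs = P ` set xs" by (rule image_cong) (simp_all add: P del: fun_upd_apply)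
      show ?thesis unfolding image_insert * using p by auto
    qed
    show "card ((\<lambda>u. ?P u \<inter> F) ` insert v (set xs)) \<le> card (F \<inter> \<Union>(?P ` insert v (set xs))) + 1"
    proof (cases "?e \<in> F")
      case True
      have "?e \<notin> \<Union>(P ` set xs)" using new by auto
      then have "card (F \<inter> insert ?e (\<Union>(P ` set xs))) = Suc (card (F \<inter> \<Union>(P ` set xs)))"
        using True F by simp
      moreover have "card (insert (?P v \<inter> F) ((\<lambda>u. P u \<inter> F) ` set xs)) \<le> Suc (card ((\<lambda>u. P u \<inter> F) ` set xs))"
        by (simp add: card_insert_if)
      ultimately show ?thesis unfolding im un using card_signatures[OF F] by linarith
    next
      case False
      then have "?P v \<inter> F = P p \<inter> F" by auto
      then have "?P v \<inter> F \<in> (\<lambda>u. P u \<inter> F) ` set xs" using p by blast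
      then show ?thesis unfolding im un using card_signatures[OF F] False by (simp add: insert_absorb)
    qed
  qed
  then show ?thesis using set by blast
qed

text \<open>The list grows by one vertex at a time. If the root of an unlisted vertex is missing, it
  is added; otherwise some edge leaves the listed set, and its far end becomes a leaf.\<close>

lemma ex_rooted_forest:
  assumes "ugraph V E"
  obtains rt xs P where "set xs = V" "rooted_forest E rt xs P"
    "\<And>u v. u \<in> V \<Longrightarrow> v \<in> V \<Longrightarrow> rt u = rt v \<longleftrightarrow> connected_by E u v"
proof -
  define rt where "rt v = (SOME u. connected_by E v u)" for v
  have rt: "connected_by E v (rt v)" for v
    unfolding rt_def by (rule someI) (rule connected_by_refl)
  have rt_eq: "rt u = rt v \<longleftrightarrow> connected_by E u v" for u v
  proof
    assume "rt u = rt v"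
    then show "connected_by E u v"
      using connected_by_trans[OF rt[of u], of v] connected_by_sym[OF rt[of v]] by simp
  next
    assume uv: "connected_by E u v"
    have "connected_by E u = connected_by E v"
      using connected_by_trans[OF uv] connected_by_trans[OF connected_by_sym[OF uv]] by blast
    then show "rt u = rt v" by (simp only: rt_def)
  qed
  have rt_rt: "rt (rt v) = rt v" for v using connected_by_sym[OF rt[of v]] by (simp add: rt_eq)
  have closed: "v \<in> V" if "connected_by E u v" "u \<in> V" for u v
    using that unfolding connected_by_def
    by (induction rule: rtrancl_induct) (use assms in \<open>auto simp: ugraph_def\<close>)
  have fin: "finite V" using assms by (simp add: ugraph_def)
  have "\<exists>xs P. set xs \<subseteq> V \<and> card (set xs) = k \<and> rooted_forest E rt xs P" if "k \<le> card V" for k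
    using that
  proof (induction k)
    case 0
    then show ?case using rooted_forest_Nil by (intro exI[of _ "[]"]) auto
  next
    case (Suc k)
    then obtain xs P where xs: "set xs \<subseteq> V" "card (set xs) = k" "rooted_forest E rt xs P" by auto
    have rt_in: "rt u \<in> set xs" if "u \<in> set xs" for u using rooted_forest.root_in[OF xs(3) that] .
    obtain v where v: "v \<in> V" "v \<notin> set xs" using xs Suc.prems fin
      by (metis Suc_n_not_le_n subsetI subset_antisym)
    show ?case
    proof (cases "rt v \<in> set xs")
      case False
      have "rooted_forest E rt (xs @ [rt v]) (P(rt v := {}))"
      proof (rule rooted_forest_root[OF xs(3) False rt_rt])
        show "rt u \<noteq> rt v" if "u \<in> set xs" for u using rt_in[OF that] False by metis
      qed
      moreover have "set (xs @ [rt v]) \<subseteq> V" using xs(1) closed[OF rt v(1)] by auto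
      moreover have "card (set (xs @ [rt v])) = Suc k" using xs(2) False by simp
      ultimately show ?thesis by blast
    next
      case True
      have "connected_by E (rt v) v" by (rule connected_by_sym[OF rt])
      then obtain p w where pw: "p \<in> set xs" "w \<notin> set xs" "{p, w} \<in> E"
        using connected_by_leaves[of E "rt v" v "set xs"] True v(2) by blast
      moreover have "rt w = rt p" using connected_by_sym[OF connected_by_edge[OF pw(3)]] by (simp only: rt_eq)
      ultimately obtain xs' where "set xs' = insert w (set xs)" "rooted_forest E rt xs' (P(w := insert {p, w} (P p)))"
        using rooted_forest_leaf[OF xs(3)] by metis
      moreover have "w \<in> V" using closed[OF connected_by_edge[OF pw(3)]] pw(1) xs(1) by auto
      ultimately show ?thesis using xs pw
        by (intro exI[of _ xs'] exI[of _ "P(w := insert {p, w} (P p))"]) (simp del: fun_upd_apply)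
    qed
  qed
  then obtain xs P where "set xs \<subseteq> V" "card (set xs) = card V" "rooted_forest E rt xs P" by blast
  then show ?thesis using that card_subset_eq[OF fin] rt_eq by blast
qed

section \<open>Products of independent distributions\<close>


lemma prob_bind_pmf:
  "measure_pmf.prob (bind_pmf p f) A = measure_pmf.expectation p (\<lambda>x. measure_pmf.prob (f x) A)"
proof -
  have "ennreal (measure_pmf.prob (bind_pmf p f) A) = (\<integral>\<^sup>+x. ennreal (measure_pmf.prob (f x) A) \<partial>measure_pmf p)"
    by (simp flip: measure_pmf.emeasure_eq_measure)
  also have "\<dots> = ennreal (measure_pmf.expectation p (\<lambda>x. measure_pmf.prob (f x) A))"
    by (intro nn_integral_eq_integral measure_pmf.integrable_const_bound[where B = 1]) auto
  finally show ?thesis by (simp add: integral_nonneg_AE)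
qed

lemma prob_pair_pmf:
  "measure_pmf.prob (pair_pmf p q) A =
     measure_pmf.expectation p (\<lambda>x. measure_pmf.prob q {y. (x, y) \<in> A})"
  by (simp add: pair_pmf_def prob_bind_pmf[of p] vimage_def flip: map_pmf_def)

lemma prob_pair_pmf_le:
  assumes "\<And>x. x \<in> set_pmf p \<Longrightarrow> measure_pmf.prob q {y. (x, y) \<in> A} \<le> \<epsilon>"
  shows "measure_pmf.prob (pair_pmf p q) A \<le> \<epsilon>"
  unfolding prob_pair_pmf
  by (intro measure_pmf.integral_le_const measure_pmf.integrable_const_bound[where B = 1])
    (auto simp: AE_measure_pmf_iff assms)

text \<open>Deferred decisions: fix all coordinates except \<open>i\<close>, bound the conditional
  probability, then average.\<close>

lemma prob_Pi_pmf_coordinate_le: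
  assumes I: "finite I" "i \<in> I"
    and le: "\<And>\<sigma>. measure_pmf.prob (p i) {x. \<sigma>(i := x) \<in> A} \<le> \<epsilon>"
  shows "measure_pmf.prob (Pi_pmf I d p) A \<le> \<epsilon>"
proof -
  have "Pi_pmf I d p = map_pmf (\<lambda>(\<sigma>, x). \<sigma>(i := x)) (pair_pmf (Pi_pmf (I - {i}) d p) (p i))"
    using Pi_pmf_insert[of "I - {i}" i d p] I
    by (subst pair_commute_pmf) (simp add: insert_absorb map_pmf_comp case_prod_unfold)
  then show ?thesis
    by (simp add: vimage_def prob_pair_pmf_le le)
qed

lemma finite_set_Pi_pmf:
  assumes "finite I" "\<And>i. i \<in> I \<Longrightarrow> finite (set_pmf (p i))"
  shows "finite (set_pmf (Pi_pmf I d p))"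
  unfolding set_Pi_pmf[OF assms(1)] using assms by (intro finite_PiE_dflt) auto

section \<open>Exponential moments and isolation by sampling\<close>

lemma exp_minus_le_quadratic:
  fixes d :: real
  assumes "\<bar>d\<bar> \<le> 1"
  shows "exp (- d) \<le> 1 - d + d\<^sup>2"
proof (cases "d \<ge> 0")
  case True
  \<comment> \<open>The product equals \<open>1 + d ^ 3\<close>.\<close>
  have "1 \<le> (1 - d + d\<^sup>2) * (1 + d)"
    using True by (simp add: algebra_simps power2_eq_square)
  also have "\<dots> \<le> (1 - d + d\<^sup>2) * exp d"
    using True assms by (intro mult_left_mono exp_ge_add_one_self) auto
  finally show ?thesis by (simp add: exp_minus field_simps)
next
  case False
  then show ?thesis using exp_bound[of "- d"] assms by simp
qed

text \<open>The expansion is around the value \<open>b\<close> of the frequent outcome, not around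
  the mean, so the quadratic error carries the factor \<open>q\<close> of the rare one.\<close>

lemma two_point_exp_le:
  fixes q a b c :: real
  assumes q: "0 \<le> q" "q \<le> 1" and c: "\<bar>a - b\<bar> \<le> c" "c \<le> 1"
  shows "q * exp (- a) + (1 - q) * exp (- b) \<le> exp (- (q * a + (1 - q) * b) + q * c\<^sup>2)"
proof -
  define d where "d = a - b"
  have d: "\<bar>d\<bar> \<le> 1" "d\<^sup>2 \<le> c\<^sup>2" using c by (auto simp: d_def intro!: power2_le_iff_abs_le[THEN iffD2])
  have "q * exp (- a) + (1 - q) * exp (- b) = exp (- b) * (1 + q * (exp (- d) - 1))"
    by (simp add: d_def algebra_simps flip: exp_add)
  also have "\<dots> \<le> exp (- b) * exp (q * (exp (- d) - 1))"
    by (intro mult_left_mono exp_ge_add_one_self) auto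
  also have "\<dots> \<le> exp (- b) * exp (q * (- d + c\<^sup>2))"
    using exp_minus_le_quadratic[OF d(1)] d(2) q by (intro mult_left_mono) (auto intro!: mult_left_mono)
  also have "\<dots> = exp (- (q * a + (1 - q) * b) + q * c\<^sup>2)"
    by (simp add: d_def algebra_simps flip: exp_add)
  finally show ?thesis .
qed

lemma expectation_Pi_bernoulli_insert:
  fixes h :: "('i \<Rightarrow> bool) \<Rightarrow> real"
  assumes I: "finite I" "x \<notin> I" and q: "0 \<le> q x" "q x \<le> 1"
  shows "measure_pmf.expectation (Pi_pmf (insert x I) False (\<lambda>i. bernoulli_pmf (q i))) h =
    q x * measure_pmf.expectation (Pi_pmf I False (\<lambda>i. bernoulli_pmf (q i))) (\<lambda>\<sigma>. h (\<sigma>(x := True))) +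
    (1 - q x) * measure_pmf.expectation (Pi_pmf I False (\<lambda>i. bernoulli_pmf (q i))) (\<lambda>\<sigma>. h (\<sigma>(x := False)))"
proof -
  have fin: "finite (set_pmf (Pi_pmf I False (\<lambda>i. bernoulli_pmf (q i))))"
    using I by (intro finite_set_Pi_pmf) (auto intro: finite_subset[OF subset_UNIV])
  show ?thesis
    unfolding Pi_pmf_insert'[OF I]
    by (subst pmf_expectation_bind[of "{True, False}"]) (auto simp: fin q simp flip: map_pmf_def)
qed

text \<open>Concentration for functions of rare independent events: the variance proxy is the sum of the
  probabilities, not the number of events, which a bounded difference inequality would give.\<close>

lemma expectation_exp_bounded_differences:
  fixes f :: "('i \<Rightarrow> bool) \<Rightarrow> real"
  assumes "finite I" "\<And>i. i \<in> I \<Longrightarrow> 0 \<le> q i \<and> q i \<le> 1" "\<And>i. i \<in> I \<Longrightarrow> c i \<le> 1"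
    and "\<And>i \<sigma>. i \<in> I \<Longrightarrow> \<bar>f (\<sigma>(i := True)) - f (\<sigma>(i := False))\<bar> \<le> c i"
  defines "M J \<equiv> Pi_pmf J False (\<lambda>i. bernoulli_pmf (q i))"
  shows "measure_pmf.expectation (M I) (\<lambda>\<sigma>. exp (- f \<sigma>)) \<le>
    exp (- measure_pmf.expectation (M I) f + (\<Sum>i\<in>I. q i * (c i)\<^sup>2))"
  using assms(1-4)
proof (induction I arbitrary: f rule: finite_induct)
  case empty
  then show ?case by (simp add: M_def)
next
  case (insert x I)
  let ?E = "measure_pmf.expectation (M I)"
  let ?f = "\<lambda>b \<sigma>. f (\<sigma>(x := b))"
  let ?S = "\<Sum>i\<in>I. q i * (c i)\<^sup>2"
  have q: "0 \<le> q x" "q x \<le> 1" using insert.prems by auto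
  have fin: "finite (set_pmf (M I))"
    unfolding M_def using insert.hyps by (intro finite_set_Pi_pmf) (auto intro: finite_subset[OF subset_UNIV])
  note int = integrable_measure_pmf_finite[OF fin]
  have IH: "?E (\<lambda>\<sigma>. exp (- ?f b \<sigma>)) \<le> exp (- ?E (?f b) + ?S)" for b
  proof (rule insert.IH)
    fix i \<sigma> assume i: "i \<in> I"
    then have ne: "i \<noteq> x" using insert.hyps by auto
    show "\<bar>?f b (\<sigma>(i := True)) - ?f b (\<sigma>(i := False))\<bar> \<le> c i"
      unfolding fun_upd_twist[OF ne] by (rule insert.prems(3)) (rule insertI2[OF i])
  qed (use insert.prems in auto)
  \<comment> \<open>Averaging over the other coordinates preserves the difference bound, so the two
    conditional means can enter the two-point estimate.\<close>
  have "\<bar>?E (?f True) - ?E (?f False)\<bar> = \<bar>?E (\<lambda>\<sigma>. ?f True \<sigma> - ?f False \<sigma>)\<bar>"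
    by (simp add: int)
  also have "\<dots> \<le> ?E (\<lambda>\<sigma>. \<bar>?f True \<sigma> - ?f False \<sigma>\<bar>)"
    by (rule integral_abs_bound)
  also have "\<dots> \<le> c x"
    by (intro measure_pmf.integral_le_const int always_eventually allI insert.prems(3) insertI1)
  finally have c: "\<bar>?E (?f True) - ?E (?f False)\<bar> \<le> c x" .
  note split = expectation_Pi_bernoulli_insert[of _ _ q, OF insert.hyps q, folded M_def]
  have "measure_pmf.expectation (M (insert x I)) (\<lambda>\<sigma>. exp (- f \<sigma>)) \<le>
      q x * exp (- ?E (?f True) + ?S) + (1 - q x) * exp (- ?E (?f False) + ?S)"
    unfolding split using q by (intro add_mono mult_left_mono IH) auto
  also have "\<dots> = exp ?S * (q x * exp (- ?E (?f True)) + (1 - q x) * exp (- ?E (?f False)))"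
    by (simp only: exp_add) (simp only: distrib_left mult_ac)
  also have "\<dots> \<le> exp ?S * exp (- (q x * ?E (?f True) + (1 - q x) * ?E (?f False)) + q x * (c x)\<^sup>2)"
    using insert.prems by (intro mult_left_mono two_point_exp_le q c) auto
  also have "\<dots> = exp (- measure_pmf.expectation (M (insert x I)) f + (\<Sum>i\<in>insert x I. q i * (c i)\<^sup>2))"
    unfolding split using insert.hyps by (simp add: algebra_simps flip: exp_add)
  finally show ?case .
qed

text \<open>The sampling rate is the reciprocal of the cardinality up to a factor of two, so the
  expected number of hits is at least 1 and the binomial weight at 1 stays above a constant.\<close>

lemma prob_exactly_one_ge:
  assumes D: "finite I" "D \<subseteq> I" and q: "\<And>i. i \<in> D \<Longrightarrow> q i = 1 / 2 ^ j"
    and card: "2 ^ j \<le> card D" "card D < 2 ^ Suc j"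
  shows "measure_pmf.prob (Pi_pmf I False (\<lambda>i. bernoulli_pmf (q i))) {\<sigma>. card {i\<in>D. \<sigma> i} = 1} \<ge> 1 / 16"
proof -
  let ?M = "\<lambda>I. Pi_pmf I False (\<lambda>i. bernoulli_pmf (q i))"
  define t :: real where "t = 1 / 2 ^ j"
  have t: "0 < t" "t \<le> 1" by (auto simp: t_def)
  have fD: "finite D" using D finite_subset by auto
  have "measure_pmf.prob (?M I) {\<sigma>. card {i\<in>D. \<sigma> i} = 1} = measure_pmf.prob (?M D) {\<sigma>. card {i\<in>D. \<sigma> i} = 1}"
  proof -
    have eq: "{i\<in>D. if i \<in> D then \<sigma> i else False} = {i\<in>D. \<sigma> i}" for \<sigma> :: "'a \<Rightarrow> bool" by auto
    show ?thesis unfolding Pi_pmf_subset[OF D, of False] by (simp add: vimage_def eq)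
  qed
  also have "?M D = Pi_pmf D False (\<lambda>_. bernoulli_pmf t)"
    using q by (intro Pi_pmf_cong) (auto simp: t_def)
  also have "measure_pmf.prob \<dots> {\<sigma>. card {i\<in>D. \<sigma> i} = 1} = pmf (binomial_pmf (card D) t) 1"
    using t by (subst binomial_pmf_altdef'[OF fD refl, of _ False])
      (simp_all add: pmf_map vimage_def)
  also have "\<dots> = real (card D) * t * (1 - t) ^ (card D - 1)"
    using t by (subst pmf_binomial) auto
  finally have eq: "measure_pmf.prob (?M I) {\<sigma>. card {i\<in>D. \<sigma> i} = 1} = \<dots>" .
  have "real (2 ^ j) \<le> real (card D)" using card(1) by (simp only: of_nat_le_iff)
  then have ge1: "1 \<le> real (card D) * t" by (simp add: t_def field_simps)
  have "1 / 16 \<le> (1 - t) ^ (card D - 1)"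
  proof (cases j)
    case 0
    then have "card D = 1" using card by simp
    then show ?thesis by simp
  next
    case (Suc i)
    have t2: "t = 1 / (2 * 2 ^ i)" by (simp add: t_def Suc)
    \<comment> \<open>Here \<open>2 ^ i\<close> is \<open>2 ^ j / 2\<close>. Bernoulli bounds
      \<open>(1 - t) ^ (2 ^ i)\<close> below by one half, and \<open>card D - 1\<close> is less than
      four such exponents, which gives 1/16.\<close>
    have "1 / 2 \<le> 1 + real (2 ^ i) * (- t)" by (simp add: t2)
    also have "\<dots> \<le> (1 + - t) ^ (2 ^ i)" using t by (intro Bernoulli_inequality) auto
    finally have "(1 / 2) ^ 4 \<le> ((1 - t) ^ (2 ^ i)) ^ 4" by (intro power_mono) auto
    also have "\<dots> = (1 - t) ^ (2 ^ i * 4)" by (simp flip: power_mult)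
    also have "\<dots> \<le> (1 - t) ^ (card D - 1)" using t card Suc by (intro power_decreasing) auto
    finally show ?thesis by (simp add: power_divide)
  qed
  also have "\<dots> \<le> real (card D) * t * (1 - t) ^ (card D - 1)"
    using mult_right_mono[OF ge1, of "(1 - t) ^ (card D - 1)"] t by simp
  finally show ?thesis unfolding eq .
qed

section \<open>Components and their merging\<close>


definition pairs :: "'a set \<Rightarrow> 'a set set" where
  "pairs V = {e. e \<subseteq> V \<and> card e = 2}"

definition links_on :: "'a set \<Rightarrow> 'a set set \<Rightarrow> bool" where
  "links_on V H \<longleftrightarrow> (\<forall>e\<in>H. \<exists>x\<in>V. \<exists>y\<in>V. e = {x, y})"

definition component_of :: "'a set \<Rightarrow> 'a set set \<Rightarrow> 'a \<Rightarrow> 'a set" where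
  "component_of V H v = {u \<in> V. connected_by H v u}"

definition link_components :: "'a set \<Rightarrow> 'a set set \<Rightarrow> 'a set set" where
  "link_components V H = component_of V H ` V"

text \<open>A component without a leaving edge can never merge again, so the number of all
  components need not fall; only this count has to become small.\<close>

definition active_components :: "'a set \<Rightarrow> 'a set set \<Rightarrow> 'a set set \<Rightarrow> 'a set set" where
  "active_components V G H = {C \<in> link_components V H. \<exists>e\<in>G. crosses e C}"

lemma pairs_cases:
  assumes "e \<in> pairs V"
  obtains x y where "x \<in> V" "y \<in> V" "x \<noteq> y" "e = {x, y}"
  using assms by (auto simp: pairs_def card_2_iff)

lemma links_on_pairs: "M \<subseteq> pairs V \<Longrightarrow> links_on V M"
  unfolding links_on_def by (meson pairs_cases subsetD)

lemma links_on_Un: "links_on V (H \<union> M) \<longleftrightarrow> links_on V H \<and> links_on V M"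
  unfolding links_on_def by blast

lemma crosses_pairs_cases:
  assumes "e \<in> pairs V" "crosses e C"
  obtains x y where "x \<in> V" "y \<in> V" "e = {x, y}" "x \<in> C" "y \<notin> C"
proof -
  from assms(1) obtain x y where xy: "x \<in> V" "y \<in> V" "e = {x, y}" by (rule pairs_cases)
  then show ?thesis using assms(2) that[of x y] that[of y x]
    by (cases "x \<in> C") (auto simp: crosses_pair insert_commute)
qed

lemma component_of_refl: "v \<in> V \<Longrightarrow> v \<in> component_of V H v"
  by (simp add: component_of_def)

lemma component_of_in_components: "v \<in> V \<Longrightarrow> component_of V H v \<in> link_components V H"
  by (simp add: link_components_def)

lemma component_of_eqI:
  assumes "u \<in> component_of V H v"
  shows "component_of V H u = component_of V H v"
proof -
  have uv: "connected_by H v u" using assms by (simp add: component_of_def)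
  show ?thesis
    unfolding component_of_def
    using connected_by_trans[OF uv] connected_by_trans[OF connected_by_sym[OF uv]] by blast
qed

lemma components_eq_component_of: "C \<in> link_components V H \<Longrightarrow> v \<in> C \<Longrightarrow> C = component_of V H v"
  by (auto simp: link_components_def dest: component_of_eqI)

lemma components_nonempty: "C \<in> link_components V H \<Longrightarrow> C \<noteq> {}"
  using component_of_refl by (fastforce simp: link_components_def)

lemma finite_components: "finite V \<Longrightarrow> finite (link_components V H)"
  by (simp add: link_components_def)

lemma card_components_le: "finite V \<Longrightarrow> card (link_components V H) \<le> card V"
  by (simp add: link_components_def card_image_le)

lemma finite_active: "finite V \<Longrightarrow> finite (active_components V G H)"
  by (simp add: active_components_def finite_components)

lemma component_of_mono: "H \<subseteq> H' \<Longrightarrow> component_of V H v \<subseteq> component_of V H' v"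
  by (auto simp: component_of_def intro: connected_by_mono)

lemma closed_under_components:
  assumes "links_on V H" "C \<in> link_components V H"
  shows "closed_under H C"
  unfolding closed_under_def
proof
  fix e assume e: "e \<in> H"
  then obtain x y where xy: "x \<in> V" "y \<in> V" "e = {x, y}" using assms(1) unfolding links_on_def by blast
  obtain v where v: "C = component_of V H v" using assms(2) by (auto simp: link_components_def)
  have "connected_by H x y" using e xy by (simp add: connected_by_edge)
  then have "connected_by H v x \<longleftrightarrow> connected_by H v y"
    using connected_by_sym connected_by_trans by metis
  then show "\<not> crosses e C" by (simp add: xy v crosses_pair component_of_def)
qed

lemma closed_under_component_subset:
  assumes "closed_under H C" "v \<in> C"
  shows "component_of V H v \<subseteq> C"
  using closed_under_connected[OF assms(1)] assms(2) by (auto simp: component_of_def)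

text \<open>Charge every new component to the old active components inside it. An active new one
  contains at least one, and at least two if one of them lies in \<open>Y\<close>; in each case
  twice the size of the fibre covers the left-hand side.\<close>

lemma active_merge:
  assumes V: "finite V" and H: "links_on V H" and G: "G \<subseteq> pairs V" and M: "M \<subseteq> G"
    and Y: "Y \<subseteq> active_components V G H" "\<And>C. C \<in> Y \<Longrightarrow> \<exists>e\<in>M. crosses e C"
  shows "2 * card (active_components V G (H \<union> M)) + card Y \<le> 2 * card (active_components V G H)"
proof -
  let ?A = "active_components V G H" and ?A' = "active_components V G (H \<union> M)" and ?D = "link_components V (H \<union> M)"
  define fib where "fib D = {C \<in> ?A. C \<subseteq> D}" for D
  have fA: "finite ?A" "finite ?A'" "finite ?D" using V by (simp_all add: finite_active finite_components)
  have fY: "finite Y" using Y(1) fA(1) finite_subset by blast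
  have ffib: "finite (fib D)" for D using fA by (simp add: fib_def)
  have H': "links_on V (H \<union> M)"
    using H links_on_pairs M G by (auto simp: links_on_Un)
  have sub: "component_of V H v \<subseteq> D" if "D \<in> ?D" "v \<in> D" for D v
    using component_of_mono[of H "H \<union> M" V v] components_eq_component_of[OF that] by simp
  have disj: "fib D \<inter> fib D' = {}" if "D \<in> ?D" "D' \<in> ?D" "D \<noteq> D'" for D D'
  proof (rule equals0I)
    fix C assume C: "C \<in> fib D \<inter> fib D'"
    then have "C \<noteq> {}" using components_nonempty by (auto simp: fib_def active_components_def)
    then obtain v where "v \<in> D" "v \<in> D'" using C by (auto simp: fib_def)
    then show False using that components_eq_component_of by metis
  qed
  have cover: "\<exists>D\<in>?D. C \<in> fib D" if "C \<in> ?A" for C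
  proof -
    have C: "C \<in> link_components V H" using that by (simp add: active_components_def)
    then obtain v where v: "v \<in> V" "C = component_of V H v" by (auto simp: link_components_def)
    then show ?thesis
      using that component_of_mono[of H "H \<union> M" V v]
      by (intro bexI[of _ "component_of V (H \<union> M) v"]) (auto simp: fib_def link_components_def)
  qed
  have cross_active: "component_of V H x \<in> ?A"
    if "{x, y} \<in> G" "x \<in> V" "y \<notin> component_of V H x" for x y
    using that component_of_refl[of x V H]
    by (auto simp: active_components_def crosses_pair component_of_in_components intro!: bexI[of _ "{x, y}"])
  have A_card: "card ?A = (\<Sum>D\<in>?D. card (fib D))"
  proof -
    have "?A = (\<Union>D\<in>?D. fib D)" using cover by (auto simp: fib_def)
    then show ?thesis using disj fA ffib by (simp add: card_UN_disjoint)
  qed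
  have Y_card: "card Y = (\<Sum>D\<in>?D. card (fib D \<inter> Y))"
  proof -
    have "Y = (\<Union>D\<in>?D. fib D \<inter> Y)" using cover Y(1) by blast
    moreover have "card (\<Union>D\<in>?D. fib D \<inter> Y) = (\<Sum>D\<in>?D. card (fib D \<inter> Y))"
      using disj fA ffib by (intro card_UN_disjoint) blast+
    ultimately show ?thesis by simp
  qed
  have A'_card: "card ?A' = (\<Sum>D\<in>?D. if D \<in> ?A' then 1 else 0)"
  proof -
    have "{D \<in> ?D. D \<in> ?A'} = ?A'" by (auto simp: active_components_def)
    then show ?thesis using fA by (simp add: sum.If_cases Int_def)
  qed
  have "2 * (if D \<in> ?A' then 1 else 0) + card (fib D \<inter> Y) \<le> 2 * card (fib D)" if D: "D \<in> ?D" for D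
  proof (cases "D \<in> ?A'")
    case False
    have "card (fib D \<inter> Y) \<le> card (fib D)" using ffib by (intro card_mono) auto
    then show ?thesis using False by simp
  next
    case True
    then obtain e where e: "e \<in> G" "crosses e D" by (auto simp: active_components_def)
    obtain x y where xy: "x \<in> V" "y \<in> V" "e = {x, y}" "x \<in> D" "y \<notin> D"
      using e(2) by (rule crosses_pairs_cases[OF subsetD[OF G e(1)]])
    have x: "component_of V H x \<in> fib D"
      using cross_active[of x y] sub[OF D xy(4)] xy e by (auto simp: fib_def)
    show ?thesis
    proof (cases "fib D \<inter> Y = {}")
      case True
      have "1 \<le> card (fib D)" using x ffib by (metis One_nat_def Suc_leI card_gt_0_iff empty_iff)
      then show ?thesis using True by simp
    next
      case False
      then obtain C where C: "C \<in> fib D" "C \<in> Y" by auto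
      obtain e where e: "e \<in> M" "crosses e C" using Y(2)[OF C(2)] by auto
      obtain x y where xy: "x \<in> V" "y \<in> V" "e = {x, y}" "x \<in> C" "y \<notin> C"
        using e(2) by (rule crosses_pairs_cases[OF subsetD[OF G subsetD[OF M e(1)]]])
      have eG: "{y, x} \<in> G" using e M xy by (auto simp: insert_commute)
      have CH: "C \<in> link_components V H" using C by (simp add: fib_def active_components_def)
      \<comment> \<open>The edge of \<open>M\<close> that leaves \<open>C\<close> also leaves the
        component of its far end. That component is therefore active, and it lies in
        \<open>D\<close> because \<open>D\<close> is closed under \<open>M\<close>.\<close>
      have "x \<notin> component_of V H y"
        using components_eq_component_of[OF CH xy(4)] component_of_eqI[of x V H y]
          component_of_refl[OF xy(2), of H] xy(5) by auto
      then have yA: "component_of V H y \<in> ?A" using cross_active[OF eG] xy by simp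
      have "\<not> crosses e D" using closed_under_components[OF H' D] e by (simp add: closed_under_def)
      moreover have "x \<in> D" using C xy by (auto simp: fib_def)
      ultimately have "y \<in> D" using xy by (simp add: crosses_pair)
      then have "component_of V H y \<in> fib D" using sub[OF D] yA by (simp add: fib_def)
      moreover have "component_of V H y \<noteq> C" using xy component_of_refl by metis
      ultimately have "card {component_of V H y, C} \<le> card (fib D)"
        using C ffib by (intro card_mono) auto
      then have "2 \<le> card (fib D)" using \<open>component_of V H y \<noteq> C\<close> by simp
      moreover have "card (fib D \<inter> Y) \<le> card (fib D)" using ffib by (intro card_mono) auto
      ultimately show ?thesis using \<open>D \<in> ?A'\<close> by simp
    qed
  qed
  then have "(\<Sum>D\<in>?D. 2 * (if D \<in> ?A' then 1 else 0) + card (fib D \<inter> Y)) \<le> (\<Sum>D\<in>?D. 2 * card (fib D))"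
    by (rule sum_mono)
  then show ?thesis
    unfolding A_card Y_card A'_card by (simp add: sum.distrib sum_distrib_left)
qed

text \<open>Dropping inactive components from \<open>C\<close> does not change its cut in
  \<open>G\<close>, as no edge of \<open>G\<close> leaves them. The union bound over cuts then
  ranges over sets of active components only.\<close>

lemma crosses_active_Union:
  assumes V: "C \<subseteq> V" "closed_under H C" and e: "e \<in> G" "e \<in> pairs V"
  shows "crosses e (\<Union>{D \<in> active_components V G H. D \<subseteq> C}) \<longleftrightarrow> crosses e C"
proof -
  let ?U = "\<Union>{D \<in> active_components V G H. D \<subseteq> C}"
  have in_U: "x \<in> ?U" if "{x, y} = e" "x \<in> C" "y \<notin> component_of V H x" for x y
  proof -
    have x: "x \<in> V" using that V by auto
    have "component_of V H x \<in> active_components V G H"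
      using that(1,3) e(1) component_of_refl[OF x, of H] component_of_in_components[OF x, of H]
      by (auto simp: active_components_def crosses_pair intro!: bexI[of _ e])
    moreover have "component_of V H x \<subseteq> C" by (rule closed_under_component_subset[OF V(2) that(2)])
    ultimately show ?thesis using component_of_refl[OF x] by blast
  qed
  show ?thesis
  proof
    assume "crosses e C"
    then obtain x y where xy: "x \<in> V" "y \<in> V" "e = {x, y}" "x \<in> C" "y \<notin> C"
      by (rule crosses_pairs_cases[OF e(2)])
    have "y \<notin> component_of V H x" using closed_under_component_subset[OF V(2) xy(4)] xy(5) by blast
    then have "x \<in> ?U" using in_U[of x y] xy by blast
    moreover have "y \<notin> ?U" using xy by auto
    ultimately show "crosses e ?U" using xy by (simp add: crosses_pair)
  next
    assume "crosses e ?U"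
    then obtain x y where xy: "x \<in> V" "y \<in> V" "e = {x, y}" "x \<in> ?U" "y \<notin> ?U"
      by (rule crosses_pairs_cases[OF e(2)])
    from xy(4) obtain D where D: "D \<in> link_components V H" "D \<in> active_components V G H" "D \<subseteq> C" "x \<in> D"
      unfolding active_components_def by blast
    have "y \<notin> C"
    proof
      assume y: "y \<in> C"
      have "x \<notin> component_of V H y"
        using components_eq_component_of[OF D(1,4)] component_of_eqI[of x V H y]
          component_of_refl[OF xy(2), of H] xy(5) D by blast
      then show False using in_U[of y x] xy y by (auto simp: insert_commute)
    qed
    then show "crosses e C" using xy D by (auto simp: crosses_pair)
  qed
qed

lemma card_active_crossed_le:
  assumes "e \<in> pairs V"
  shows "card {C \<in> active_components V G H. crosses e C} \<le> 2"
proof -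
  obtain x y where xy: "x \<in> V" "y \<in> V" "e = {x, y}" using assms by (rule pairs_cases)
  have "{C \<in> active_components V G H. crosses e C} \<subseteq> {component_of V H x, component_of V H y}"
    using components_eq_component_of by (fastforce simp: active_components_def xy crosses_pair)
  then have "card {C \<in> active_components V G H. crosses e C} \<le> card {component_of V H x, component_of V H y}"
    by (intro card_mono) auto
  also have "\<dots> \<le> 2" by (simp add: card_insert_if)
  finally show ?thesis .
qed

lemma card_components_fibres_le:
  assumes "finite V"
  shows "card (link_components V {{u, v} | u v. u \<in> V \<and> v \<in> V \<and> g u = g v}) \<le> card (g ` V)"
proof -
  let ?H = "{{u, v} | u v. u \<in> V \<and> v \<in> V \<and> g u = g v}"
  have "component_of V ?H v = {u \<in> V. g u = g v}" if v: "v \<in> V" for v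
  proof (intro equalityI subsetI)
    fix u assume "u \<in> component_of V ?H v"
    then have u: "u \<in> V" "connected_by ?H v u" by (auto simp: component_of_def)
    have "closed_under ?H {u \<in> V. g u = g v}" by (auto simp: closed_under_def crosses_pair)
    then show "u \<in> {u \<in> V. g u = g v}" using closed_under_connected[OF _ u(2)] v by blast
  next
    fix u assume u: "u \<in> {u \<in> V. g u = g v}"
    then have "{v, u} \<in> ?H" using v by (intro CollectI exI[of _ v] exI[of _ u]) simp
    then have "connected_by ?H v u" by (rule connected_by_edge)
    then show "u \<in> component_of V ?H v" using u unfolding component_of_def by simp
  qed
  then have "link_components V ?H = (\<lambda>s. {u \<in> V. g u = s}) ` g ` V"
    unfolding link_components_def by (simp add: image_image)
  then show ?thesis using card_image_le[of "g ` V"] assms by simp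
qed

section \<open>One round of sketches\<close>


text \<open>The decoder does not know the graph, so it compares with the codewords of all pairs of
  vertices; links outside \<open>G\<close> have to be excluded by probability.\<close>

definition decoded_links ::
  "'a set \<Rightarrow> nat \<Rightarrow> nat \<Rightarrow> ('a set \<Rightarrow> nat \<Rightarrow> vec) \<Rightarrow> (nat \<Rightarrow> 'a set \<Rightarrow> vec) \<Rightarrow> 'a set set \<Rightarrow> 'a set set" where
  "decoded_links V J N w sk H =
     {e \<in> pairs V. \<exists>C\<in>link_components V H. \<exists>j<J. \<exists>k<N. sk j C = w e k}"

text \<open>In one round, edge \<open>e\<close> is sampled at level \<open>j\<close> iff \<open>\<sigma> (j, e)\<close>, with codeword
  \<open>w e (\<rho> (j, e))\<close>.\<close>

definition round_vec :: "('a set \<Rightarrow> nat \<Rightarrow> vec) \<Rightarrow>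
    (nat \<times> 'a set \<Rightarrow> bool) \<times> (nat \<times> 'a set \<Rightarrow> nat) \<Rightarrow> nat \<Rightarrow> 'a set \<Rightarrow> vec" where
  "round_vec w \<omega>' j e = (if fst \<omega>' (j, e) then w e (snd \<omega>' (j, e)) else 0)"

definition cut_sum :: "'a set set \<Rightarrow> ('a set \<Rightarrow> vec) \<Rightarrow> 'a set \<Rightarrow> vec" where
  "cut_sum G r C = (\<Sum>e\<in>{e\<in>G. crosses e C}. r e)"

definition samples_pmf :: "nat \<Rightarrow> 'a set set \<Rightarrow> (nat \<times> 'a set \<Rightarrow> bool) pmf" where
  "samples_pmf J E = Pi_pmf ({..<J} \<times> E) False (\<lambda>i. bernoulli_pmf (1 / 2 ^ fst i))"

definition round_pmf :: "nat \<Rightarrow> nat \<Rightarrow> 'a set set \<Rightarrow>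
    ((nat \<times> 'a set \<Rightarrow> bool) \<times> (nat \<times> 'a set \<Rightarrow> nat)) pmf" where
  "round_pmf J N E = pair_pmf (samples_pmf J E) (Pi_pmf ({..<J} \<times> E) 0 (\<lambda>_. pmf_of_set {..<N}))"

lemma finite_set_samples_pmf: "finite E \<Longrightarrow> finite (set_pmf (samples_pmf J E))"
  unfolding samples_pmf_def by (intro finite_set_Pi_pmf) (auto intro: finite_subset[OF subset_UNIV])

lemma prob_le_of_support:
  assumes "\<And>x. x \<in> set_pmf p \<Longrightarrow> x \<in> A \<Longrightarrow> x \<in> B"
  shows "measure_pmf.prob p A \<le> measure_pmf.prob p B"
proof -
  have "measure_pmf.prob p A = measure_pmf.prob p (A \<inter> set_pmf p)"
    by (simp add: measure_Int_set_pmf)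
  also have "\<dots> \<le> measure_pmf.prob p B"
    using assms by (intro measure_pmf.finite_measure_mono) auto
  finally show ?thesis .
qed

lemma prob_uniform_le:
  assumes "N > 0" "card {k. k < N \<and> P k} \<le> c"
  shows "measure_pmf.prob (pmf_of_set {..<N}) {k. P k} \<le> real c / real N"
proof -
  have "{..<N} \<inter> {k. P k} = {k. k < N \<and> P k}" by auto
  moreover have "{..<N} \<noteq> {}" using assms(1) by auto
  ultimately have "measure_pmf.prob (pmf_of_set {..<N}) {k. P k} = real (card {k. k < N \<and> P k}) / real N"
    using measure_pmf_of_set[of "{..<N}" "{k. P k}"] by simp
  also have "\<dots> \<le> real c / real N"
    using assms(2) by (intro divide_right_mono) simp_all
  finally show ?thesis .
qed

lemma ex_dyadic_level:
  assumes "1 \<le> (m :: nat)" "m < 2 ^ J"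
  shows "\<exists>j<J. 2 ^ j \<le> m \<and> m < 2 ^ Suc j"
proof -
  obtain j where j: "2 ^ j \<le> m" "m < 2 ^ Suc j"
    using ex_power_ivl1[of 2 m] assms(1) by auto
  have "(2 :: nat) ^ j < 2 ^ J" using j(1) assms(2) by (rule le_less_trans)
  then show ?thesis using j by (metis one_less_numeral_iff power_strict_increasing_iff semiring_norm(76))
qed

text \<open>\<open>E\<close> indexes the randomness, which is drawn before the faults are known;
  \<open>G\<close> is what the faults leave, and the analysed cuts are cuts of \<open>G\<close>. The
  bound on \<open>card E\<close> guarantees a matching level for every cut size.\<close>

locale boruvka =
  fixes V :: "'a set" and E G :: "'a set set" and J N :: nat and w :: "'a set \<Rightarrow> nat \<Rightarrow> vec"
  assumes V: "finite V" and E: "E \<subseteq> pairs V" and G: "G \<subseteq> E" and card_E: "card E < 2 ^ J"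
    and N: "N > 0"
    and w_inj: "inj_on (\<lambda>(e, k). w e k) (pairs V \<times> {..<N})"
    and w_nonzero: "e \<in> pairs V \<Longrightarrow> k < N \<Longrightarrow> w e k \<noteq> 0"
    and w_sidon: "sidon ((\<lambda>(e, k). w e k) ` (pairs V \<times> {..<N}))"
begin

abbreviation W :: "vec set" where
  "W \<equiv> (\<lambda>(e, k). w e k) ` (pairs V \<times> {..<N})"

lemma finite_pairs: "finite (pairs V)"
  using V by (auto simp: pairs_def intro: finite_subset[of _ "Pow V"])

lemma finite_E: "finite E"
  using E finite_pairs finite_subset by blast

lemma finite_G: "finite G"
  using G finite_E finite_subset by blast

lemma G_pairs: "G \<subseteq> pairs V"
  using E G by blast

lemma w_eq_iff: "e \<in> pairs V \<Longrightarrow> e' \<in> pairs V \<Longrightarrow> k < N \<Longrightarrow> k' < N \<Longrightarrow> w e k = w e' k' \<longleftrightarrow> e = e' \<and> k = k'"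
  using w_inj by (auto simp: inj_on_def)

lemma finite_W: "finite W"
  using finite_pairs by simp

definition links where
  "links \<omega>' H = decoded_links V J N w (\<lambda>j. cut_sum G (round_vec w \<omega>' j)) H"

lemma links_pairs: "links \<omega>' H \<subseteq> pairs V"
  by (auto simp: links_def decoded_links_def)

lemma set_ids:
  assumes "\<rho> \<in> set_pmf (Pi_pmf ({..<J} \<times> E) 0 (\<lambda>_. pmf_of_set {..<N}))"
  shows "\<rho> i < N"
proof -
  have "finite ({..<J} \<times> E)" using finite_E by simp
  then have "\<rho> \<in> PiE_dflt ({..<J} \<times> E) 0 (set_pmf \<circ> (\<lambda>_. pmf_of_set {..<N}))"
    using assms by (simp only: set_Pi_pmf)
  moreover have "set_pmf (pmf_of_set {..<N}) = {..<N}" using N by (intro set_pmf_of_set) auto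
  ultimately have "\<rho> \<in> PiE_dflt ({..<J} \<times> E) 0 (\<lambda>_. {..<N})" by (simp only: o_def)
  then have "(i \<in> {..<J} \<times> E \<longrightarrow> \<rho> i \<in> {..<N}) \<and> (i \<notin> {..<J} \<times> E \<longrightarrow> \<rho> i = 0)"
    unfolding PiE_dflt_def mem_Collect_eq by (rule spec)
  \<comment> \<open>Off the index set the value is the default 0, which is below \<open>N\<close> as
    well.\<close>
  then show ?thesis using N by (cases "i \<in> {..<J} \<times> E") simp_all
qed

text \<open>Whatever the other codewords are, the codeword of \<open>b\<close> makes the sum over \<open>A - {a}\<close> nonzero except
  for one choice, and then at most two codewords of \<open>a\<close> complete this sum to a codeword.\<close>

lemma prob_sum_in_code_le:
  assumes j: "j < J" and A: "A \<subseteq> E" "a \<in> A" "b \<in> A" "a \<noteq> b"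
  shows "measure_pmf.prob (Pi_pmf ({..<J} \<times> E) 0 (\<lambda>_. pmf_of_set {..<N}))
    {\<rho>. (\<Sum>e\<in>A. w e (\<rho> (j, e))) \<in> W} \<le> 3 / real N"
proof -
  let ?M = "Pi_pmf ({..<J} \<times> E) 0 (\<lambda>_. pmf_of_set {..<N})"
  define S where "S B \<rho> = (\<Sum>e\<in>B. w e (\<rho> (j, e)))" for B and \<rho> :: "nat \<times> 'a set \<Rightarrow> nat"
  have fA: "finite A" using A finite_E finite_subset by blast
  have ab: "a \<in> pairs V" "b \<in> pairs V" using A E by auto
  have I: "finite ({..<J} \<times> E)" "(j, a) \<in> {..<J} \<times> E" "(j, b) \<in> {..<J} \<times> E"
    using finite_E j A by auto
  have S_upd: "S B (\<rho>((j, x) := k)) = w x k + S (B - {x}) \<rho>" if "x \<in> B" "B \<subseteq> A" for B x k \<rho>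
  proof -
    have "finite B" using that fA finite_subset by blast
    then have "S B (\<rho>((j, x) := k)) = w x k + S (B - {x}) (\<rho>((j, x) := k))"
      using that by (simp add: S_def sum.remove)
    also have "S (B - {x}) (\<rho>((j, x) := k)) = S (B - {x}) \<rho>"
      unfolding S_def by (intro sum.cong) auto
    finally show ?thesis .
  qed
  have B0: "measure_pmf.prob ?M {\<rho>. S (A - {a}) \<rho> = 0} \<le> real 1 / real N"
  proof (rule prob_Pi_pmf_coordinate_le[OF I(1,3)])
    fix \<rho> :: "nat \<times> 'a set \<Rightarrow> nat"
    have "card {k. k < N \<and> \<rho>((j, b) := k) \<in> {\<rho>. S (A - {a}) \<rho> = 0}} \<le> 1"
      unfolding One_nat_def
    proof (subst card_le_Suc0_iff_eq, simp, intro ballI)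
      fix k k' assume k: "k \<in> {k. k < N \<and> \<rho>((j, b) := k) \<in> {\<rho>. S (A - {a}) \<rho> = 0}}"
        "k' \<in> {k. k < N \<and> \<rho>((j, b) := k) \<in> {\<rho>. S (A - {a}) \<rho> = 0}}"
      have "b \<in> A - {a}" using A by auto
      then have "w b k + S (A - {a} - {b}) \<rho> = w b k' + S (A - {a} - {b}) \<rho>"
        using k S_upd[of b "A - {a}" \<rho>] by simp
      then show "k = k'" using k w_eq_iff[OF ab(2) ab(2)] by simp
    qed
    then show "measure_pmf.prob (pmf_of_set {..<N}) {k. \<rho>((j, b) := k) \<in> {\<rho>. S (A - {a}) \<rho> = 0}} \<le> real 1 / real N"
      by (rule prob_uniform_le[OF N])
  qed
  have B1: "measure_pmf.prob ?M {\<rho>. S (A - {a}) \<rho> \<noteq> 0 \<and> S A \<rho> \<in> W} \<le> real 2 / real N"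
  proof (rule prob_Pi_pmf_coordinate_le[OF I(1,2)])
    fix \<rho> :: "nat \<times> 'a set \<Rightarrow> nat"
    let ?y = "S (A - {a}) \<rho>"
    let ?K = "{k. k < N \<and> \<rho>((j, a) := k) \<in> {\<rho>. S (A - {a}) \<rho> \<noteq> 0 \<and> S A \<rho> \<in> W}}"
    have upd: "S (A - {a}) (\<rho>((j, a) := k)) = ?y" for k
      unfolding S_def by (intro sum.cong) auto
    have K: "?K = {k. k < N \<and> ?y \<noteq> 0 \<and> w a k + ?y \<in> W}"
      using A S_upd[of a A \<rho>] upd by simp
    have "card ?K \<le> 2"
    proof (cases "?y = 0")
      case False
      have "inj_on (w a) ?K" using w_eq_iff[OF ab(1) ab(1)] by (auto simp: inj_on_def)
      then have "card ?K = card (w a ` ?K)" by (simp add: card_image)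
      also have "\<dots> \<le> card {x \<in> W. x + ?y \<in> W}"
        unfolding K using ab finite_W by (intro card_mono) auto
      also have "\<dots> \<le> 2" by (rule sidon_translate_card[OF w_sidon finite_W False])
      finally show ?thesis .
    next
      case True
      show ?thesis unfolding K using True by simp
    qed
    then show "measure_pmf.prob (pmf_of_set {..<N})
        {k. \<rho>((j, a) := k) \<in> {\<rho>. S (A - {a}) \<rho> \<noteq> 0 \<and> S A \<rho> \<in> W}} \<le> real 2 / real N"
      by (rule prob_uniform_le[OF N])
  qed
  have "measure_pmf.prob ?M {\<rho>. S A \<rho> \<in> W} \<le>
      measure_pmf.prob ?M ({\<rho>. S (A - {a}) \<rho> = 0} \<union> {\<rho>. S (A - {a}) \<rho> \<noteq> 0 \<and> S A \<rho> \<in> W})"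
    by (intro measure_pmf.finite_measure_mono) auto
  also have "\<dots> \<le> real 1 / real N + real 2 / real N"
    by (intro order_trans[OF measure_Un_le] add_mono B0 B1) auto
  also have "\<dots> = 3 / real N" by (simp flip: add_divide_distrib)
  finally show ?thesis by (simp add: S_def)
qed

lemma cut_sum_round_vec:
  "cut_sum G (round_vec w (\<sigma>, \<rho>) j) C = (\<Sum>e\<in>{e \<in> G. crosses e C \<and> \<sigma> (j, e)}. w e (\<rho> (j, e)))"
  unfolding cut_sum_def round_vec_def using finite_G
  by (auto simp: sum.If_cases intro!: sum.cong)

text \<open>Fix the sampled edges of the cut. None gives the zero vector, which is no codeword; one
  gives the codeword of a true edge; only the sum of two or more can mislead.\<close>

lemma prob_false_link_at_le:
  assumes j: "j < J"
  shows "measure_pmf.prob (round_pmf J N E)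
    {\<omega>'. \<exists>e\<in>pairs V - G. \<exists>k<N. cut_sum G (round_vec w \<omega>' j) C = w e k} \<le> 3 / real N"
  unfolding round_pmf_def
proof (rule prob_pair_pmf_le)
  fix \<sigma> :: "nat \<times> 'a set \<Rightarrow> bool"
  let ?M = "Pi_pmf ({..<J} \<times> E) 0 (\<lambda>_. pmf_of_set {..<N})"
  define A where "A = {e \<in> G. crosses e C \<and> \<sigma> (j, e)}"
  have A: "finite A" "A \<subseteq> G" using finite_G by (auto simp: A_def)
  have *: "(\<sigma>, \<rho>) \<in> {\<omega>'. \<exists>e\<in>pairs V - G. \<exists>k<N. cut_sum G (round_vec w \<omega>' j) C = w e k} \<longleftrightarrow>
      (\<exists>e\<in>pairs V - G. \<exists>k<N. (\<Sum>e\<in>A. w e (\<rho> (j, e))) = w e k)" for \<rho>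
    by (simp add: cut_sum_round_vec A_def)
  consider "A = {}" | a where "A = {a}" | a b where "a \<in> A" "b \<in> A" "a \<noteq> b" by blast
  then show "measure_pmf.prob ?M {\<rho>. (\<sigma>, \<rho>) \<in> {\<omega>'. \<exists>e\<in>pairs V - G. \<exists>k<N. cut_sum G (round_vec w \<omega>' j) C = w e k}} \<le> 3 / real N"
    unfolding *
  proof cases
    case 1
    have "measure_pmf.prob ?M {\<rho>. \<exists>e\<in>pairs V - G. \<exists>k<N. (\<Sum>e\<in>A. w e (\<rho> (j, e))) = w e k} \<le> measure_pmf.prob ?M {}"
    proof (rule prob_le_of_support)
      fix \<rho> assume "\<rho> \<in> {\<rho>. \<exists>e\<in>pairs V - G. \<exists>k<N. (\<Sum>e\<in>A. w e (\<rho> (j, e))) = w e k}"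
      then obtain e k where "e \<in> pairs V" "k < N" "(\<Sum>e\<in>A. w e (\<rho> (j, e))) = w e k" by blast
      then show "\<rho> \<in> {}" using w_nonzero[of e k] 1 by simp
    qed
    also have "\<dots> \<le> 3 / real N" by simp
    finally show "measure_pmf.prob ?M {\<rho>. \<exists>e\<in>pairs V - G. \<exists>k<N. (\<Sum>e\<in>A. w e (\<rho> (j, e))) = w e k} \<le> 3 / real N" .
  next
    case (2 a)
    have "measure_pmf.prob ?M {\<rho>. \<exists>e\<in>pairs V - G. \<exists>k<N. (\<Sum>e\<in>A. w e (\<rho> (j, e))) = w e k} \<le> measure_pmf.prob ?M {}"
    proof (rule prob_le_of_support)
      fix \<rho> assume \<rho>: "\<rho> \<in> set_pmf ?M" "\<rho> \<in> {\<rho>. \<exists>e\<in>pairs V - G. \<exists>k<N. (\<Sum>e\<in>A. w e (\<rho> (j, e))) = w e k}"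
      then obtain e k where ek: "e \<in> pairs V - G" "k < N" "(\<Sum>e\<in>A. w e (\<rho> (j, e))) = w e k" by blast
      have sum: "w a (\<rho> (j, a)) = w e k" using ek(3) 2 by simp
      have "a \<in> G" using A 2 by auto
      then have "a = e" using ek sum set_ids[OF \<rho>(1), of "(j, a)"] w_eq_iff[of a e] G_pairs by blast
      then show "\<rho> \<in> {}" using ek \<open>a \<in> G\<close> by auto
    qed
    also have "\<dots> \<le> 3 / real N" by simp
    finally show "measure_pmf.prob ?M {\<rho>. \<exists>e\<in>pairs V - G. \<exists>k<N. (\<Sum>e\<in>A. w e (\<rho> (j, e))) = w e k} \<le> 3 / real N" .
  next
    case (3 a b)
    have "measure_pmf.prob ?M {\<rho>. \<exists>e\<in>pairs V - G. \<exists>k<N. (\<Sum>e\<in>A. w e (\<rho> (j, e))) = w e k} \<le>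
        measure_pmf.prob ?M {\<rho>. (\<Sum>e\<in>A. w e (\<rho> (j, e))) \<in> W}"
      by (intro measure_pmf.finite_measure_mono) auto
    also have "\<dots> \<le> 3 / real N"
      using A G 3 by (intro prob_sum_in_code_le[OF j]) auto
    finally show "measure_pmf.prob ?M {\<rho>. \<exists>e\<in>pairs V - G. \<exists>k<N. (\<Sum>e\<in>A. w e (\<rho> (j, e))) = w e k} \<le> 3 / real N" .
  qed
qed

text \<open>\<open>H\<close> is fixed before the round is drawn, so a union bound over its
  components and the levels applies.\<close>

lemma prob_false_link_le:
  "measure_pmf.prob (round_pmf J N E) {\<omega>'. \<not> links \<omega>' H \<subseteq> G} \<le> real (card V) * real J * (3 / real N)"
proof -
  let ?bad = "\<lambda>i. {\<omega>'. \<exists>e\<in>pairs V - G. \<exists>k<N. cut_sum G (round_vec w \<omega>' (snd i)) (fst i) = w e k}"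
  let ?I = "link_components V H \<times> {..<J}"
  have fin: "finite ?I" using finite_components[OF V] by simp
  have "measure_pmf.prob (round_pmf J N E) {\<omega>'. \<not> links \<omega>' H \<subseteq> G} \<le> measure_pmf.prob (round_pmf J N E) (\<Union>i\<in>?I. ?bad i)"
    by (intro measure_pmf.finite_measure_mono) (fastforce simp: links_def decoded_links_def)+
  also have "\<dots> \<le> (\<Sum>i\<in>?I. measure_pmf.prob (round_pmf J N E) (?bad i))"
    by (intro measure_pmf.finite_measure_subadditive_finite fin) auto
  also have "\<dots> \<le> (\<Sum>i\<in>?I. 3 / real N)"
    using prob_false_link_at_le by (intro sum_mono) auto
  also have "\<dots> = real (card (link_components V H)) * real J * (3 / real N)"
    by (simp add: card_cartesian_product)
  also have "\<dots> \<le> real (card V) * real J * (3 / real N)"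
    using card_components_le[OF V] by (intro mult_right_mono) auto
  finally show ?thesis .
qed

definition level :: "'a set \<Rightarrow> nat" where
  "level C = (SOME j. j < J \<and> 2 ^ j \<le> card {e \<in> G. crosses e C} \<and> card {e \<in> G. crosses e C} < 2 ^ Suc j)"

lemma level:
  assumes "C \<in> active_components V G H"
  shows "level C < J" "2 ^ level C \<le> card {e \<in> G. crosses e C}" "card {e \<in> G. crosses e C} < 2 ^ Suc (level C)"
proof -
  have "{e \<in> G. crosses e C} \<noteq> {}" using assms by (auto simp: active_components_def)
  moreover have "finite {e \<in> G. crosses e C}" using finite_G by simp
  ultimately have "1 \<le> card {e \<in> G. crosses e C}" by (simp add: Suc_le_eq card_gt_0_iff)
  moreover have "card {e \<in> G. crosses e C} < 2 ^ J"
  proof -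
    have "card {e \<in> G. crosses e C} \<le> card E" using G by (intro card_mono finite_E) auto
    then show ?thesis using card_E by simp
  qed
  ultimately have "\<exists>j. j < J \<and> 2 ^ j \<le> card {e \<in> G. crosses e C} \<and> card {e \<in> G. crosses e C} < 2 ^ Suc j"
    using ex_dyadic_level[of "card {e \<in> G. crosses e C}" J] by blast
  then have "level C < J \<and> 2 ^ level C \<le> card {e \<in> G. crosses e C} \<and> card {e \<in> G. crosses e C} < 2 ^ Suc (level C)"
    unfolding level_def by (rule someI_ex)
  then show "level C < J" "2 ^ level C \<le> card {e \<in> G. crosses e C}" "card {e \<in> G. crosses e C} < 2 ^ Suc (level C)"
    by auto
qed

text \<open>A function of the sampling bits alone. Looking at a single level per component ensures
  that each bit affects at most two components, the ones at the ends of its edge.\<close>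

definition isolated :: "'a set set \<Rightarrow> (nat \<times> 'a set \<Rightarrow> bool) \<Rightarrow> 'a set set" where
  "isolated H \<sigma> = {C \<in> active_components V G H. card {e \<in> G. crosses e C \<and> \<sigma> (level C, e)} = 1}"

lemma isolated_linked:
  assumes C: "C \<in> isolated H \<sigma>" and \<rho>: "\<And>i. \<rho> i < N"
  shows "\<exists>e\<in>links (\<sigma>, \<rho>) H. crosses e C"
proof -
  have C': "C \<in> active_components V G H" using C by (simp add: isolated_def)
  obtain e where e: "{e \<in> G. crosses e C \<and> \<sigma> (level C, e)} = {e}"
    using C by (auto simp: isolated_def card_1_singleton_iff)
  then have "cut_sum G (round_vec w (\<sigma>, \<rho>) (level C)) C = w e (\<rho> (level C, e))"
    by (simp add: cut_sum_round_vec)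
  moreover have "e \<in> G" "crosses e C" using e by auto
  moreover have "C \<in> link_components V H" using C' by (simp add: active_components_def)
  ultimately have "e \<in> links (\<sigma>, \<rho>) H"
    using level(1)[OF C'] \<rho>[of "(level C, e)"] G_pairs unfolding links_def decoded_links_def by blast
  then show ?thesis using \<open>crosses e C\<close> by blast
qed

lemma card_active_merge_le:
  assumes "links_on V H" "links (\<sigma>, \<rho>) H \<subseteq> G" "\<And>i. \<rho> i < N"
  shows "real (card (active_components V G (H \<union> links (\<sigma>, \<rho>) H))) \<le>
    real (card (active_components V G H)) - real (card (isolated H \<sigma>)) / 2"
proof -
  have "2 * card (active_components V G (H \<union> links (\<sigma>, \<rho>) H)) + card (isolated H \<sigma>) \<le>
      2 * card (active_components V G H)"
    using assms isolated_linked by (intro active_merge V G_pairs) (auto simp: isolated_def)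
  then show ?thesis by linarith
qed

lemma expectation_isolated_ge:
  "real (card (active_components V G H)) / 16 \<le>
    measure_pmf.expectation (samples_pmf J E) (\<lambda>\<sigma>. real (card (isolated H \<sigma>)))"
proof -
  let ?A = "active_components V G H" and ?I = "{..<J} \<times> E"
  let ?X = "\<lambda>C. {\<sigma>. card {e \<in> G. crosses e C \<and> \<sigma> (level C, e)} = 1}"
  have fA: "finite ?A" by (rule finite_active[OF V])
  have one: "1 / 16 \<le> measure_pmf.prob (samples_pmf J E) (?X C)" if C: "C \<in> ?A" for C
  proof -
    let ?D = "Pair (level C) ` {e \<in> G. crosses e C}"
    have card_D: "card ?D = card {e \<in> G. crosses e C}" by (intro card_image) (auto simp: inj_on_def)
    have sub: "?D \<subseteq> ?I" using level(1)[OF C] G by auto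
    have "card {i \<in> ?D. \<sigma> i} = card {e \<in> G. crosses e C \<and> \<sigma> (level C, e)}" for \<sigma> :: "nat \<times> 'a set \<Rightarrow> bool"
    proof -
      have "{i \<in> ?D. \<sigma> i} = Pair (level C) ` {e \<in> G. crosses e C \<and> \<sigma> (level C, e)}" by auto
      then show ?thesis by (simp add: card_image inj_on_def)
    qed
    moreover have "1 / 16 \<le> measure_pmf.prob (samples_pmf J E) {\<sigma>. card {i \<in> ?D. \<sigma> i} = 1}"
      unfolding samples_pmf_def
    proof (rule prob_exactly_one_ge)
      show "1 / 2 ^ fst i = (1 / 2 ^ level C :: real)" if "i \<in> ?D" for i using that by auto
    qed (use sub finite_E card_D level[OF C] in auto)
    ultimately show ?thesis by simp
  qed
  have "real (card ?A) / 16 = (\<Sum>C\<in>?A. 1 / 16)" by simp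
  also have "\<dots> \<le> (\<Sum>C\<in>?A. measure_pmf.prob (samples_pmf J E) (?X C))"
    by (intro sum_mono one)
  also have "\<dots> = measure_pmf.expectation (samples_pmf J E) (\<lambda>\<sigma>. \<Sum>C\<in>?A. indicator (?X C) \<sigma>)"
    by (subst Bochner_Integration.integral_sum)
      (auto intro!: integrable_measure_pmf_finite finite_set_samples_pmf finite_E)
  also have "(\<lambda>\<sigma>. \<Sum>C\<in>?A. indicator (?X C) \<sigma>) = (\<lambda>\<sigma>. real (card (isolated H \<sigma>)))"
    using fA by (auto simp: isolated_def indicator_def of_bool_def sum.If_cases Int_def fun_eq_iff)
  finally show ?thesis .
qed

end

section \<open>All rounds\<close>


lemma card_diff_le_of_eq_outside:
  assumes "finite A" "finite B" "finite D" "A - D = B - D"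
  shows "\<bar>real (card A) - real (card B)\<bar> \<le> real (card D)"
proof -
  have *: "card A \<le> card B + card D" if "finite A" "finite B" "A - D = B - D" for A B
  proof -
    have "A \<subseteq> B \<union> D" using that(3) by blast
    then have "card A \<le> card (B \<union> D)" using that assms(3) by (intro card_mono) auto
    also have "\<dots> \<le> card B + card D" by (rule card_Un_le)
    finally show ?thesis .
  qed
  show ?thesis using *[OF assms(1,2,4)] *[OF assms(2,1) assms(4)[symmetric]] by linarith
qed

context boruvka
begin

lemma finite_set_round_pmf: "finite (set_pmf (round_pmf J N E))"
proof -
  have "set_pmf (pmf_of_set {..<N}) = {..<N}" using N by (intro set_pmf_of_set) auto
  then have "finite (set_pmf (Pi_pmf ({..<J} \<times> E) 0 (\<lambda>_. pmf_of_set {..<N})))"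
    using finite_E by (intro finite_set_Pi_pmf) auto
  then show ?thesis using finite_set_samples_pmf[OF finite_E] by (simp add: round_pmf_def)
qed

lemma set_round_pmf: "\<omega>' \<in> set_pmf (round_pmf J N E) \<Longrightarrow> snd \<omega>' i < N"
  using set_ids[of "snd \<omega>'" i] by (auto simp: round_pmf_def)

text \<open>The components whose membership in \<open>isolated\<close> can change with the sampling
  bit \<open>i\<close>.\<close>

definition influenced :: "'a set set \<Rightarrow> nat \<times> 'a set \<Rightarrow> 'a set set" where
  "influenced H i = {C \<in> active_components V G H. level C = fst i \<and> snd i \<in> G \<and> crosses (snd i) C}"

lemma finite_influenced: "finite (influenced H i)"
  using finite_active[OF V] by (simp add: influenced_def)

lemma card_influenced_le: "card (influenced H i) \<le> 2"
proof (cases "snd i \<in> G")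
  case True
  have "card (influenced H i) \<le> card {C \<in> active_components V G H. crosses (snd i) C}"
    using finite_active[OF V] by (intro card_mono) (auto simp: influenced_def)
  also have "\<dots> \<le> 2" using True G_pairs by (intro card_active_crossed_le) auto
  finally show ?thesis .
qed (simp add: influenced_def)

lemma isolated_update:
  assumes "C \<notin> influenced H i"
  shows "C \<in> isolated H (\<sigma>(i := b)) \<longleftrightarrow> C \<in> isolated H \<sigma>"
proof (cases "C \<in> active_components V G H")
  case True
  then have "(level C, e) \<noteq> i" if "e \<in> G" "crosses e C" for e
    using that assms by (auto simp: influenced_def)
  then have "{e \<in> G. crosses e C \<and> (\<sigma>(i := b)) (level C, e)} = {e \<in> G. crosses e C \<and> \<sigma> (level C, e)}"
    by auto
  then show ?thesis unfolding isolated_def by simp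
qed (simp add: isolated_def)

text \<open>Double counting: an active component depends on fewer than
  \<open>2 ^ (level C + 1)\<close> bits, each of probability \<open>2 ^ - level C\<close>, and so
  contributes at most 2.\<close>

lemma sum_influence_le:
  "(\<Sum>i\<in>{..<J} \<times> E. 1 / 2 ^ fst i * real (card (influenced H i))) \<le> 2 * real (card (active_components V G H))"
proof -
  let ?A = "active_components V G H" and ?I = "{..<J} \<times> E"
  have fA: "finite ?A" by (rule finite_active[OF V])
  have fI: "finite ?I" using finite_E by simp
  have one: "(\<Sum>i\<in>?I. if C \<in> influenced H i then 1 / 2 ^ fst i else 0) \<le> (2 :: real)" if C: "C \<in> ?A" for C
  proof -
    let ?D = "Pair (level C) ` {e \<in> G. crosses e C}"
    have D: "?I \<inter> {i. C \<in> influenced H i} = ?D"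
      using level(1)[OF C] C G by (auto simp: influenced_def)
    have "(\<Sum>i\<in>?I. if C \<in> influenced H i then 1 / 2 ^ fst i else 0) = (\<Sum>i\<in>?D. 1 / 2 ^ fst i :: real)"
      using fI by (simp add: sum.If_cases D)
    also have "\<dots> = (\<Sum>e\<in>{e \<in> G. crosses e C}. 1 / 2 ^ level C)"
      by (subst sum.reindex) (auto simp: inj_on_def)
    also have "\<dots> = real (card {e \<in> G. crosses e C}) / 2 ^ level C" by simp
    also have "\<dots> \<le> 2 ^ Suc (level C) / 2 ^ level C"
    proof (rule divide_right_mono)
      have "real (card {e \<in> G. crosses e C}) \<le> real (2 ^ Suc (level C))"
        using level(3)[OF C] by (simp only: of_nat_le_iff less_imp_le)
      then show "real (card {e \<in> G. crosses e C}) \<le> 2 ^ Suc (level C)" by simp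
    qed simp
    finally show ?thesis by simp
  qed
  have "(\<Sum>i\<in>?I. 1 / 2 ^ fst i * real (card (influenced H i))) =
      (\<Sum>i\<in>?I. \<Sum>C\<in>?A. if C \<in> influenced H i then 1 / 2 ^ fst i else 0)"
  proof (rule sum.cong[OF refl])
    fix i assume "i \<in> ?I"
    have "?A \<inter> {C. C \<in> influenced H i} = influenced H i" by (auto simp: influenced_def)
    then show "1 / 2 ^ fst i * real (card (influenced H i)) =
        (\<Sum>C\<in>?A. if C \<in> influenced H i then 1 / 2 ^ fst i else 0)"
      using fA by (simp add: sum.If_cases)
  qed
  also have "\<dots> = (\<Sum>C\<in>?A. \<Sum>i\<in>?I. if C \<in> influenced H i then 1 / 2 ^ fst i else 0)"
    by (rule sum.swap)
  also have "\<dots> \<le> (\<Sum>C\<in>?A. 2)" by (intro sum_mono one)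
  also have "\<dots> = 2 * real (card ?A)" by simp
  finally show ?thesis .
qed

text \<open>The linear term is \<open>\<mu> / 2\<close> times the mean, which is at least
  \<open>k / 16\<close>. For the quadratic term, influences are at most 2, so their squares are at
  most twice their values, and double counting makes the total linear in \<open>k\<close>.\<close>

lemma expectation_exp_isolated_le:
  fixes H :: "'a set set"
  assumes \<mu>: "0 \<le> \<mu>" "\<mu> \<le> 1"
  defines "k \<equiv> real (card (active_components V G H))"
  shows "measure_pmf.expectation (samples_pmf J E) (\<lambda>\<sigma>. exp (- (\<mu> / 2 * real (card (isolated H \<sigma>)))))
    \<le> exp (- \<mu> * k / 32 + \<mu>\<^sup>2 * k)"
proof -
  let ?I = "{..<J} \<times> E"
  let ?f = "\<lambda>\<sigma>. \<mu> / 2 * real (card (isolated H \<sigma>))"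
  let ?c = "\<lambda>i. \<mu> / 2 * real (card (influenced H i))"
  have fin: "finite (isolated H \<sigma>)" for \<sigma> using finite_active[OF V] by (simp add: isolated_def)
  have card2: "real (card (influenced H i)) \<le> 2" for i using card_influenced_le[of H i] by simp
  have "measure_pmf.expectation (samples_pmf J E) (\<lambda>\<sigma>. exp (- ?f \<sigma>)) \<le>
      exp (- measure_pmf.expectation (samples_pmf J E) ?f + (\<Sum>i\<in>?I. 1 / 2 ^ fst i * (?c i)\<^sup>2))"
    unfolding samples_pmf_def
  proof (rule expectation_exp_bounded_differences)
    show "finite ?I" using finite_E by simp
    fix i :: "nat \<times> 'a set"
    show "0 \<le> (1 / 2 ^ fst i :: real) \<and> 1 / 2 ^ fst i \<le> (1 :: real)" by simp
    have "\<mu> / 2 * real (card (influenced H i)) \<le> \<mu> / 2 * 2" using \<mu> card2 by (intro mult_left_mono) auto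
    then show "?c i \<le> 1" using \<mu> by simp
    fix \<sigma> :: "nat \<times> 'a set \<Rightarrow> bool"
    have "isolated H (\<sigma>(i := True)) - influenced H i = isolated H (\<sigma>(i := False)) - influenced H i"
      using isolated_update[of _ H i \<sigma>] by blast
    then have "\<bar>real (card (isolated H (\<sigma>(i := True)))) - real (card (isolated H (\<sigma>(i := False))))\<bar>
        \<le> real (card (influenced H i))"
      by (intro card_diff_le_of_eq_outside fin finite_influenced)
    then have "\<mu> / 2 * \<bar>real (card (isolated H (\<sigma>(i := True)))) - real (card (isolated H (\<sigma>(i := False))))\<bar> \<le> ?c i"
      using \<mu> by (intro mult_left_mono) auto
    then show "\<bar>?f (\<sigma>(i := True)) - ?f (\<sigma>(i := False))\<bar> \<le> ?c i"
      using \<mu> by (simp only: abs_mult right_diff_distrib[symmetric])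
  qed
  also have "\<dots> \<le> exp (- \<mu> * k / 32 + \<mu>\<^sup>2 * k)"
  proof -
    have "(\<Sum>i\<in>?I. 1 / 2 ^ fst i * (?c i)\<^sup>2) \<le> (\<Sum>i\<in>?I. \<mu>\<^sup>2 / 2 * (1 / 2 ^ fst i * real (card (influenced H i))))"
    proof (rule sum_mono)
      fix i
      let ?d = "real (card (influenced H i))"
      have "?d\<^sup>2 \<le> 2 * ?d" unfolding power2_eq_square using card2 by (intro mult_right_mono) auto
      then have "\<mu>\<^sup>2 / 4 / 2 ^ fst i * ?d\<^sup>2 \<le> \<mu>\<^sup>2 / 4 / 2 ^ fst i * (2 * ?d)" by (intro mult_left_mono) auto
      then show "1 / 2 ^ fst i * (?c i)\<^sup>2 \<le> \<mu>\<^sup>2 / 2 * (1 / 2 ^ fst i * ?d)"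
        by (simp add: power_mult_distrib power_divide)
    qed
    also have "\<dots> = \<mu>\<^sup>2 / 2 * (\<Sum>i\<in>?I. 1 / 2 ^ fst i * real (card (influenced H i)))"
      by (rule sum_distrib_left[symmetric])
    also have "\<dots> \<le> \<mu>\<^sup>2 / 2 * (2 * k)"
      unfolding k_def by (intro mult_left_mono sum_influence_le) auto
    also have "\<dots> = \<mu>\<^sup>2 * k" by simp
    finally have var: "(\<Sum>i\<in>?I. 1 / 2 ^ fst i * (?c i)\<^sup>2) \<le> \<mu>\<^sup>2 * k" .
    have "\<mu> / 2 * (k / 16) \<le> \<mu> / 2 * measure_pmf.expectation (samples_pmf J E) (\<lambda>\<sigma>. real (card (isolated H \<sigma>)))"
      unfolding k_def using \<mu> by (intro mult_left_mono expectation_isolated_ge) auto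
    also have "\<dots> = measure_pmf.expectation (samples_pmf J E) ?f" by simp
    finally show ?thesis using var by simp
  qed
  finally show ?thesis .
qed

text \<open>With \<open>\<mu> \<le> 1 / 64\<close> the quadratic loss consumes at most half of the
  gain \<open>\<mu> * k / 32\<close>, whence the factor 63/64. Outcomes with a false link count as 0
  here and are charged separately.\<close>

lemma expectation_round_le:
  fixes H :: "'a set set"
  assumes H: "links_on V H" and \<mu>: "0 \<le> \<mu>" "\<mu> \<le> 1 / 64"
  defines "k \<equiv> real (card (active_components V G H))"
  shows "measure_pmf.expectation (round_pmf J N E)
      (\<lambda>\<omega>'. if links \<omega>' H \<subseteq> G then exp (\<mu> * real (card (active_components V G (H \<union> links \<omega>' H)))) else 0)
    \<le> exp (\<mu> * (63 / 64) * k)"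
proof -
  note int = integrable_measure_pmf_finite[OF finite_set_round_pmf]
  have "measure_pmf.expectation (round_pmf J N E)
      (\<lambda>\<omega>'. if links \<omega>' H \<subseteq> G then exp (\<mu> * real (card (active_components V G (H \<union> links \<omega>' H)))) else 0)
    \<le> measure_pmf.expectation (round_pmf J N E)
        (\<lambda>\<omega>'. exp (\<mu> * k) * exp (- (\<mu> / 2 * real (card (isolated H (fst \<omega>'))))))"
  proof (intro integral_mono_AE int, unfold AE_measure_pmf_iff, intro ballI)
    fix \<omega>' assume \<omega>: "\<omega>' \<in> set_pmf (round_pmf J N E)"
    show "(if links \<omega>' H \<subseteq> G then exp (\<mu> * real (card (active_components V G (H \<union> links \<omega>' H)))) else 0)
        \<le> exp (\<mu> * k) * exp (- (\<mu> / 2 * real (card (isolated H (fst \<omega>')))))"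
    proof (cases "links \<omega>' H \<subseteq> G")
      case True
      have "real (card (active_components V G (H \<union> links \<omega>' H))) \<le> k - real (card (isolated H (fst \<omega>'))) / 2"
        using card_active_merge_le[OF H, of "fst \<omega>'" "snd \<omega>'"] True set_round_pmf[OF \<omega>] by (simp add: k_def)
      then have "\<mu> * real (card (active_components V G (H \<union> links \<omega>' H))) \<le>
          \<mu> * (k - real (card (isolated H (fst \<omega>'))) / 2)"
        using \<mu> by (intro mult_left_mono) auto
      also have "\<dots> = \<mu> * k + - (\<mu> / 2 * real (card (isolated H (fst \<omega>'))))" by (simp add: right_diff_distrib)
      finally show ?thesis using True by (simp flip: exp_add)
    qed simp
  qed
  also have "\<dots> = exp (\<mu> * k) * measure_pmf.expectation (samples_pmf J E)
      (\<lambda>\<sigma>. exp (- (\<mu> / 2 * real (card (isolated H \<sigma>)))))"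
    unfolding round_pmf_def by (simp add: expectation_pair_pmf_fst[where f = "\<lambda>\<sigma>. exp (- (\<mu> * real (card (isolated H \<sigma>)) / 2))"])
  also have "\<dots> \<le> exp (\<mu> * k) * exp (- \<mu> * k / 32 + \<mu>\<^sup>2 * k)"
    unfolding k_def using \<mu> by (intro mult_left_mono expectation_exp_isolated_le) auto
  also have "\<dots> \<le> exp (\<mu> * (63 / 64) * k)"
  proof -
    have "\<mu> * (\<mu> * k) \<le> 1 / 64 * (\<mu> * k)" using \<mu> by (intro mult_right_mono) (auto simp: k_def)
    then show ?thesis by (simp add: power2_eq_square flip: exp_add)
  qed
  finally show ?thesis .
qed

section \<open>The final check and the error event\<close>

definition check_pmf :: "nat \<Rightarrow> ('a set \<Rightarrow> vec) pmf" where
  "check_pmf b = Pi_pmf E 0 (\<lambda>_. pmf_of_set (vecs b))"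

text \<open>The one event outside which decoding is correct. It speaks about all cuts that are left,
  not about \<open>s\<close> and \<open>t\<close>. Slow progress is no error in itself; it only
  makes the last clause more likely.\<close>

fun misdecodes :: "'a set set \<Rightarrow> ((nat \<times> 'a set \<Rightarrow> bool) \<times> (nat \<times> 'a set \<Rightarrow> nat)) list \<Rightarrow>
    ('a set \<Rightarrow> vec) \<Rightarrow> bool" where
  "misdecodes H [] \<eta> \<longleftrightarrow>
     (\<exists>C\<subseteq>V. closed_under H C \<and> (\<exists>e\<in>G. crosses e C) \<and> cut_sum G \<eta> C = 0)"
| "misdecodes H (\<omega>' # \<omega>s) \<eta> \<longleftrightarrow> \<not> links \<omega>' H \<subseteq> G \<or> misdecodes (H \<union> links \<omega>' H) \<omega>s \<eta>"

text \<open>Reveal the vector of the crossing edge \<open>e\<close> last: exactly one value cancels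
  the sum of the others.\<close>

lemma prob_cut_sum_zero_le:
  assumes "e \<in> G" "crosses e U"
  shows "measure_pmf.prob (check_pmf b) {\<eta>. cut_sum G \<eta> U = 0} \<le> 1 / 2 ^ b"
  unfolding check_pmf_def
proof (rule prob_Pi_pmf_coordinate_le[OF finite_E])
  show "e \<in> E" using assms G by auto
  fix \<eta> :: "'a set \<Rightarrow> vec"
  let ?D = "{e \<in> G. crosses e U}"
  define y where "y = (\<Sum>e\<in>?D - {e}. \<eta> e)"
  have "cut_sum G (\<eta>(e := x)) U = x + y" for x
  proof -
    have "(\<Sum>e'\<in>?D - {e}. (\<eta>(e := x)) e') = y" unfolding y_def by (intro sum.cong) auto
    moreover have "cut_sum G (\<eta>(e := x)) U = (\<eta>(e := x)) e + (\<Sum>e'\<in>?D - {e}. (\<eta>(e := x)) e')"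
      unfolding cut_sum_def using assms finite_G by (intro sum.remove) auto
    ultimately show ?thesis by simp
  qed
  then have eq: "{x. \<eta>(e := x) \<in> {\<eta>. cut_sum G \<eta> U = 0}} = {y}"
    by (simp add: vec_add_eq_iff)
  have "vecs b \<noteq> {}" using vecs_0 by blast
  then show "measure_pmf.prob (pmf_of_set (vecs b)) {x. \<eta>(e := x) \<in> {\<eta>. cut_sum G \<eta> U = 0}} \<le> 1 / 2 ^ b"
    unfolding eq by (simp add: measure_pmf_single pmf_of_set indicator_def)
qed

text \<open>The union bound over \<open>2 ^ k\<close> unions of active components gives
  \<open>2 ^ k / 2 ^ b\<close>. It is weakened to the form of the exponential moment, which is valid
  also for \<open>k \<ge> b\<close>, where the right-hand side is at least 1.\<close>

lemma prob_misdecodes_Nil_le: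
  fixes H :: "'a set set"
  assumes H: "links_on V H" and \<mu>: "0 \<le> \<mu>" "\<mu> \<le> ln 2"
  defines "k \<equiv> real (card (active_components V G H))"
  shows "measure_pmf.prob (check_pmf b) {\<eta>. misdecodes H [] \<eta>} \<le> exp (\<mu> * (k - real b))"
proof (cases "k \<ge> real b")
  case True
  have "measure_pmf.prob (check_pmf b) {\<eta>. misdecodes H [] \<eta>} \<le> 1" by simp
  also have "1 \<le> exp (\<mu> * (k - real b))" using True \<mu> by simp
  finally show ?thesis .
next
  case False
  let ?A = "active_components V G H"
  let ?K = "{K \<in> Pow ?A. \<exists>e\<in>G. crosses e (\<Union>K)}"
  have fA: "finite ?A" by (rule finite_active[OF V])
  have sub: "{\<eta>. misdecodes H [] \<eta>} \<subseteq> (\<Union>K\<in>?K. {\<eta>. cut_sum G \<eta> (\<Union>K) = 0})"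
  proof
    fix \<eta> assume "\<eta> \<in> {\<eta>. misdecodes H [] \<eta>}"
    then obtain C e where C: "C \<subseteq> V" "closed_under H C" "e \<in> G" "crosses e C" "cut_sum G \<eta> C = 0" by auto
    let ?U = "\<Union>{D \<in> ?A. D \<subseteq> C}"
    have iff: "crosses e ?U \<longleftrightarrow> crosses e C" if "e \<in> G" for e
      using that G_pairs by (intro crosses_active_Union[OF C(1,2)]) auto
    then have "{e \<in> G. crosses e ?U} = {e \<in> G. crosses e C}" by auto
    then have "cut_sum G \<eta> ?U = 0" using C(5) unfolding cut_sum_def by simp
    moreover have "{D \<in> ?A. D \<subseteq> C} \<in> ?K" using iff[OF C(3)] C(3,4) by auto
    ultimately show "\<eta> \<in> (\<Union>K\<in>?K. {\<eta>. cut_sum G \<eta> (\<Union>K) = 0})" by blast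
  qed
  have fK: "finite ?K" using fA by simp
  have "measure_pmf.prob (check_pmf b) {\<eta>. misdecodes H [] \<eta>} \<le>
      measure_pmf.prob (check_pmf b) (\<Union>K\<in>?K. {\<eta>. cut_sum G \<eta> (\<Union>K) = 0})"
    using sub by (intro measure_pmf.finite_measure_mono) auto
  also have "\<dots> \<le> (\<Sum>K\<in>?K. measure_pmf.prob (check_pmf b) {\<eta>. cut_sum G \<eta> (\<Union>K) = 0})"
    by (intro measure_pmf.finite_measure_subadditive_finite fK) auto
  also have "\<dots> \<le> (\<Sum>K\<in>?K. 1 / 2 ^ b)"
    using prob_cut_sum_zero_le by (intro sum_mono) blast
  also have "\<dots> = real (card ?K) / 2 ^ b" by simp
  also have "\<dots> \<le> real (card (Pow ?A)) / 2 ^ b"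
    using fA by (intro divide_right_mono) (auto intro!: card_mono)
  also have "\<dots> = 2 powr k / 2 powr real b"
    using fA by (simp add: card_Pow k_def powr_realpow)
  also have "\<dots> = exp (ln 2 * (k - real b))"
    by (simp add: powr_def right_diff_distrib exp_diff mult.commute left_diff_distrib)
  also have "\<dots> \<le> exp (\<mu> * (k - real b))"
    using \<mu> False by (auto intro!: mult_right_mono_neg)
  finally show ?thesis .
qed

text \<open>Induction with arbitrary \<open>H\<close>: the rounds after the first are independent of
  it and start from the enlarged links. The moment bound is applied to the first round with
  parameter \<open>\<mu> * (63 / 64) ^ R\<close>, so the factors 63/64 multiply up in the
  exponent.\<close>

lemma prob_misdecodes_le:
  assumes "links_on V H" and \<mu>: "0 \<le> \<mu>" "\<mu> \<le> 1 / 64"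
  shows "measure_pmf.prob (pair_pmf (replicate_pmf R (round_pmf J N E)) (check_pmf b))
      {(\<omega>s, \<eta>). misdecodes H \<omega>s \<eta>} \<le>
    real R * (real (card V) * real J * (3 / real N)) +
      exp (\<mu> * ((63 / 64) ^ R * real (card (active_components V G H)) - real b))"
  using assms(1)
proof (induction R arbitrary: H)
  case 0
  have "\<mu> \<le> ln 2" using \<mu> ln2_ge_two_thirds by simp
  then show ?case
    using prob_misdecodes_Nil_le[OF 0 \<mu>(1)]
    by (simp add: prob_pair_pmf del: misdecodes.simps)
next
  case (Suc R)
  let ?Q = "pair_pmf (replicate_pmf R (round_pmf J N E)) (check_pmf b)"
  let ?\<delta> = "real (card V) * real J * (3 / real N)"
  let ?k = "\<lambda>H. real (card (active_components V G H))"
  define \<gamma> :: real where "\<gamma> = (63 / 64) ^ R"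
  have \<gamma>: "0 \<le> \<gamma>" "\<gamma> \<le> 1" by (auto simp: \<gamma>_def power_le_one)
  note int = integrable_measure_pmf_finite[OF finite_set_round_pmf]
  have \<delta>: "0 \<le> real R * ?\<delta>" by simp
  have "measure_pmf.prob (pair_pmf (replicate_pmf (Suc R) (round_pmf J N E)) (check_pmf b)) {(\<omega>s, \<eta>). misdecodes H \<omega>s \<eta>} =
      measure_pmf.expectation (round_pmf J N E) (\<lambda>\<omega>'. measure_pmf.prob ?Q {(\<omega>s, \<eta>). misdecodes H (\<omega>' # \<omega>s) \<eta>})"
  proof -
    have "pair_pmf (replicate_pmf (Suc R) (round_pmf J N E)) (check_pmf b) =
        bind_pmf (round_pmf J N E) (\<lambda>\<omega>'. map_pmf (\<lambda>(\<omega>s, \<eta>). (\<omega>' # \<omega>s, \<eta>)) ?Q)"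
      by (simp add: pair_pmf_def bind_assoc_pmf bind_return_pmf map_bind_pmf map_pmf_def)
    then show ?thesis by (simp add: prob_bind_pmf vimage_def case_prod_unfold)
  qed
  also have "\<dots> \<le> measure_pmf.expectation (round_pmf J N E)
      (\<lambda>\<omega>'. (indicator {\<omega>'. \<not> links \<omega>' H \<subseteq> G} \<omega>' + real R * ?\<delta>) +
        exp (- \<mu> * real b) * (if links \<omega>' H \<subseteq> G then exp (\<mu> * \<gamma> * ?k (H \<union> links \<omega>' H)) else 0))"
  proof (intro integral_mono int)
    fix \<omega>'
    show "measure_pmf.prob ?Q {(\<omega>s, \<eta>). misdecodes H (\<omega>' # \<omega>s) \<eta>} \<le>
        (indicator {\<omega>'. \<not> links \<omega>' H \<subseteq> G} \<omega>' + real R * ?\<delta>) +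
        exp (- \<mu> * real b) * (if links \<omega>' H \<subseteq> G then exp (\<mu> * \<gamma> * ?k (H \<union> links \<omega>' H)) else 0)"
    proof (cases "links \<omega>' H \<subseteq> G")
      case True
      then have "links_on V (H \<union> links \<omega>' H)"
        using Suc.prems links_on_pairs[OF links_pairs] by (simp add: links_on_Un)
      from Suc.IH[OF this] True show ?thesis
        by (simp add: \<gamma>_def right_diff_distrib mult.assoc flip: exp_add)
    next
      case False
      then have "measure_pmf.prob ?Q {(\<omega>s, \<eta>). misdecodes H (\<omega>' # \<omega>s) \<eta>} \<le> 1" by simp
      then show ?thesis using False \<delta> by simp
    qed
  qed
  also have "\<dots> = (measure_pmf.prob (round_pmf J N E) {\<omega>'. \<not> links \<omega>' H \<subseteq> G} + real R * ?\<delta>) +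
      exp (- \<mu> * real b) * measure_pmf.expectation (round_pmf J N E)
        (\<lambda>\<omega>'. if links \<omega>' H \<subseteq> G then exp (\<mu> * \<gamma> * ?k (H \<union> links \<omega>' H)) else 0)"
    by (subst Bochner_Integration.integral_add[OF int int], subst Bochner_Integration.integral_add[OF int int],
        subst integral_mult_right_zero) simp
  also have "\<dots> \<le> (?\<delta> + real R * ?\<delta>) + exp (- \<mu> * real b) * exp (\<mu> * \<gamma> * (63 / 64) * ?k H)"
  proof (intro add_mono mult_left_mono prob_false_link_le order_refl expectation_round_le Suc.prems)
    show "0 \<le> \<mu> * \<gamma>" "\<mu> * \<gamma> \<le> 1 / 64" using \<mu> \<gamma> mult_left_le[of \<gamma> \<mu>] by auto
  qed simp_all
  also have "?\<delta> + real R * ?\<delta> = real (Suc R) * ?\<delta>"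
    by (simp only: of_nat_Suc distrib_right mult_1_left)
  also have "exp (- \<mu> * real b) * exp (\<mu> * \<gamma> * (63 / 64) * ?k H) = exp (\<mu> * ((63 / 64) ^ Suc R * ?k H - real b))"
    by (simp add: \<gamma>_def right_diff_distrib mult_ac flip: exp_add)
  finally show ?case .
qed

end

section \<open>Numbered graphs\<close>


lemma connected_by_image: "connected_by A u v \<Longrightarrow> connected_by ((`) f ` A) (f u) (f v)"
  unfolding connected_by_def
proof (induction rule: rtrancl_induct)
  case (step y z)
  then have "{f y, f z} \<in> (`) f ` A" by (intro image_eqI[of _ _ "{y, z}"]) auto
  then show ?case using step.IH by (simp add: rtrancl_into_rtrancl)
qed simp

lemma rooted_forest_image:
  assumes R: "rooted_forest E rt xs P" and inj: "inj_on f (set xs)"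
  defines "g \<equiv> inv_into (set xs) f"
  shows "rooted_forest ((`) f ` E) (f \<circ> rt \<circ> g) (map f xs) (\<lambda>y. (`) f ` P (g y))"
proof -
  interpret rooted_forest E rt xs P by (rule R)
  let ?P = "\<lambda>y. (`) f ` P (g y)"
  have gf: "g (f v) = v" if "v \<in> set xs" for v using inj that by (simp add: g_def)
  have gin: "g y \<in> set xs" "f (g y) = y" if "y \<in> set (map f xs)" for y
    using that gf by auto
  have edge: "e \<subseteq> set xs" if "v \<in> set xs" "e \<in> P v" for e v using path_vertices[OF that(1)] that(2) by auto
  have inj_img: "inj_on ((`) f) (Pow (set xs))"
    using inj by (rule inj_on_image_Pow)
  have Pow: "P v \<subseteq> Pow (set xs)" if "v \<in> set xs" for v using edge[OF that] by auto
  show ?thesis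
  proof
    show "distinct (map f xs)" using distinct inj by (simp add: distinct_map)
    show "?P v \<subseteq> (`) f ` E" if "v \<in> set (map f xs)" for v
      using path_subset[OF gin(1)[OF that]] by (rule image_mono)
    show "\<Union>(?P v) \<subseteq> set (map f xs)" if "v \<in> set (map f xs)" for v
      using edge[OF gin(1)[OF that]] by auto
    show "(f \<circ> rt \<circ> g) v \<in> set (map f xs)" if "v \<in> set (map f xs)" for v
      using root_in[OF gin(1)[OF that]] by simp
    show "(f \<circ> rt \<circ> g) ((f \<circ> rt \<circ> g) v) = (f \<circ> rt \<circ> g) v" if "v \<in> set (map f xs)" for v
      using root_root[OF gin(1)[OF that]] root_in[OF gin(1)[OF that]] by (simp add: gf)
    show "?P ((f \<circ> rt \<circ> g) v) = {}" if "v \<in> set (map f xs)" for v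
      using path_root[OF gin(1)[OF that]] root_in[OF gin(1)[OF that]] by (simp add: gf)
    show "\<exists>u w. u \<in> set (map f xs) \<and> w \<in> set (map f xs) \<and> e = {u, w} \<and> ?P w = insert e (?P u)"
      if v: "v \<in> set (map f xs)" and e: "e \<in> ?P v" for v e
    proof -
      obtain e' where e': "e' \<in> P (g v)" "e = f ` e'" using e by blast
      from path_edge[OF gin(1)[OF v] e'(1)] obtain u w
        where "u \<in> set xs" "w \<in> set xs" "e' = {u, w}" "P w = insert e' (P u)" by blast
      then show ?thesis using e'(2) by (intro exI[of _ "f u"] exI[of _ "f w"]) (simp add: gf)
    qed
    show "(\<Sum>e\<in>?P v. \<Sum>u\<in>e. \<phi> u :: bit) = \<phi> v + \<phi> ((f \<circ> rt \<circ> g) v)" if "v \<in> set (map f xs)" for v \<phi>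
    proof -
      have v: "g v \<in> set xs" "f (g v) = v" using gin that by blast+
      have "(\<Sum>e\<in>?P v. \<Sum>u\<in>e. \<phi> u) = (\<Sum>e\<in>P (g v). \<Sum>u\<in>f ` e. \<phi> u)"
        using inj_on_subset[OF inj_img Pow[OF v(1)]] by (subst sum.reindex) simp_all
      also have "\<dots> = (\<Sum>e\<in>P (g v). \<Sum>u\<in>e. \<phi> (f u))"
      proof (rule sum.cong[OF refl])
        fix e assume "e \<in> P (g v)"
        then have "inj_on f e" using inj edge[OF v(1)] inj_on_subset by blast
        then show "(\<Sum>u\<in>f ` e. \<phi> u) = (\<Sum>u\<in>e. \<phi> (f u))" by (subst sum.reindex) simp_all
      qed
      also have "\<dots> = \<phi> v + \<phi> ((f \<circ> rt \<circ> g) v)"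
        using telescope[OF v(1), of "\<lambda>u. \<phi> (f u)"] v(2) by simp
      finally show ?thesis .
    qed
    show "connected_by ((?P u - ?P v) \<union> (?P v - ?P u)) u v"
      if "u \<in> set (map f xs)" "v \<in> set (map f xs)" "(f \<circ> rt \<circ> g) u = (f \<circ> rt \<circ> g) v" for u v
    proof -
      have uv: "g u \<in> set xs" "g v \<in> set xs" using gin that by blast+
      have "rt (g u) = rt (g v)"
        using that(3) inj root_in[OF uv(1)] root_in[OF uv(2)] by (auto dest: inj_onD)
      from connected_by_image[OF path_connects[OF uv this], of f]
      have "connected_by ((`) f ` ((P (g u) - P (g v)) \<union> (P (g v) - P (g u)))) u v"
        using gin that by simp
      also have "(`) f ` ((P (g u) - P (g v)) \<union> (P (g v) - P (g u))) = (?P u - ?P v) \<union> (?P v - ?P u)"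
      proof -
        have *: "(`) f ` (A - B) = (`) f ` A - (`) f ` B" if "A \<subseteq> Pow (set xs)" "B \<subseteq> Pow (set xs)" for A B
          by (rule inj_on_image_set_diff[OF inj_img]) (use that in auto)
        show ?thesis unfolding image_Un *[OF Pow[OF uv(1)] Pow[OF uv(2)]] *[OF Pow[OF uv(2)] Pow[OF uv(1)]] ..
      qed
      finally show ?thesis .
    qed
    show "(f \<circ> rt \<circ> g) u = (f \<circ> rt \<circ> g) v"
      if u: "u \<in> set (map f xs)" and v: "v \<in> set (map f xs)" and e: "e \<in> ?P u" "e \<in> ?P v" for u v e
    proof -
      obtain a where a: "a \<in> P (g u)" "e = f ` a" using e(1) by blast
      obtain b where b: "b \<in> P (g v)" "e = f ` b" using e(2) by blast
      have "a = b"
        using a b inj_onD[OF inj_img, of a b] edge[OF gin(1)[OF u] a(1)] edge[OF gin(1)[OF v] b(1)]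
        by simp
      then show ?thesis
        using common_edge_root[OF gin(1)[OF u] gin(1)[OF v]] a b by simp
    qed
    show "\<exists>ys zs ws. map f xs = ys @ zs @ ws \<and> {v \<in> set (map f xs). e \<in> ?P v} = set zs" for e
    proof (cases "\<exists>v\<in>set (map f xs). e \<in> ?P v")
      case False
      then show ?thesis by (intro exI[of _ "map f xs"] exI[of _ "[]"]) auto
    next
      case True
      then obtain v a where va: "v \<in> set (map f xs)" "a \<in> P (g v)" "e = f ` a" by blast
      have a: "a \<subseteq> set xs" using edge[OF gin(1)[OF va(1)] va(2)] .
      obtain ys zs ws where d: "xs = ys @ zs @ ws" "{v \<in> set xs. a \<in> P v} = set zs"
        using below_consecutive by blast
      have "{v \<in> set (map f xs). e \<in> ?P v} = f ` {v \<in> set xs. a \<in> P v}"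
      proof (intro equalityI subsetI)
        fix y assume y: "y \<in> {v \<in> set (map f xs). e \<in> ?P v}"
        then obtain b where b: "b \<in> P (g y)" "e = f ` b" by blast
        have gy: "g y \<in> set xs" "f (g y) = y" using gin y by blast+
        have "a = b" using va(3) b(2) inj_onD[OF inj_img, of a b] a edge[OF gy(1) b(1)] by simp
        then show "y \<in> f ` {v \<in> set xs. a \<in> P v}" using gy b by (intro image_eqI[of _ _ "g y"]) auto
      next
        fix y assume "y \<in> f ` {v \<in> set xs. a \<in> P v}"
        then obtain x where "x \<in> set xs" "a \<in> P x" "y = f x" by blast
        then show "y \<in> {v \<in> set (map f xs). e \<in> ?P v}" using va(3) by (simp add: gf)
      qed
      then have "{v \<in> set (map f xs). e \<in> ?P v} = set (map f zs)" using d(2) by simp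
      then show ?thesis using d(1) by (intro exI[of _ "map f ys"] exI[of _ "map f zs"] exI[of _ "map f ws"]) simp
    qed
    fix F' :: "'b set set" assume F': "finite F'"
    define F where "F = {e \<in> Pow (set xs). f ` e \<in> F'}"
    have F: "finite F" by (simp add: F_def)
    have inter: "(`) f ` A \<inter> F' = (`) f ` (A \<inter> F)" if "A \<subseteq> Pow (set xs)" for A
      using that by (auto simp: F_def)
    have sig: "?P y \<inter> F' = (`) f ` (P (g y) \<inter> F)" if "y \<in> set (map f xs)" for y
      using gin[OF that] Pow by (intro inter) auto
    have "(\<lambda>v. ?P v \<inter> F') ` set (map f xs) = (\<lambda>v. (`) f ` (P (g v) \<inter> F)) ` set (map f xs)"
      by (intro image_cong refl sig)
    also have "\<dots> = (`) ((`) f) ` (\<lambda>v. P v \<inter> F) ` set xs"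
      by (auto simp: image_image gf intro!: image_cong)
    finally have "card ((\<lambda>v. ?P v \<inter> F') ` set (map f xs)) \<le> card ((\<lambda>v. P v \<inter> F) ` set xs)"
      by (simp add: card_image_le)
    also have "\<dots> \<le> card (F \<inter> \<Union>(P ` set xs)) + 1" by (rule card_signatures[OF F])
    also have "card (F \<inter> \<Union>(P ` set xs)) = card ((`) f ` (F \<inter> \<Union>(P ` set xs)))"
      by (rule card_image[symmetric], rule inj_on_subset[OF inj_img]) (auto simp: F_def)
    also have "(`) f ` (F \<inter> \<Union>(P ` set xs)) = F' \<inter> \<Union>(?P ` set (map f xs))"
    proof -
      have "\<Union>(?P ` set (map f xs)) = (`) f ` \<Union>(P ` set xs)" by (auto simp: gf)
      moreover have "\<Union>(P ` set xs) \<subseteq> Pow (set xs)" using Pow by blast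
      ultimately show ?thesis using inter[of "\<Union>(P ` set xs)"] by (simp add: Int_commute)
    qed
    finally show "card ((\<lambda>v. ?P v \<inter> F') ` set (map f xs)) \<le> card (F' \<inter> \<Union>(?P ` set (map f xs))) + 1"
      by simp
  qed
qed

text \<open>Vertices are named by their preorder positions, so an edge can describe the vertices
  below it by two numbers.\<close>

locale numbered_graph =
  fixes n :: nat and E :: "nat set set" and rt :: "nat \<Rightarrow> nat" and P :: "nat \<Rightarrow> nat set set"
  assumes forest: "rooted_forest E rt [0..<n] P"
    and E: "E \<subseteq> pairs {..<n}"
    and rt_eq_iff: "u < n \<Longrightarrow> v < n \<Longrightarrow> rt u = rt v \<longleftrightarrow> connected_by E u v"
begin

interpretation rooted_forest E rt "[0..<n]" P by (rule forest)

lemma finite_E: "finite E"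
  by (rule finite_subset[OF E]) (auto simp: pairs_def intro: finite_subset[of _ "Pow {..<n}"])

lemma path_sub: "v < n \<Longrightarrow> P v \<subseteq> E"
  using path_subset by simp

lemma finite_path: "v < n \<Longrightarrow> finite (P v)"
  using path_sub finite_E finite_subset by blast

lemma root_less: "v < n \<Longrightarrow> rt v < n"
  using root_in by simp

text \<open>This covers every \<open>e\<close>: an edge outside the forest receives an interval
  without vertices, so faults on and off the forest are treated alike.\<close>

lemma ex_interval: "\<exists>lo hi. lo \<le> n \<and> hi \<le> n \<and> (\<forall>v<n. e \<in> P v \<longleftrightarrow> lo \<le> v \<and> v < hi)"
proof -
  obtain ys zs ws where d: "[0..<n] = ys @ zs @ ws" "{v \<in> set [0..<n]. e \<in> P v} = set zs"
    using below_consecutive by blast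
  let ?lo = "length ys" and ?hi = "length ys + length zs"
  have len: "?hi \<le> n" using arg_cong[OF d(1), of length] by simp
  have "zs = take (length zs) (drop ?lo [0..<n])" by (simp add: d(1))
  also have "\<dots> = [?lo..<?hi]" using len by (simp add: take_upt)
  finally have "set zs = set [?lo..<?hi]" by (rule arg_cong)
  then have zs: "set zs = {?lo..<?hi}" by simp
  have "\<forall>v<n. e \<in> P v \<longleftrightarrow> ?lo \<le> v \<and> v < ?hi"
  proof (intro allI impI)
    fix v assume v: "v < n"
    have "v \<in> {v \<in> set [0..<n]. e \<in> P v} \<longleftrightarrow> v \<in> {?lo..<?hi}" unfolding d(2) zs ..
    then show "e \<in> P v \<longleftrightarrow> ?lo \<le> v \<and> v < ?hi" using v by simp
  qed
  then show ?thesis using len by (intro exI[of _ ?lo] exI[of _ ?hi]) simp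
qed

text \<open>Signatures name the pieces of the forest minus \<open>F\<close>, except that all pieces
  containing a root share the empty one. The bound is therefore independent of the number of
  trees.\<close>

lemma card_signatures_le:
  assumes "finite F"
  shows "card ((\<lambda>v. P v \<inter> F) ` {..<n}) \<le> card F + 1"
proof -
  have "card ((\<lambda>v. P v \<inter> F) ` {..<n}) \<le> card (F \<inter> \<Union>(P ` set [0..<n])) + 1"
    using card_signatures[OF assms] by (simp add: lessThan_atLeast0)
  also have "card (F \<inter> \<Union>(P ` set [0..<n])) \<le> card F" using assms by (intro card_mono) auto
  finally show ?thesis by simp
qed

text \<open>Telescoping along root paths writes the indicator function of \<open>C\<close>, up to its common value at
  the roots, as a sum over the forest edges that cross \<open>C\<close>, and these all lie in \<open>F\<close>.\<close>

lemma ex_subtree_combination: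
  assumes F: "finite F" and C: "\<And>u v. u < n \<Longrightarrow> v < n \<Longrightarrow> P u \<inter> F = P v \<inter> F \<Longrightarrow> u \<in> C \<longleftrightarrow> v \<in> C"
  shows "\<exists>X\<subseteq>F. (\<forall>v<n. (\<Sum>e\<in>X. of_bool (e \<in> P v)) = (of_bool (v \<in> C) :: bit)) \<or>
    (\<forall>v<n. (\<Sum>e\<in>X. of_bool (e \<in> P v)) = (of_bool (v \<notin> C) :: bit))"
proof (cases "n = 0")
  case True
  then show ?thesis by (intro exI[of _ "{}"]) simp
next
  case False
  define \<phi> :: "nat \<Rightarrow> bit" where "\<phi> v = of_bool (v \<in> C)" for v
  define x where "x e = (\<Sum>u\<in>e. \<phi> u)" for e
  define X where "X = {e \<in> F. x e = 1}"
  have x0: "x e = 0" if "v < n" "e \<in> P v" "e \<notin> F" for e v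
  proof -
    obtain u z where uz: "u < n" "z < n" "e = {u, z}" "P z = insert e (P u)"
      using path_edge[of v e] \<open>v < n\<close> \<open>e \<in> P v\<close> by auto
    have "P z \<inter> F = P u \<inter> F" using uz(4) \<open>e \<notin> F\<close> by auto
    then have "\<phi> z = \<phi> u" using C[OF uz(2,1)] by (simp add: \<phi>_def)
    moreover have "u \<noteq> z" using E path_sub[OF \<open>v < n\<close>] \<open>e \<in> P v\<close> uz(3) by (auto simp: pairs_def card_2_iff)
    ultimately show ?thesis by (simp add: x_def uz(3))
  qed
  have sum_X: "(\<Sum>e\<in>X. of_bool (e \<in> P v)) = \<phi> v + \<phi> (rt v)" if v: "v < n" for v
  proof -
    have "(\<Sum>e\<in>X. of_bool (e \<in> P v)) = (\<Sum>e\<in>X \<inter> P v. 1 :: bit)"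
      using F by (auto simp: X_def of_bool_def sum.If_cases Int_def)
    also have "\<dots> = (\<Sum>e\<in>X \<inter> P v. x e)" by (intro sum.cong) (auto simp: X_def)
    also have "\<dots> = (\<Sum>e\<in>P v. x e)"
    proof (rule sum.mono_neutral_left[OF finite_path[OF v]])
      show "\<forall>e\<in>P v - X \<inter> P v. x e = 0"
      proof
        fix e assume e: "e \<in> P v - X \<inter> P v"
        show "x e = 0"
        proof (cases "e \<in> F")
          case True
          then have "x e \<noteq> 1" using e by (auto simp: X_def)
          then show ?thesis by (simp add: bit_not_one_iff)
        next
          case False
          then show ?thesis using x0[OF v] e by blast
        qed
      qed
    qed simp
    also have "\<dots> = \<phi> v + \<phi> (rt v)" unfolding x_def using v by (intro telescope) simp
    finally show ?thesis .
  qed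
  \<comment> \<open>All roots have the empty signature, so one complementation serves all trees at
    once.\<close>
  have rt: "\<phi> (rt v) = \<phi> (rt 0)" if v: "v < n" for v
  proof -
    have "P (rt v) = {}" "P (rt 0) = {}" using path_root v False by simp_all
    then show ?thesis using C[of "rt v" "rt 0"] root_less[OF v] root_less[of 0] False by (simp add: \<phi>_def)
  qed
  have "X \<subseteq> F" by (auto simp: X_def)
  moreover have "(\<forall>v<n. (\<Sum>e\<in>X. of_bool (e \<in> P v)) = (of_bool (v \<in> C) :: bit)) \<or>
      (\<forall>v<n. (\<Sum>e\<in>X. of_bool (e \<in> P v)) = (of_bool (v \<notin> C) :: bit))"
  proof (cases "rt 0 \<in> C")
    case True
    then show ?thesis using sum_X rt by (auto simp: \<phi>_def)
  next
    case False
    then show ?thesis using sum_X rt by (auto simp: \<phi>_def)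
  qed
  ultimately show ?thesis by blast
qed

text \<open>At least one of \<open>s\<close>, \<open>t\<close> is cut off from their common root;
  take its component in \<open>E - F\<close>. A component avoiding its root contains no vertex of
  empty signature, and a nonempty signature determines the tree, so the shared signature of the
  roots does no harm.\<close>

lemma ex_separating_cut:
  assumes st: "s < n" "t < n" "rt s = rt t" and disc: "\<not> connected_by (E - F) s t"
  shows "\<exists>C\<subseteq>{..<n}. closed_under (E - F) C \<and> (s \<in> C) \<noteq> (t \<in> C) \<and>
    (\<forall>u<n. \<forall>v<n. P u \<inter> F = P v \<inter> F \<longrightarrow> (u \<in> C \<longleftrightarrow> v \<in> C))"
proof -
  have "\<exists>a b. {a, b} = {s, t} \<and> a < n \<and> b < n \<and> rt a = rt b \<and> \<not> connected_by (E - F) a b \<and> \<not> connected_by (E - F) a (rt a)"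
  proof (cases "connected_by (E - F) s (rt s)")
    case False
    then show ?thesis using st disc by (intro exI[of _ s] exI[of _ t]) simp
  next
    case True
    have "\<not> connected_by (E - F) t (rt t)"
    proof
      assume "connected_by (E - F) t (rt t)"
      then have "connected_by (E - F) (rt s) t"
        unfolding st(3) by (rule connected_by_sym)
      then show False using connected_by_trans[OF True] disc by blast
    qed
    moreover have "\<not> connected_by (E - F) t s" using disc by (simp only: connected_by_commute[of "E - F" t s] not_False_eq_True)
    ultimately show ?thesis using st(1,2) st(3)[symmetric]
      by (intro exI[of _ t] exI[of _ s] conjI) (simp_all add: insert_commute)
  qed
  then obtain a b where ab: "{a, b} = {s, t}" "a < n" "b < n" "\<not> connected_by (E - F) a b"
    "\<not> connected_by (E - F) a (rt a)" by blast
  define C where "C = {v \<in> {..<n}. connected_by (E - F) a v}"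
  have cl: "closed_under (E - F) C"
    unfolding C_def component_of_def[symmetric] using E ab(2)
    by (intro closed_under_components[of "{..<n}"] links_on_pairs component_of_in_components) auto
  have *: "v \<in> C" if u: "u \<in> C" and v: "v < n" and sig: "P u \<inter> F = P v \<inter> F" for u v
  proof -
    have u': "u < n" "connected_by (E - F) a u" using u by (auto simp: C_def)
    have conn: "connected_by (E - F) x y" if "x < n" "y < n" "rt x = rt y" "P x \<inter> F = P y \<inter> F" for x y
      using path_connects[of x y] that path_sub[OF that(1)] path_sub[OF that(2)]
      by (auto elim!: connected_by_mono)
    have "rt a = rt u" using connected_by_mono[OF u'(2), of E] rt_eq_iff[OF ab(2) u'(1)] by auto
    have "P u \<inter> F \<noteq> {}"
    proof
      assume e: "P u \<inter> F = {}"
      have "P (rt u) = {}" "rt (rt u) = rt u"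
        using path_root[of u] root_root[of u] u'(1) by simp_all
      then have "connected_by (E - F) u (rt u)" using conn[of u "rt u"] u'(1) root_less e by simp
      then show False using connected_by_trans[OF u'(2)] ab(5) \<open>rt a = rt u\<close> by simp
    qed
    then obtain e where e: "e \<in> P u \<inter> F" by (meson ex_in_conv)
    then have "e \<in> P v \<inter> F" by (simp only: sig)
    then have "rt u = rt v" using common_edge_root[of u v e] e u'(1) v by simp
    then have "connected_by (E - F) u v" using conn u'(1) v sig by simp
    then show ?thesis using connected_by_trans[OF u'(2)] v by (simp add: C_def)
  qed
  have "a \<in> C" "b \<notin> C" using ab by (auto simp: C_def)
  then have "(s \<in> C) \<noteq> (t \<in> C)" using ab(1) by (auto simp: doubleton_eq_iff)
  then show ?thesis using cl * by (intro exI[of _ C]) (auto simp: C_def)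
qed

text \<open>The boundary sum of the subtree in vertex form: an edge with both ends below
  \<open>e\<close> occurs twice and cancels. In this form linearity in the vertex set is
  immediate.\<close>

definition subtree_sum :: "(nat set \<Rightarrow> vec) \<Rightarrow> nat set \<Rightarrow> vec" where
  "subtree_sum r e = (\<Sum>v\<in>{v. v < n \<and> e \<in> P v}. \<Sum>e'\<in>{e' \<in> E. v \<in> e'}. r e')"

text \<open>After exchanging the sums, an edge is counted once for each endpoint in
  \<open>S\<close>, which is an odd number exactly when it crosses \<open>S\<close>.\<close>

lemma sum_subtree_sums:
  assumes X: "finite X" and S: "\<And>v. v < n \<Longrightarrow> (\<Sum>e\<in>X. of_bool (e \<in> P v)) = (of_bool (v \<in> S) :: bit)"
  shows "(\<Sum>e\<in>X. subtree_sum r e) = cut_sum E r S"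
proof
  fix p
  have count: "(\<Sum>v<n. of_bool (v \<in> S) * of_bool (v \<in> e)) = (of_bool (crosses e S) :: bit)" if e: "e \<in> E" for e
  proof -
    from E e have "e \<in> pairs {..<n}" by blast
    then obtain x y where xy: "x \<in> {..<n}" "y \<in> {..<n}" "x \<noteq> y" "e = {x, y}" by (rule pairs_cases)
    have "(\<Sum>v<n. of_bool (v \<in> S) * of_bool (v \<in> e)) = (\<Sum>v\<in>{x, y}. of_bool (v \<in> S) :: bit)"
      using xy by (intro sum.mono_neutral_cong_right) auto
    also have "\<dots> = of_bool (x \<in> S) + of_bool (y \<in> S)" using xy(3) by (subst sum.insert) simp_all
    also have "\<dots> = of_bool (crosses e S)" by (simp only: of_bool_add_bit crosses_pair xy(4))
    finally show ?thesis .
  qed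
  have "(\<Sum>e\<in>X. subtree_sum r e) p =
      (\<Sum>e\<in>X. \<Sum>v<n. of_bool (e \<in> P v) * (\<Sum>e'\<in>E. of_bool (v \<in> e') * r e' p))"
    using finite_E by (simp add: subtree_sum_def sum_fun_apply of_bool_def sum.If_cases Int_def
        if_distrib[of "\<lambda>x. x * _"] cong: if_cong)
  also have "\<dots> = (\<Sum>v<n. \<Sum>e\<in>X. of_bool (e \<in> P v) * (\<Sum>e'\<in>E. of_bool (v \<in> e') * r e' p))"
    by (rule sum.swap)
  also have "\<dots> = (\<Sum>v<n. of_bool (v \<in> S) * (\<Sum>e'\<in>E. of_bool (v \<in> e') * r e' p))"
    using S by (simp flip: sum_distrib_right)
  also have "\<dots> = (\<Sum>v<n. \<Sum>e'\<in>E. of_bool (v \<in> S) * of_bool (v \<in> e') * r e' p)"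
    by (simp only: sum_distrib_left mult.assoc)
  also have "\<dots> = (\<Sum>e'\<in>E. \<Sum>v<n. of_bool (v \<in> S) * of_bool (v \<in> e') * r e' p)"
    by (rule sum.swap)
  also have "\<dots> = (\<Sum>e'\<in>E. of_bool (crosses e' S) * r e' p)"
    using count by (simp only: sum_distrib_right[symmetric] cong: sum.cong)
  also have "\<dots> = cut_sum E r S p"
    using finite_E by (simp add: cut_sum_def sum_fun_apply of_bool_def sum.If_cases Int_def
        if_distrib[of "\<lambda>x. x * _"] cong: if_cong)
  finally show "(\<Sum>e\<in>X. subtree_sum r e) p = cut_sum E r S p" .
qed

end

section \<open>The decoder\<close>


definition segment :: "nat \<Rightarrow> nat \<Rightarrow> vec \<Rightarrow> vec" where
  "segment a m v = (\<lambda>q. if q < m then v (a + q) else 0)"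

lemma segment_sum: "segment a m (\<Sum>i\<in>A. f i) = (\<Sum>i\<in>A. segment a m (f i))"
  by (auto simp: segment_def sum_fun_apply fun_eq_iff)

lemma segment_cut_sum: "segment a m (cut_sum G r C) = cut_sum G (\<lambda>e. segment a m (r e)) C"
  by (simp add: cut_sum_def segment_sum)

text \<open>The word of round \<open>i\<close> and level \<open>j\<close> starts at
  \<open>(i * J + j) * m\<close>, and the \<open>b\<close> check bits come last. Because addition is
  positionwise, one sum over a cut yields all sketches of that cut.\<close>

definition flatten :: "nat \<Rightarrow> nat \<Rightarrow> nat \<Rightarrow> nat \<Rightarrow> (nat \<Rightarrow> nat \<Rightarrow> vec) \<Rightarrow> vec \<Rightarrow> vec" where
  "flatten m J R b y z = (\<lambda>p. if p < R * J * m then y (p div m div J) (p div m mod J) (p mod m)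
     else if p < R * J * m + b then z (p - R * J * m) else 0)"

lemma flatten_in_vecs: "flatten m J R b y z \<in> vecs (R * J * m + b)"
  by (simp add: flatten_def vecs_def)

lemma segment_flatten:
  assumes "i < R" "j < J" "y i j \<in> vecs m"
  shows "segment ((i * J + j) * m) m (flatten m J R b y z) = y i j"
proof
  fix q
  show "segment ((i * J + j) * m) m (flatten m J R b y z) q = y i j q"
  proof (cases "q < m")
    case True
    let ?p = "(i * J + j) * m + q"
    have "i * J + j < R * J"
    proof -
      have "i * J + j < Suc i * J" using assms(2) by simp
      also have "\<dots> \<le> R * J" using assms(1) by (intro mult_right_mono) auto
      finally show ?thesis .
    qed
    then have "Suc (i * J + j) * m \<le> R * J * m" by (intro mult_right_mono) auto
    then have "?p < R * J * m" using True by simp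
    moreover have "?p div m = i * J + j" "?p mod m = q" using True by simp_all
    moreover have "(i * J + j) div J = i" "(i * J + j) mod J = j" using assms(2) by simp_all
    ultimately show ?thesis using True by (simp add: segment_def flatten_def)
  next
    case False
    then show ?thesis using assms(3) by (simp add: segment_def vecs_def)
  qed
qed

lemma segment_flatten_check:
  assumes "z \<in> vecs b"
  shows "segment (R * J * m) b (flatten m J R b y z) = z"
  using assms by (auto simp: segment_def flatten_def vecs_def fun_eq_iff)

datatype edge_info = Edge_Info (ends: "nat set") (lo: nat) (hi: nat) (own: vec) (below: vec)

text \<open>\<open>Q\<close> holds the information on the faulty edges. The selected \<open>X\<close> exists if \<open>C\<close> does not split
  any component of the forest minus the faulty edges.\<close>

definition cut_vec :: "nat \<Rightarrow> edge_info set \<Rightarrow> nat set \<Rightarrow> vec" where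
  "cut_vec n Q C =
     (let X = (SOME X. X \<subseteq> Q \<and>
        ((\<forall>v<n. (\<Sum>q\<in>X. of_bool (lo q \<le> v \<and> v < hi q)) = (of_bool (v \<in> C) :: bit)) \<or>
         (\<forall>v<n. (\<Sum>q\<in>X. of_bool (lo q \<le> v \<and> v < hi q)) = (of_bool (v \<notin> C) :: bit))))
      in (\<Sum>q\<in>X. below q) + (\<Sum>q\<in>{q\<in>Q. crosses (ends q) C}. own q))"

text \<open>Computed from the intervals of the faulty edges alone. It joins the vertices of each
  forest piece, and also the root pieces of different trees to one another.\<close>

definition sig_links :: "nat \<Rightarrow> edge_info set \<Rightarrow> nat set set" where
  "sig_links n Q = {{u, v} | u v. u \<in> {..<n} \<and> v \<in> {..<n} \<and>
     {q \<in> Q. lo q \<le> u \<and> u < hi q} = {q \<in> Q. lo q \<le> v \<and> v < hi q}}"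

definition learn :: "nat \<Rightarrow> nat \<Rightarrow> nat \<Rightarrow> nat \<Rightarrow> (nat set \<Rightarrow> nat \<Rightarrow> vec) \<Rightarrow> edge_info set \<Rightarrow> nat \<Rightarrow>
    nat set set \<Rightarrow> nat set set" where
  "learn n J N m w Q i H =
     H \<union> decoded_links {..<n} J N w (\<lambda>j C. segment ((i * J + j) * m) m (cut_vec n Q C)) H"

text \<open>A separating candidate set with vanishing check is taken as proof of disconnection. The
  search runs over all vertex sets.\<close>

definition decode_connected :: "nat \<Rightarrow> nat \<Rightarrow> nat \<Rightarrow> nat \<Rightarrow> (nat set \<Rightarrow> nat \<Rightarrow> vec) \<Rightarrow> nat \<Rightarrow> nat \<Rightarrow>
    edge_info set \<Rightarrow> nat \<Rightarrow> nat \<Rightarrow> bool" where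
  "decode_connected n J N m w R b Q s t \<longleftrightarrow>
     \<not> (\<exists>C\<subseteq>{..<n}. closed_under (fold (learn n J N m w Q) [0..<R] (sig_links n Q)) C \<and>
        (s \<in> C) \<noteq> (t \<in> C) \<and> segment (R * J * m) b (cut_vec n Q C) = 0)"

section \<open>Correctness outside the error event\<close>

lemma decoded_links_cong:
  assumes "\<And>C j. C \<in> link_components V H \<Longrightarrow> j < J \<Longrightarrow> sk j C = sk' j C"
  shows "decoded_links V J N w sk H = decoded_links V J N w sk' H"
  unfolding decoded_links_def
  by (intro Collect_cong conj_cong refl bex_cong ex_cong1) (simp_all add: assms)

lemma closed_under_mono: "closed_under H C \<Longrightarrow> H' \<subseteq> H \<Longrightarrow> closed_under H' C"
  by (auto simp: closed_under_def)

lemma closed_under_Un: "closed_under (H \<union> H') C \<longleftrightarrow> closed_under H C \<and> closed_under H' C"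
  by (auto simp: closed_under_def)

lemma links_on_sig_links: "links_on {..<n} (sig_links n Q)"
  unfolding links_on_def sig_links_def by blast

lemma cut_sum_compl: "cut_sum G r (- C) = cut_sum G r C"
proof -
  have "crosses e (- C) \<longleftrightarrow> crosses e C" for e by (auto simp: crosses_def)
  then show ?thesis by (simp add: cut_sum_def)
qed

lemma cut_sum_Diff:
  assumes "finite E" "F \<subseteq> E"
  shows "cut_sum E r C + cut_sum F r C = cut_sum (E - F) r C"
proof -
  have "{e \<in> E. crosses e C} = {e \<in> E - F. crosses e C} \<union> {e \<in> F. crosses e C}" using assms by blast
  moreover have "finite F" using assms finite_subset by blast
  ultimately have "cut_sum E r C = cut_sum (E - F) r C + cut_sum F r C"
    unfolding cut_sum_def using assms by (subst sum.union_disjoint[symmetric]) auto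
  then show ?thesis by (simp add: add.assoc)
qed

lemma (in numbered_graph) card_active_signatures_le:
  assumes "finite F"
  shows "card (active_components {..<n} G
    {{u, v} | u v. u \<in> {..<n} \<and> v \<in> {..<n} \<and> P u \<inter> F = P v \<inter> F}) \<le> card F + 1" (is "card (active_components _ _ ?H) \<le> _")
proof -
  have "card (active_components {..<n} G ?H) \<le> card (link_components {..<n} ?H)"
    by (intro card_mono finite_components) (auto simp: active_components_def)
  also have "\<dots> \<le> card ((\<lambda>v. P v \<inter> F) ` {..<n})"
    by (rule card_components_fibres_le) simp
  also have "\<dots> \<le> card F + 1" by (rule card_signatures_le[OF assms])
  finally show ?thesis .
qed

text \<open>One query together with one fixed outcome of the randomness; everything in this locale
  is deterministic.\<close>

locale faulty_query = numbered_graph n E rt P + boruvka "{..<n}" E "E - F" J N w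
  for n E rt P F J N w +
  fixes m R b :: nat and lo\<^sub>E hi\<^sub>E :: "nat set \<Rightarrow> nat"
    and \<omega>s :: "((nat \<times> nat set \<Rightarrow> bool) \<times> (nat \<times> nat set \<Rightarrow> nat)) list" and \<eta> :: "nat set \<Rightarrow> vec"
  assumes F: "F \<subseteq> E"
    and w_vecs: "e \<in> pairs {..<n} \<Longrightarrow> k < N \<Longrightarrow> w e k \<in> vecs m"
    and interval: "v < n \<Longrightarrow> e \<in> P v \<longleftrightarrow> lo\<^sub>E e \<le> v \<and> v < hi\<^sub>E e"
    and length_\<omega>s: "length \<omega>s = R"
    and ids: "\<omega>' \<in> set \<omega>s \<Longrightarrow> snd \<omega>' i < N"
    and \<eta>: "\<eta> e \<in> vecs b"
begin

definition rvec :: "nat set \<Rightarrow> vec" where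
  "rvec e = flatten m J R b (\<lambda>i j. round_vec w (\<omega>s ! i) j e) (\<eta> e)"

definition info :: "nat set \<Rightarrow> edge_info" where
  "info e = Edge_Info e (lo\<^sub>E e) (hi\<^sub>E e) (rvec e) (subtree_sum rvec e)"

abbreviation Q :: "edge_info set" where
  "Q \<equiv> info ` F"

lemma info_sel [simp]:
  "ends (info e) = e" "lo (info e) = lo\<^sub>E e" "hi (info e) = hi\<^sub>E e"
  "own (info e) = rvec e" "below (info e) = subtree_sum rvec e"
  by (simp_all add: info_def)

lemma inj_info: "inj_on info A"
  by (auto simp: inj_on_def info_def)

lemma finite_F: "finite F"
  using F finite_E finite_subset by blast

lemma sig_info:
  assumes "v < n"
  shows "{q \<in> Q. lo q \<le> v \<and> v < hi q} = info ` (P v \<inter> F)"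
  unfolding Compr_image_eq using interval[OF assms] by (intro arg_cong[of _ _ "(`) info"]) auto

lemma sig_links_eq: "sig_links n Q = {{u, v} | u v. u \<in> {..<n} \<and> v \<in> {..<n} \<and> P u \<inter> F = P v \<inter> F}"
proof -
  have "info ` A = info ` B \<longleftrightarrow> A = B" for A B
    using inj_info[of UNIV] by (rule inj_image_eq_iff)
  then have "{q \<in> Q. lo q \<le> u \<and> u < hi q} = {q \<in> Q. lo q \<le> v \<and> v < hi q} \<longleftrightarrow> P u \<inter> F = P v \<inter> F"
    if "u < n" "v < n" for u v
    unfolding sig_info[OF that(1)] sig_info[OF that(2)] .
  then show ?thesis unfolding sig_links_def by (intro Collect_cong ex_cong1 conj_cong refl) auto
qed

lemma closed_under_sig_iff:
  assumes "closed_under (sig_links n Q) C" "u < n" "v < n" "P u \<inter> F = P v \<inter> F"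
  shows "u \<in> C \<longleftrightarrow> v \<in> C"
proof -
  have "{u, v} \<in> sig_links n Q" unfolding sig_links_eq using assms by blast
  then have "\<not> crosses {u, v} C" using assms(1) by (simp add: closed_under_def)
  then show ?thesis by (simp add: crosses_pair)
qed

text \<open>The selected \<open>X\<close> need not be unique, but a set and its complement have the
  same cut, so every admissible choice gives the same sum. In characteristic 2, adding the vectors
  of the crossing faulty edges removes them.\<close>

lemma cut_vec_eq:
  assumes C: "closed_under (sig_links n Q) C"
  shows "cut_vec n Q C = cut_sum (E - F) rvec C"
proof -
  let ?good = "\<lambda>X. X \<subseteq> Q \<and>
        ((\<forall>v<n. (\<Sum>q\<in>X. of_bool (lo q \<le> v \<and> v < hi q)) = (of_bool (v \<in> C) :: bit)) \<or>
         (\<forall>v<n. (\<Sum>q\<in>X. of_bool (lo q \<le> v \<and> v < hi q)) = (of_bool (v \<notin> C) :: bit)))"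
  have reindex: "(\<Sum>q\<in>info ` Y. of_bool (lo q \<le> v \<and> v < hi q)) = (\<Sum>e\<in>Y. of_bool (e \<in> P v) :: bit)"
    if "v < n" for Y v
    by (subst sum.reindex[OF inj_info]) (simp add: interval[OF that])
  define X where "X = (SOME X. ?good X)"
  have "\<exists>X. ?good X"
  proof -
    obtain Y where Y: "Y \<subseteq> F" "(\<forall>v<n. (\<Sum>e\<in>Y. of_bool (e \<in> P v)) = (of_bool (v \<in> C) :: bit)) \<or>
        (\<forall>v<n. (\<Sum>e\<in>Y. of_bool (e \<in> P v)) = (of_bool (v \<notin> C) :: bit))"
      using ex_subtree_combination[OF finite_F, of C] closed_under_sig_iff[OF C] by blast
    then have "?good (info ` Y)" using reindex by (simp add: image_mono)
    then show ?thesis by blast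
  qed
  then have X: "?good X" unfolding X_def by (rule someI_ex)
  then obtain Y where Y: "Y \<subseteq> F" "X = info ` Y" by (meson subset_imageE)
  have fY: "finite Y" using Y finite_F finite_subset by blast
  have "(\<Sum>q\<in>X. below q) = (\<Sum>e\<in>Y. subtree_sum rvec e)"
    unfolding Y(2) by (subst sum.reindex[OF inj_info]) simp
  also have "\<dots> = cut_sum E rvec C"
  proof -
    have "(\<forall>v<n. (\<Sum>e\<in>Y. of_bool (e \<in> P v)) = (of_bool (v \<in> C) :: bit)) \<or>
        (\<forall>v<n. (\<Sum>e\<in>Y. of_bool (e \<in> P v)) = (of_bool (v \<in> - C) :: bit))"
      using X reindex unfolding Y(2) by simp
    then show ?thesis
      using sum_subtree_sums[OF fY, of C] sum_subtree_sums[OF fY, of "- C"] by (metis cut_sum_compl)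
  qed
  finally have 1: "(\<Sum>q\<in>X. below q) = cut_sum E rvec C" .
  have "{q \<in> Q. crosses (ends q) C} = info ` {e \<in> F. crosses e C}"
    unfolding Compr_image_eq by simp
  then have 2: "(\<Sum>q\<in>{q\<in>Q. crosses (ends q) C}. own q) = cut_sum F rvec C"
    unfolding cut_sum_def by (simp add: sum.reindex[OF inj_info])
  have "cut_vec n Q C = cut_sum E rvec C + cut_sum F rvec C"
    unfolding cut_vec_def Let_def X_def[symmetric] 1 2 ..
  then show ?thesis using cut_sum_Diff finite_E F by simp
qed

lemma cut_sum_cong: "(\<And>e. e \<in> G \<Longrightarrow> r e = r' e) \<Longrightarrow> cut_sum G r C = cut_sum G r' C"
  unfolding cut_sum_def by (intro sum.cong) auto

lemma round_vec_in_vecs: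
  assumes "i < R" "e \<in> E"
  shows "round_vec w (\<omega>s ! i) j e \<in> vecs m"
proof -
  have "snd (\<omega>s ! i) (j, e) < N" using assms(1) length_\<omega>s by (intro ids nth_mem) simp
  moreover have "e \<in> pairs {..<n}" using assms(2) E by blast
  ultimately show ?thesis unfolding round_vec_def by (simp add: w_vecs)
qed

lemma segment_round:
  assumes "i < R" "j < J" "closed_under (sig_links n Q) C"
  shows "segment ((i * J + j) * m) m (cut_vec n Q C) = cut_sum (E - F) (round_vec w (\<omega>s ! i) j) C"
  unfolding cut_vec_eq[OF assms(3)] segment_cut_sum
proof (rule cut_sum_cong)
  fix e assume "e \<in> E - F"
  then show "segment ((i * J + j) * m) m (rvec e) = round_vec w (\<omega>s ! i) j e"
    unfolding rvec_def using assms round_vec_in_vecs by (intro segment_flatten) auto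
qed

lemma segment_check:
  assumes "closed_under (sig_links n Q) C"
  shows "segment (R * J * m) b (cut_vec n Q C) = cut_sum (E - F) \<eta> C"
  unfolding cut_vec_eq[OF assms] segment_cut_sum
  by (rule cut_sum_cong) (simp add: rvec_def segment_flatten_check \<eta>)

text \<open>Components of \<open>H\<close> are closed under the signature links in \<open>H\<close>,
  so for them the decoder computes the true sketches.\<close>

lemma learn_eq:
  assumes "links_on {..<n} H" "sig_links n Q \<subseteq> H" "i < R"
  shows "learn n J N m w Q i H = H \<union> links (\<omega>s ! i) H"
proof -
  have "closed_under (sig_links n Q) C" if "C \<in> link_components {..<n} H" for C
    using closed_under_mono[OF closed_under_components[OF assms(1) that] assms(2)] .
  then have "segment ((i * J + j) * m) m (cut_vec n Q C) = cut_sum (E - F) (round_vec w (\<omega>s ! i) j) C"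
    if "C \<in> link_components {..<n} H" "j < J" for C j
    using segment_round[OF assms(3) that(2)] that(1) by blast
  then show ?thesis
    unfolding learn_def links_def by (intro arg_cong[of _ _ "(\<union>) H"] decoded_links_cong)
qed

text \<open>The three conclusions serve different ends: keeping cut vectors computable, keeping true
  cuts among the candidates, and making a vanishing check conclusive.\<close>

lemma fold_learn:
  assumes "links_on {..<n} H" "sig_links n Q \<subseteq> H" "k \<le> R" "\<not> misdecodes H (drop k \<omega>s) \<eta>"
  shows "let H' = fold (learn n J N m w Q) [k..<R] H in
    H \<subseteq> H' \<and> H' \<subseteq> H \<union> (E - F) \<and>
    (\<forall>C\<subseteq>{..<n}. closed_under H' C \<and> (\<exists>e\<in>E - F. crosses e C) \<longrightarrow> cut_sum (E - F) \<eta> C \<noteq> 0)"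
  using assms
proof (induction "R - k" arbitrary: k H)
  case 0
  then have k: "k = R" by simp
  then have drop: "drop k \<omega>s = []" using length_\<omega>s by simp
  have ok: "\<not> (\<exists>C\<subseteq>{..<n}. closed_under H C \<and> (\<exists>e\<in>E - F. crosses e C) \<and> cut_sum (E - F) \<eta> C = 0)"
    using 0(5) unfolding drop misdecodes.simps .
  have "fold (learn n J N m w Q) [k..<R] H = H" by (simp add: k)
  then show ?case unfolding Let_def using ok by (simp only:) blast
next
  case (Suc d)
  then have k: "k < R" by simp
  have drop: "drop k \<omega>s = \<omega>s ! k # drop (Suc k) \<omega>s" using k length_\<omega>s by (simp add: Cons_nth_drop_Suc)
  let ?H = "H \<union> links (\<omega>s ! k) H"
  have step: "links (\<omega>s ! k) H \<subseteq> E - F" "\<not> misdecodes ?H (drop (Suc k) \<omega>s) \<eta>"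
    using Suc.prems(4) unfolding drop by simp_all
  have "links_on {..<n} ?H" using Suc.prems(1) links_on_pairs[OF links_pairs] by (simp add: links_on_Un)
  then have *: "let H' = fold (learn n J N m w Q) [Suc k..<R] ?H in
    ?H \<subseteq> H' \<and> H' \<subseteq> ?H \<union> (E - F) \<and>
    (\<forall>C\<subseteq>{..<n}. closed_under H' C \<and> (\<exists>e\<in>E - F. crosses e C) \<longrightarrow> cut_sum (E - F) \<eta> C \<noteq> 0)"
    using Suc.hyps(2) Suc.prems(2) k step(2) by (intro Suc.hyps(1)) auto
  let ?H' = "fold (learn n J N m w Q) [Suc k..<R] ?H"
  note IH = *[unfolded Let_def, THEN conjunct1] *[unfolded Let_def, THEN conjunct2, THEN conjunct1]
    *[unfolded Let_def, THEN conjunct2, THEN conjunct2]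
  have eq: "fold (learn n J N m w Q) [k..<R] H = fold (learn n J N m w Q) [Suc k..<R] ?H"
    using learn_eq[OF Suc.prems(1,2) k] k by (simp add: upt_conv_Cons)
  have "H \<subseteq> ?H'" using IH(1) by (rule subset_trans[OF Un_upper1])
  moreover have "?H' \<subseteq> H \<union> (E - F)" using IH(2) step(1) by blast
  ultimately show ?case unfolding Let_def eq using IH(3) by (intro conjI)
qed

text \<open>If \<open>s\<close> and \<open>t\<close> are connected, every separating candidate is
  crossed by a remaining edge and its check is nonzero. Otherwise a separating cut exists that
  respects signatures and true links; it is a candidate, and its check is an empty sum.\<close>

lemma decode_connected_correct:
  assumes st: "s < n" "t < n" "rt s = rt t" and ok: "\<not> misdecodes (sig_links n Q) \<omega>s \<eta>"
  shows "decode_connected n J N m w R b Q s t \<longleftrightarrow> connected_by (E - F) s t"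
proof -
  define H where "H = fold (learn n J N m w Q) [0..<R] (sig_links n Q)"
  have H: "sig_links n Q \<subseteq> H" "H \<subseteq> sig_links n Q \<union> (E - F)"
    "\<And>C. C \<subseteq> {..<n} \<Longrightarrow> closed_under H C \<Longrightarrow> \<exists>e\<in>E - F. crosses e C \<Longrightarrow> cut_sum (E - F) \<eta> C \<noteq> 0"
    using fold_learn[OF links_on_sig_links subset_refl, of 0] ok unfolding H_def Let_def by auto
  have dec: "decode_connected n J N m w R b Q s t \<longleftrightarrow>
      \<not> (\<exists>C\<subseteq>{..<n}. closed_under H C \<and> (s \<in> C) \<noteq> (t \<in> C) \<and> cut_sum (E - F) \<eta> C = 0)"
  proof -
    have "segment (R * J * m) b (cut_vec n Q C) = cut_sum (E - F) \<eta> C" if "closed_under H C" for C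
      by (rule segment_check[OF closed_under_mono[OF that H(1)]])
    then show ?thesis unfolding decode_connected_def H_def[symmetric]
      by (intro arg_cong[of _ _ Not] ex_cong1 conj_cong refl) simp
  qed
  show ?thesis
  proof
    assume conn: "connected_by (E - F) s t"
    show "decode_connected n J N m w R b Q s t"
      unfolding dec
    proof clarify
      fix C assume C: "C \<subseteq> {..<n}" "closed_under H C" "(s \<in> C) \<noteq> (t \<in> C)" "cut_sum (E - F) \<eta> C = 0"
      have "\<not> closed_under (E - F) C" using closed_under_connected[OF _ conn] C(3) by blast
      then have "\<exists>e\<in>E - F. crosses e C" by (simp add: closed_under_def)
      then show False using H(3)[OF C(1,2)] C(4) by simp
    qed
  next
    assume d: "decode_connected n J N m w R b Q s t"
    show "connected_by (E - F) s t"
    proof (rule ccontr)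
      assume "\<not> connected_by (E - F) s t"
      from ex_separating_cut[OF st this] obtain C where C: "C \<subseteq> {..<n}" "closed_under (E - F) C"
        "(s \<in> C) \<noteq> (t \<in> C)" "\<forall>u<n. \<forall>v<n. P u \<inter> F = P v \<inter> F \<longrightarrow> (u \<in> C \<longleftrightarrow> v \<in> C)"
        by (elim exE conjE)
      have "closed_under (sig_links n Q) C"
        unfolding closed_under_def
      proof
        fix e assume "e \<in> sig_links n Q"
        then obtain u v where uv: "e = {u, v}" "u < n" "v < n" "P u \<inter> F = P v \<inter> F"
          unfolding sig_links_eq mem_Collect_eq lessThan_iff by (elim exE conjE)
        have "u \<in> C \<longleftrightarrow> v \<in> C" by (rule C(4)[rule_format, OF uv(2-4)])
        then show "\<not> crosses e C" unfolding uv(1) crosses_pair by simp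
      qed
      then have "closed_under H C" using C(2) closed_under_mono[OF _ H(2)] by (simp add: closed_under_Un)
      moreover have "{e \<in> E - F. crosses e C} = {}" using C(2) unfolding closed_under_def by blast
      then have "cut_sum (E - F) \<eta> C = 0" by (simp only: cut_sum_def sum.empty)
      ultimately show False using d C(1,3) unfolding dec by blast
    qed
  qed
qed

end

section \<open>Parameters\<close>


definition ell :: "nat \<Rightarrow> nat" where
  "ell n = (LEAST l. n \<le> 2 ^ l)"

lemma le_2_ell: "n \<le> 2 ^ ell n"
  unfolding ell_def by (rule LeastI_ex) (meson less_exp less_imp_le)

lemma ell_pos:
  assumes "2 \<le> n"
  shows "1 \<le> ell n"
proof (rule ccontr)
  assume "\<not> 1 \<le> ell n"
  then have "ell n = 0" by simp
  then show False using le_2_ell[of n] assms by simp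
qed

lemma log_le_ell: "2 \<le> n \<Longrightarrow> log 2 (real n) \<le> real (ell n)"
  using le_2_ell[of n] by (simp add: log_le_iff powr_realpow)

lemma ell_le_log:
  assumes "2 \<le> n"
  shows "real (ell n) \<le> 2 * log 2 (real n)"
proof -
  have "\<not> n \<le> 2 ^ (ell n - 1)"
    unfolding ell_def[of n, symmetric] using ell_pos[OF assms] not_less_Least[of "ell n - 1" "\<lambda>l. n \<le> 2 ^ l"]
    by (simp add: ell_def)
  then have "real (2 ^ (ell n - 1)) \<le> real n" by (simp only: of_nat_le_iff)
  then have "real (ell n - 1) \<le> log 2 (real n)" using assms by (simp add: le_log_iff powr_realpow)
  moreover have "1 \<le> log 2 (real n)" using assms by (simp add: le_log_iff)
  ultimately show ?thesis using ell_pos[OF assms] by (simp add: of_nat_diff)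
qed

text \<open>\<open>2 ^ fault_exp n f\<close> is about \<open>f / log\<^sup>2 n\<close>; more than \<open>n\<^sup>2\<close> faults are impossible.\<close>

definition fault_exp :: "nat \<Rightarrow> nat \<Rightarrow> nat" where
  "fault_exp n f = (LEAST h. min f (n\<^sup>2) \<le> 2 ^ h * (ell n)\<^sup>2)"

lemma fault_exp:
  assumes "2 \<le> n"
  shows "min f (n\<^sup>2) \<le> 2 ^ fault_exp n f * (ell n)\<^sup>2" "fault_exp n f \<le> 2 * ell n"
proof -
  have "n\<^sup>2 \<le> (2 ^ ell n)\<^sup>2" using le_2_ell by (rule power_mono) simp
  also have "\<dots> = 2 ^ (2 * ell n) * 1" by (simp add: power_mult mult.commute power_even_eq)
  also have "\<dots> \<le> 2 ^ (2 * ell n) * (ell n)\<^sup>2" using ell_pos[OF assms] by (intro mult_left_mono) auto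
  finally have *: "min f (n\<^sup>2) \<le> 2 ^ (2 * ell n) * (ell n)\<^sup>2" by simp
  show "min f (n\<^sup>2) \<le> 2 ^ fault_exp n f * (ell n)\<^sup>2"
    unfolding fault_exp_def by (rule LeastI[of _ "2 * ell n"]) (rule *)
  show "fault_exp n f \<le> 2 * ell n"
    unfolding fault_exp_def by (rule Least_le) (rule *)
qed

text \<open>The hypothesis on \<open>f\<close> makes the logarithm at least 1. Minimality bounds
  \<open>fault_exp n f - 1\<close> by it, and the two remaining units are absorbed by the factor
  3.\<close>

lemma fault_exp_le_log:
  assumes n: "2 \<le> n" and f: "real f \<ge> 2 * (log 2 (real n))\<^sup>2"
  shows "real (fault_exp n f) + 1 \<le> 3 * log 2 (real f / (log 2 (real n))\<^sup>2)"
proof -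
  let ?L = "log 2 (real n)"
  have L: "1 \<le> ?L" using n by (simp add: le_log_iff)
  then have L2: "0 < ?L\<^sup>2" by (intro zero_less_power) linarith
  have x: "2 \<le> real f / ?L\<^sup>2" using f L2 by (simp add: field_simps)
  then have lx: "1 \<le> log 2 (real f / ?L\<^sup>2)" by (subst le_log_iff) auto
  show ?thesis
  proof (cases "fault_exp n f")
    case 0
    then show ?thesis using lx by simp
  next
    case (Suc h)
    have "\<not> min f (n\<^sup>2) \<le> 2 ^ h * (ell n)\<^sup>2"
      using not_less_Least[of h "\<lambda>h. min f (n\<^sup>2) \<le> 2 ^ h * (ell n)\<^sup>2"] Suc by (simp add: fault_exp_def)
    then have "2 ^ h * (ell n)\<^sup>2 \<le> f" by simp
    then have "real (2 ^ h * (ell n)\<^sup>2) \<le> real f" by (simp only: of_nat_le_iff)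
    then have "2 ^ h * (real (ell n))\<^sup>2 \<le> real f" by simp
    moreover have "2 ^ h * ?L\<^sup>2 \<le> 2 ^ h * (real (ell n))\<^sup>2"
      using log_le_ell[OF n] L by (intro mult_left_mono power_mono) auto
    ultimately have "2 ^ h * ?L\<^sup>2 \<le> real f" by (rule order_trans[rotated])
    then have "2 ^ h \<le> real f / ?L\<^sup>2" by (simp add: pos_le_divide_eq[OF L2])
    then have "real h \<le> log 2 (real f / ?L\<^sup>2)" using x by (subst le_log_iff) (auto simp: powr_realpow)
    then show ?thesis using Suc lx by simp
  qed
qed

text \<open>In the false-link bound the rounds, \<open>n\<close> and the levels contribute three
  factors \<open>2 ^ ell n\<close> and a constant \<open>1536 \<le> 2 ^ 11\<close>, hence 14 = 3 +
  11; \<open>c\<close> supplies the failure rate.\<close>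

definition ids_num :: "nat \<Rightarrow> nat \<Rightarrow> nat" where
  "ids_num c n = 2 ^ ((c + 14) * ell n)"

text \<open>Three times the exponent of the code size, which is 2 for the pairs and
  \<open>c + 14\<close> for the identifiers per unit of \<open>ell n\<close>; the last 1 makes the
  greedy inequality strict.\<close>

definition word_len :: "nat \<Rightarrow> nat \<Rightarrow> nat" where
  "word_len c n = 3 * (c + 16) * ell n + 1"

text \<open>Of the 66, two units cancel the bound \<open>2 * (ell n)\<^sup>2\<close> left after the
  rounds; the other \<open>64 * (c + 1)\<close> become \<open>c + 1\<close> after multiplication by
  \<open>\<mu> = 1 / 64\<close>.\<close>

definition check_len :: "nat \<Rightarrow> nat \<Rightarrow> nat" where
  "check_len c n = (66 + 64 * c) * (ell n)\<^sup>2"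

text \<open>As \<open>(63 / 64) ^ 64 \<le> 1 / 2\<close>, every 64 rounds halve the exponent, and
  \<open>64 * fault_exp n f\<close> rounds reduce it from at most
  \<open>2 ^ h * (2 * l\<^sup>2)\<close> to \<open>2 * l\<^sup>2\<close>. Each of the two error
  sources receives half of the allowance.\<close>

lemma failure_bound:
  assumes n: "2 \<le> n" and k: "k \<le> min f (n\<^sup>2) + 1"
  shows "real (64 * fault_exp n f) * (real n * real (2 * ell n) * (3 / real (ids_num c n))) +
    exp (1 / 64 * ((63 / 64) ^ (64 * fault_exp n f) * real k - real (check_len c n))) \<le> 1 / real n ^ c"
proof -
  define l where "l = ell n"
  define h where "h = fault_exp n f"
  have l: "1 \<le> l" using ell_pos[OF n] by (simp add: l_def)
  have h: "h \<le> 2 * l" using fault_exp(2)[OF n] by (simp add: h_def l_def)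
  have nl: "n \<le> 2 ^ l" using le_2_ell by (simp add: l_def)
  have main: "1 / 2 ^ (c * l) \<le> 1 / real n ^ c"
  proof -
    have "real n \<le> real (2 ^ l)" using nl by (simp only: of_nat_le_iff)
    then have "real n ^ c \<le> real (2 ^ l) ^ c" by (rule power_mono) simp
    also have "\<dots> = 2 ^ (c * l)" by (simp add: mult.commute flip: power_mult)
    finally show ?thesis using n by (intro divide_left_mono) auto
  qed
  have 1: "real (64 * h) * (real n * real (2 * l) * (3 / real (ids_num c n))) \<le> 1 / 2 * (1 / 2 ^ (c * l))"
  proof -
    have "l \<le> 2 ^ l" using less_exp[of l] by simp
    moreover from this have "h \<le> 2 * 2 ^ l" using h by linarith
    ultimately have "2 * (64 * h * (n * (2 * l) * 3)) \<le> 2 * (64 * (2 * 2 ^ l) * (2 ^ l * (2 * 2 ^ l) * 3))"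
      using nl by (intro mult_mono) auto
    also have "\<dots> = 1536 * (2 ^ l * 2 ^ l * 2 ^ l)" by simp
    also have "2 ^ l * 2 ^ l * 2 ^ l = (2 :: nat) ^ (l + l + l)" by (simp only: power_add)
    also have "l + l + l = 3 * l" by simp
    also have "1536 * 2 ^ (3 * l) \<le> 2 ^ 11 * (2 :: nat) ^ (3 * l)" by simp
    also have "\<dots> \<le> 2 ^ (11 * l) * 2 ^ (3 * l)" using l by (intro mult_right_mono power_increasing) auto
    also have "\<dots> = 2 ^ (14 * l)" by (simp flip: power_add)
    finally have "real (2 * (64 * h * (n * (2 * l) * 3))) \<le> real (2 ^ (14 * l))" by (simp only: of_nat_le_iff)
    then have "2 * (real (64 * h) * (real n * real (2 * l) * 3)) \<le> 2 ^ (14 * l)" by simp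
    then have "2 * (real (64 * h) * (real n * real (2 * l) * 3)) / 2 ^ ((c + 14) * l) \<le> 2 ^ (14 * l) / 2 ^ ((c + 14) * l)"
      by (intro divide_right_mono) auto
    also have "\<dots> = 1 / 2 ^ (c * l)" by (simp add: power_add add_mult_distrib)
    finally show ?thesis by (simp add: ids_num_def l_def)
  qed
  have 2: "exp (1 / 64 * ((63 / 64) ^ (64 * h) * real k - real (check_len c n))) \<le> 1 / 2 * (1 / 2 ^ (c * l))"
  proof -
    have "k \<le> 2 ^ h * l\<^sup>2 + 1" using k fault_exp(1)[OF n, of f] by (simp add: h_def l_def)
    also have "\<dots> \<le> 2 ^ h * l\<^sup>2 + 2 ^ h * l\<^sup>2" using l by (intro add_left_mono) simp
    finally have "real k \<le> real (2 ^ h * l\<^sup>2 + 2 ^ h * l\<^sup>2)" by (simp only: of_nat_le_iff)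
    then have k': "real k \<le> 2 ^ h * (2 * (real l)\<^sup>2)" by simp
    have "(63 / 64 :: real) ^ 64 \<le> 1 / 2" by (simp add: power_divide)
    then have "((63 / 64 :: real) ^ 64) ^ h \<le> (1 / 2) ^ h" by (intro power_mono) auto
    then have "(63 / 64) ^ (64 * h) * real k \<le> (1 / 2) ^ h * (2 ^ h * (2 * (real l)\<^sup>2))"
      using k' by (intro mult_mono) (auto simp: power_mult)
    also have "\<dots> = 2 * (real l)\<^sup>2" by (simp add: power_divide)
    finally have "1 / 64 * ((63 / 64) ^ (64 * h) * real k - real (check_len c n)) \<le> - (real c + 1) * (real l)\<^sup>2"
      by (simp add: check_len_def l_def algebra_simps)
    also have "\<dots> \<le> - (real c + 1) * real l"
    proof -
      have "real l * 1 \<le> real l * real l" using l by (intro mult_left_mono) auto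
      then show ?thesis by (intro mult_left_mono_neg) (auto simp: power2_eq_square)
    qed
    also have "\<dots> = real ((c + 1) * l) * (- 1)" by (simp add: algebra_simps)
    finally have "exp (1 / 64 * ((63 / 64) ^ (64 * h) * real k - real (check_len c n))) \<le> exp (real ((c + 1) * l) * (- 1))"
      by simp
    also have "\<dots> = exp (- 1) ^ ((c + 1) * l)" by (rule exp_of_nat_mult)
    also have "\<dots> \<le> (1 / 2) ^ ((c + 1) * l)"
      using exp_ge_add_one_self[of 1] by (intro power_mono) (auto simp: exp_minus field_simps)
    also have "\<dots> = (1 / 2) ^ l * (1 / 2) ^ (c * l)" by (simp flip: power_add)
    also have "\<dots> \<le> (1 / 2) ^ 1 * (1 / 2) ^ (c * l)"
      using l by (intro mult_right_mono power_decreasing) auto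
    finally show ?thesis by (simp add: power_divide)
  qed
  show ?thesis using 1 2 main unfolding h_def l_def by linarith
qed

lemma card_pairs_less:
  assumes "2 \<le> n"
  shows "card (pairs {..<n}) < 2 ^ (2 * ell n)" "card (pairs {..<n}) \<le> n\<^sup>2"
proof -
  have "card (pairs {..<n}) = n choose 2" using n_subsets[of "{..<n}" 2] by (simp add: pairs_def)
  also have "\<dots> = n * (n - 1) div 2" by (rule choose_two)
  also have "\<dots> < n * n"
  proof -
    have "n * (n - 1) div 2 \<le> n * (n - 1)" by simp
    also have "\<dots> < n * n" using assms by simp
    finally show ?thesis .
  qed
  finally have less: "card (pairs {..<n}) < n * n" .
  also have "n * n \<le> 2 ^ ell n * 2 ^ ell n" using le_2_ell by (intro mult_mono) auto
  also have "\<dots> = 2 ^ (2 * ell n)" by (simp add: mult_2 power_add)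
  finally show "card (pairs {..<n}) < 2 ^ (2 * ell n)" .
  show "card (pairs {..<n}) \<le> n\<^sup>2" using less by (simp add: power2_eq_square)
qed

text \<open>A deterministic choice from \<open>c\<close> and \<open>n\<close> alone, so the decoder
  reproduces the code from the \<open>n\<close> in a vertex label.\<close>

definition edge_code :: "nat \<Rightarrow> nat \<Rightarrow> nat set \<Rightarrow> nat \<Rightarrow> vec" where
  "edge_code c n = (SOME w. let D = pairs {..<n} \<times> {..<ids_num c n} in
     inj_on (\<lambda>(e, k). w e k) D \<and> (\<lambda>(e, k). w e k) ` D \<subseteq> vecs (word_len c n) - {0} \<and>
     sidon ((\<lambda>(e, k). w e k) ` D))"

lemma edge_code:
  fixes c n :: nat
  assumes n: "2 \<le> n"
  defines "D \<equiv> pairs {..<n} \<times> {..<ids_num c n}"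
  shows "inj_on (\<lambda>(e, k). edge_code c n e k) D"
    "(\<lambda>(e, k). edge_code c n e k) ` D \<subseteq> vecs (word_len c n) - {0}"
    "sidon ((\<lambda>(e, k). edge_code c n e k) ` D)"
proof -
  have "finite (pairs {..<n})" by (auto simp: pairs_def intro: finite_subset[of _ "Pow {..<n}"])
  then have "finite D" by (simp add: D_def)
  moreover have "card D ^ 3 < 2 ^ word_len c n"
  proof -
    have "card D \<le> 2 ^ (2 * ell n) * 2 ^ ((c + 14) * ell n)"
      unfolding D_def card_cartesian_product using card_pairs_less(1)[OF n]
      by (intro mult_mono) (auto simp: ids_num_def)
    also have "\<dots> = 2 ^ ((c + 16) * ell n)" by (simp add: algebra_simps flip: power_add)
    finally have "card D ^ 3 \<le> (2 ^ ((c + 16) * ell n)) ^ 3" by (rule power_mono) simp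
    also have "\<dots> = 2 ^ (3 * (c + 16) * ell n)" by (simp add: mult_ac flip: power_mult)
    also have "\<dots> < 2 ^ word_len c n" by (simp add: word_len_def)
    finally show ?thesis .
  qed
  ultimately obtain w :: "nat set \<times> nat \<Rightarrow> vec" where
    w: "inj_on w D" "w ` D \<subseteq> vecs (word_len c n) - {0}" "sidon (w ` D)"
    using ex_sidon_code by blast
  have eq: "(\<lambda>(e, k). w (e, k)) = w" by auto
  have "\<exists>w. let D = pairs {..<n} \<times> {..<ids_num c n} in
     inj_on (\<lambda>(e, k). w e k) D \<and> (\<lambda>(e, k). w e k) ` D \<subseteq> vecs (word_len c n) - {0} \<and>
     sidon ((\<lambda>(e, k). w e k) ` D)"
    by (rule exI[of _ "\<lambda>e k. w (e, k)"]) (use w in \<open>simp only: Let_def eq D_def\<close>)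
  from someI_ex[OF this, folded edge_code_def]
  show "inj_on (\<lambda>(e, k). edge_code c n e k) D"
    "(\<lambda>(e, k). edge_code c n e k) ` D \<subseteq> vecs (word_len c n) - {0}"
    "sidon ((\<lambda>(e, k). edge_code c n e k) ` D)"
    unfolding D_def Let_def by blast+
qed

definition rand_len :: "nat \<Rightarrow> nat \<Rightarrow> nat \<Rightarrow> nat" where
  "rand_len c n h = 64 * h * (2 * ell n) * word_len c n + check_len c n"

text \<open>At \<open>n = 1\<close> the logarithmic bound is 0 and forces empty labels. Otherwise
  three numbers below \<open>2 ^ (ell n + 1)\<close> are joined by two nested pairings.\<close>

definition vertex_len :: "nat \<Rightarrow> nat" where
  "vertex_len n = (if n \<le> 1 then 0 else 4 * ell n + 10)"

text \<open>The bracketed sum bounds the bit length of every stored entry; four levels of pairing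
  turn a length \<open>a\<close> into \<open>16 * a + 30\<close>.\<close>

definition edge_len :: "nat \<Rightarrow> nat \<Rightarrow> nat \<Rightarrow> nat" where
  "edge_len c n f = (if n \<le> 1 then 0
     else 16 * (rand_len c n (fault_exp n f) + ell n + 1 + fault_exp n f) + 30)"

lemma vertex_len_le:
  assumes "1 \<le> n" "28 \<le> C"
  shows "real (vertex_len n) \<le> C * log 2 (real n)"
proof (cases "n \<le> 1")
  case True
  then show ?thesis using assms by (simp add: vertex_len_def)
next
  case False
  then have n: "2 \<le> n" by simp
  have "real (vertex_len n) \<le> 14 * real (ell n)" using ell_pos[OF n] n by (simp add: vertex_len_def)
  also have "\<dots> \<le> 28 * log 2 (real n)" using ell_le_log[OF n] by simp
  also have "\<dots> \<le> C * log 2 (real n)" using assms n by (intro mult_right_mono) auto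
  finally show ?thesis .
qed

text \<open>The factor 12 is 4 * 3: the square of the 2 in \<open>ell n \<le> 2 * log 2 n\<close>,
  times the 3 from the bound on \<open>fault_exp\<close>.\<close>

lemma edge_len_le:
  assumes "1 \<le> n" and f: "real f \<ge> 2 * (log 2 (real n))\<^sup>2"
    and C: "12 * (16 * real (128 * (3 * (c + 16) + 1) + 64 * c + 69) + 30) \<le> C"
  shows "real (edge_len c n f) \<le> C * ((log 2 (real n))\<^sup>2 * log 2 (real f / (log 2 (real n))\<^sup>2))"
proof (cases "n \<le> 1")
  case True
  then have "n = 1" using assms(1) by simp
  then show ?thesis by (simp add: edge_len_def)
next
  case False
  then have n: "2 \<le> n" by simp
  define l where "l = ell n"
  define h where "h = fault_exp n f"
  \<comment> \<open>The first term pays for the rounds, \<open>64 * c + 66\<close> for the check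
    bits, and the remaining 3 for \<open>l\<close>, \<open>1\<close> and \<open>h\<close>.\<close>
  define K where "K = 128 * (3 * (c + 16) + 1) + 64 * c + 69"
  let ?L = "log 2 (real n)"
  have l: "1 \<le> l" using ell_pos[OF n] by (simp add: l_def)
  have ll: "l \<le> l\<^sup>2" "1 \<le> l\<^sup>2" using l by (simp_all add: power2_eq_square)
  have "64 * h * (2 * l) * word_len c n \<le> 128 * h * (3 * (c + 16) + 1) * l\<^sup>2"
  proof -
    have "word_len c n \<le> (3 * (c + 16) + 1) * l" using l by (simp add: word_len_def l_def algebra_simps)
    then have "128 * h * l * word_len c n \<le> 128 * h * l * ((3 * (c + 16) + 1) * l)" by (rule mult_left_mono) simp
    then show ?thesis by (simp add: power2_eq_square algebra_simps)
  qed
  moreover have "h \<le> h * l\<^sup>2" using ll by simp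
  ultimately have "rand_len c n h + l + 1 + h \<le>
      128 * h * (3 * (c + 16) + 1) * l\<^sup>2 + (66 + 64 * c) * l\<^sup>2 + l\<^sup>2 + l\<^sup>2 + h * l\<^sup>2"
    unfolding rand_len_def check_len_def l_def[symmetric] using ll by linarith
  also have "\<dots> \<le> K * (l\<^sup>2 * (h + 1))" by (simp add: K_def algebra_simps)
  finally have a: "rand_len c n h + l + 1 + h \<le> K * (l\<^sup>2 * (h + 1))" .
  have gen: "16 * A + 30 \<le> (16 * K + 30) * X" if "A \<le> K * X" "1 \<le> X" for A X
  proof -
    have "(16 * K + 30) * X = 16 * (K * X) + 30 * X" by (simp add: add_mult_distrib)
    then show ?thesis using that by linarith
  qed
  have "1 * 1 \<le> l\<^sup>2 * (h + 1)" using ll by (intro mult_mono) auto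
  then have "16 * (rand_len c n h + l + 1 + h) + 30 \<le> (16 * K + 30) * (l\<^sup>2 * (h + 1))"
    using gen[OF a] by simp
  then have "edge_len c n f \<le> (16 * K + 30) * (l\<^sup>2 * (h + 1))"
    using n by (simp add: edge_len_def l_def h_def)
  then have "real (edge_len c n f) \<le> real ((16 * K + 30) * (l\<^sup>2 * (h + 1)))" by (simp only: of_nat_le_iff)
  also have "\<dots> = (16 * real K + 30) * ((real l)\<^sup>2 * (real h + 1))" by (simp add: algebra_simps)
  also have "\<dots> \<le> (16 * real K + 30) * ((2 * ?L)\<^sup>2 * (3 * log 2 (real f / ?L\<^sup>2)))"
    using ell_le_log[OF n] fault_exp_le_log[OF n f] unfolding l_def h_def
    by (intro mult_left_mono mult_mono power_mono) auto
  also have "\<dots> = 12 * (16 * real K + 30) * (?L\<^sup>2 * log 2 (real f / ?L\<^sup>2))"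
    by (simp add: power_mult_distrib)
  also have "\<dots> \<le> C * (?L\<^sup>2 * log 2 (real f / ?L\<^sup>2))"
  proof (rule mult_right_mono)
    show "12 * (16 * real K + 30) \<le> C" using C by (simp only: K_def)
    have "0 \<le> log 2 (real f / ?L\<^sup>2)" using fault_exp_le_log[OF n f] by linarith
    then show "0 \<le> ?L\<^sup>2 * log 2 (real f / ?L\<^sup>2)" by simp
  qed
  finally show ?thesis .
qed

section \<open>Labels\<close>


text \<open>\<open>h\<close> is stored with every edge because the decoder does not know
  \<open>f\<close>, and \<open>h\<close> fixes the number of rounds. \<open>Min\<close> and
  \<open>Max\<close> put the unordered ends in order.\<close>

definition encode_edge :: "nat \<Rightarrow> nat \<Rightarrow> edge_info \<Rightarrow> nat" where
  "encode_edge B h q = prod_encode (prod_encode (Min (ends q), Max (ends q)),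
     prod_encode (prod_encode (lo q, hi q),
       prod_encode (h, prod_encode (nat_of_vec B (own q), nat_of_vec B (below q)))))"

definition decode_edge :: "nat \<Rightarrow> nat \<times> edge_info" where
  "decode_edge x =
     (case prod_decode x of (e, y) \<Rightarrow> case prod_decode e of (u, v) \<Rightarrow>
      case prod_decode y of (i, z) \<Rightarrow> case prod_decode i of (l, r) \<Rightarrow>
      case prod_decode z of (h, p) \<Rightarrow> case prod_decode p of (a, b) \<Rightarrow>
        (h, Edge_Info {u, v} l r (vec_of_nat a) (vec_of_nat b)))"

lemma decode_encode_edge:
  assumes "ends q \<in> pairs V" "own q \<in> vecs B" "below q \<in> vecs B"
  shows "decode_edge (encode_edge B h q) = (h, q)"
proof -
  obtain x y where xy: "ends q = {x, y}" using assms(1) by (rule pairs_cases)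
  have "{Min {x, y}, Max {x, y}} = {x, y}" by (auto simp: min_def max_def)
  then have "{Min (ends q), Max (ends q)} = ends q" by (simp only: xy)
  then show ?thesis
    using assms(2,3) by (cases q) (simp add: encode_edge_def decode_edge_def vec_of_nat_of_vec)
qed

lemma less_power2_mono: "(x :: nat) < 2 ^ i \<Longrightarrow> i \<le> j \<Longrightarrow> x < 2 ^ j"
  by (erule less_le_trans) (simp add: power_increasing)

lemma encode_edge_less:
  assumes "Min (ends q) < 2 ^ a" "Max (ends q) < 2 ^ a" "lo q < 2 ^ a" "hi q < 2 ^ a" "h < 2 ^ a" "B \<le> a"
  shows "encode_edge B h q < 2 ^ (16 * a + 30)"
proof -
  note up = less_power2_mono
  have "nat_of_vec B r < 2 ^ a" for r using nat_of_vec_less assms(6) by (rule up)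
  then have 1: "prod_encode (nat_of_vec B (own q), nat_of_vec B (below q)) < 2 ^ (2 * a + 2)"
    by (intro prod_encode_less)
  have 2: "prod_encode (h, prod_encode (nat_of_vec B (own q), nat_of_vec B (below q))) < 2 ^ (2 * (2 * a + 2) + 2)"
    by (rule prod_encode_less[OF up[OF assms(5)] 1]) simp
  have 3: "prod_encode (prod_encode (lo q, hi q), prod_encode (h, prod_encode (nat_of_vec B (own q), nat_of_vec B (below q))))
      < 2 ^ (2 * (2 * (2 * a + 2) + 2) + 2)"
    by (rule prod_encode_less[OF up[OF prod_encode_less[OF assms(3,4)]] 2]) simp
  have "encode_edge B h q < 2 ^ (2 * (2 * (2 * (2 * a + 2) + 2) + 2) + 2)"
    unfolding encode_edge_def
    by (rule prod_encode_less[OF up[OF prod_encode_less[OF assms(1,2)]] 3]) simp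
  also have "2 * (2 * (2 * (2 * a + 2) + 2) + 2) + 2 = 16 * a + 30" by simp
  finally show ?thesis .
qed

text \<open>The roots alone decide connectivity in the whole graph. This settles pairs in different
  components and also the empty fault set, for which no edge label supplies
  \<open>h\<close>.\<close>

definition decoder :: "nat \<Rightarrow> decoder" where
  "decoder c ls lt Ls =
     (case prod_decode (nat_of_label ls) of (n, x) \<Rightarrow> case prod_decode x of (s, rs) \<Rightarrow>
      case prod_decode (nat_of_label lt) of (_, y) \<Rightarrow> case prod_decode y of (t, rt) \<Rightarrow>
        rs = rt \<and> (Ls = {} \<or>
          (let Z = (\<lambda>l. decode_edge (nat_of_label l)) ` Ls; h = (SOME h. h \<in> fst ` Z) in
           decode_connected n (2 * ell n) (ids_num c n) (word_len c n) (edge_code c n)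
             (64 * h) (check_len c n) (snd ` Z) s t)))"

lemma decoder_eq:
  assumes ls: "nat_of_label ls = prod_encode (n, prod_encode (s, rs))"
    and lt: "nat_of_label lt = prod_encode (n, prod_encode (t, rt))"
    and Ls: "Ls = g ` F" "\<And>e. e \<in> F \<Longrightarrow> decode_edge (nat_of_label (g e)) = (h, i e)"
  shows "decoder c ls lt Ls \<longleftrightarrow> rs = rt \<and> (F = {} \<or>
    decode_connected n (2 * ell n) (ids_num c n) (word_len c n) (edge_code c n)
      (64 * h) (check_len c n) (i ` F) s t)"
proof (cases "F = {}")
  case True
  then show ?thesis by (simp add: decoder_def ls lt Ls(1))
next
  case False
  have "(\<lambda>l. decode_edge (nat_of_label l)) ` Ls = (\<lambda>e. decode_edge (nat_of_label (g e))) ` F"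
    unfolding Ls(1) by (rule image_image)
  also have "\<dots> = (\<lambda>e. (h, i e)) ` F" using Ls(2) by (rule image_cong[OF refl])
  finally have Z: "(\<lambda>l. decode_edge (nat_of_label l)) ` Ls = (\<lambda>e. (h, i e)) ` F" .
  have fst: "fst ` (\<lambda>e. (h, i e)) ` F = {h}" using False by (simp add: image_image image_constant_conv)
  have snd: "snd ` (\<lambda>e. (h, i e)) ` F = i ` F" by (simp add: image_image)
  have "Ls \<noteq> {}" using False Ls(1) by simp
  then show ?thesis
    unfolding decoder_def Z Let_def fst snd by (simp add: ls lt False)
qed

text \<open>The distribution is fixed before the query. The graph \<open>E - F\<close>, the initial
  links and the error event belong to the analysis of one query, and the failure bound holds for
  each query separately.\<close>

lemma (in numbered_graph) ex_labeling:
  assumes n: "2 \<le> n"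
  shows "\<exists>Pr :: nat random_labeling.
    label_lengths {..<n} E (vertex_len n) (edge_len c n f) Pr \<and>
    (\<forall>s<n. \<forall>t<n. \<forall>F\<subseteq>E. card F \<le> f \<longrightarrow> success_prob (decoder c) E Pr s t F \<ge> 1 - 1 / real n ^ c)"
proof -
  obtain lo\<^sub>E hi\<^sub>E :: "nat set \<Rightarrow> nat" where
    interval: "\<And>e. lo\<^sub>E e \<le> n" "\<And>e. hi\<^sub>E e \<le> n" "\<And>e v. v < n \<Longrightarrow> e \<in> P v \<longleftrightarrow> lo\<^sub>E e \<le> v \<and> v < hi\<^sub>E e"
  proof -
    from choice[OF allI[OF ex_interval]] obtain l where
      "\<forall>e. \<exists>hi. l e \<le> n \<and> hi \<le> n \<and> (\<forall>v<n. e \<in> P v \<longleftrightarrow> l e \<le> v \<and> v < hi)" ..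
    from choice[OF this] obtain u where
      "\<forall>e. l e \<le> n \<and> u e \<le> n \<and> (\<forall>v<n. e \<in> P v \<longleftrightarrow> l e \<le> v \<and> v < u e)" ..
    then show ?thesis by (intro that[of l u]) simp_all
  qed
  define h where "h = fault_exp n f"
  define J where "J = 2 * ell n"
  define N where "N = ids_num c n"
  define m where "m = word_len c n"
  define w where "w = edge_code c n"
  define b where "b = check_len c n"
  define R where "R = 64 * h"
  define B where "B = R * J * m + b"
  define rv where "rv \<omega>s \<eta> e = flatten m J R b (\<lambda>i j. round_vec w (\<omega>s ! i) j e) (\<eta> e)"
    for \<omega>s :: "((nat \<times> nat set \<Rightarrow> bool) \<times> (nat \<times> nat set \<Rightarrow> nat)) list" and \<eta> e
  define inf where "inf \<omega>s \<eta> e = Edge_Info e (lo\<^sub>E e) (hi\<^sub>E e) (rv \<omega>s \<eta> e) (subtree_sum (rv \<omega>s \<eta>) e)" for \<omega>s \<eta> e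
  define LV where "LV v = label_of_nat (vertex_len n) (prod_encode (n, prod_encode (v, rt v)))" for v
  define LE where "LE \<omega>s \<eta> e = label_of_nat (edge_len c n f) (encode_edge B h (inf \<omega>s \<eta> e))" for \<omega>s \<eta> e
  define M where "M = pair_pmf (replicate_pmf R (round_pmf J N E)) (Pi_pmf E 0 (\<lambda>_. pmf_of_set (vecs b)))"
  define Pr where "Pr = map_pmf (\<lambda>(\<omega>s, \<eta>). (LV, LE \<omega>s \<eta>)) M"
  have n_less: "n < 2 ^ (ell n + 1)" by (rule le_less_trans[OF le_2_ell]) simp
  have LV: "nat_of_label (LV v) = prod_encode (n, prod_encode (v, rt v))" if v: "v < n" for v
  proof -
    have "v < 2 ^ (ell n + 1)" "rt v < 2 ^ (ell n + 1)" using v root_less[OF v] n_less by linarith+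
    then have 1: "prod_encode (v, rt v) < 2 ^ (2 * (ell n + 1) + 2)" by (rule prod_encode_less)
    have "n < 2 ^ (2 * (ell n + 1) + 2)" by (rule less_power2_mono[OF n_less]) simp
    then have "prod_encode (n, prod_encode (v, rt v)) < 2 ^ (2 * (2 * (ell n + 1) + 2) + 2)"
      using 1 by (rule prod_encode_less)
    also have "2 * (2 * (ell n + 1) + 2) + 2 = vertex_len n" using n by (simp add: vertex_len_def)
    finally show ?thesis unfolding LV_def by (rule nat_of_label_of_nat)
  qed
  have rv_vecs: "rv \<omega>s \<eta> e \<in> vecs B" for \<omega>s \<eta> e
    unfolding rv_def B_def by (rule flatten_in_vecs)
  have LE: "decode_edge (nat_of_label (LE \<omega>s \<eta> e)) = (h, inf \<omega>s \<eta> e)" if e: "e \<in> E" for \<omega>s \<eta> e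
  proof -
    define a where "a = B + ell n + 1 + h"
    have ep: "e \<in> pairs {..<n}" using E e by blast
    then obtain x y where xy: "x \<in> {..<n}" "y \<in> {..<n}" "e = {x, y}" by (rule pairs_cases)
    have na: "n < 2 ^ a" by (rule less_power2_mono[OF n_less]) (simp add: a_def)
    have "Min e < 2 ^ a" "Max e < 2 ^ a" using xy na by simp_all
    moreover have "lo\<^sub>E e < 2 ^ a" "hi\<^sub>E e < 2 ^ a" using interval(1,2)[of e] na by linarith+
    moreover have "h < 2 ^ a" by (rule less_power2_mono[OF less_exp]) (simp add: a_def)
    ultimately have "encode_edge B h (inf \<omega>s \<eta> e) < 2 ^ (16 * a + 30)"
      by (intro encode_edge_less) (simp_all add: inf_def a_def)
    also have "16 * a + 30 = edge_len c n f"
      using n by (simp add: edge_len_def a_def rand_len_def B_def R_def J_def m_def b_def h_def)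
    finally have "nat_of_label (LE \<omega>s \<eta> e) = encode_edge B h (inf \<omega>s \<eta> e)"
      unfolding LE_def by (rule nat_of_label_of_nat)
    moreover have "subtree_sum (rv \<omega>s \<eta>) e \<in> vecs B"
      unfolding subtree_sum_def by (intro vecs_sum rv_vecs)
    ultimately show ?thesis
      using ep rv_vecs decode_encode_edge[of "inf \<omega>s \<eta> e" "{..<n}" B h] by (simp add: inf_def)
  qed
  have lengths: "label_lengths {..<n} E (vertex_len n) (edge_len c n f) Pr"
    by (auto simp: label_lengths_def Pr_def LV_def LE_def)
  have "success_prob (decoder c) E Pr s t F \<ge> 1 - 1 / real n ^ c"
    if s: "s < n" and t: "t < n" and F: "F \<subseteq> E" "card F \<le> f" for s t F
  proof -
    interpret B: boruvka "{..<n}" E "E - F" J N w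
    proof
      show "card E < 2 ^ J"
      proof -
        have "finite (pairs {..<n})" by (auto simp: pairs_def intro: finite_subset[of _ "Pow {..<n}"])
        then have "card E \<le> card (pairs {..<n})" using E by (rule card_mono)
        then show ?thesis using card_pairs_less(1)[OF n] by (simp add: J_def)
      qed
      show "0 < N" by (simp add: N_def ids_num_def)
      show "inj_on (\<lambda>(e, k). w e k) (pairs {..<n} \<times> {..<N})"
        unfolding w_def N_def by (rule edge_code(1)[OF n])
      show "sidon ((\<lambda>(e, k). w e k) ` (pairs {..<n} \<times> {..<N}))"
        unfolding w_def N_def by (rule edge_code(3)[OF n])
      show "w e k \<noteq> 0" if "e \<in> pairs {..<n}" "k < N" for e k
        using edge_code(2)[OF n, of c] that unfolding w_def N_def by (auto simp: image_subset_iff)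
    qed (use E in auto)
    define H where "H = {{u, v} | u v. u \<in> {..<n} \<and> v \<in> {..<n} \<and> P u \<inter> F = P v \<inter> F}"
    have finF: "finite F" using F finite_E finite_subset by blast
    let ?k = "card (active_components {..<n} (E - F) H)"
    have "?k \<le> min f (n\<^sup>2) + 1"
    proof -
      have "?k \<le> card F + 1" unfolding H_def by (rule card_active_signatures_le[OF finF])
      \<comment> \<open>\<open>f\<close> may exceed the number of pairs of vertices, but
        \<open>card F\<close> cannot; this justifies the cap in \<open>fault_exp\<close>.\<close>
      moreover have "card F \<le> n\<^sup>2"
      proof -
        have "finite (pairs {..<n})" by (auto simp: pairs_def intro: finite_subset[of _ "Pow {..<n}"])
        then have "card F \<le> card (pairs {..<n})" using E F(1) by (intro card_mono) auto
        then show ?thesis using card_pairs_less(2)[OF n] by simp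
      qed
      ultimately show ?thesis using F(2) by simp
    qed
    note bound = failure_bound[OF n this, of c]
    have Hl: "links_on {..<n} H" unfolding H_def links_on_def by blast
    have "measure_pmf.prob M {(\<omega>s, \<eta>). B.misdecodes H \<omega>s \<eta>} \<le>
      real R * (real (card {..<n}) * real J * (3 / real N)) + exp (1 / 64 * ((63 / 64) ^ R * real ?k - real b))"
      unfolding M_def B.check_pmf_def[symmetric] by (rule B.prob_misdecodes_le[OF Hl]) simp_all
    also have "\<dots> \<le> 1 / real n ^ c"
      using bound unfolding R_def h_def J_def N_def b_def by simp
    finally have fail: "measure_pmf.prob M {(\<omega>s, \<eta>). B.misdecodes H \<omega>s \<eta>} \<le> 1 / real n ^ c" .
    have correct: "decoder c (LV s) (LV t) (LE \<omega>s \<eta> ` F) \<longleftrightarrow> connected_by (E - F) s t"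
      if supp: "(\<omega>s, \<eta>) \<in> set_pmf M" and ok: "\<not> B.misdecodes H \<omega>s \<eta>" for \<omega>s \<eta>
    proof -
      have dec: "decoder c (LV s) (LV t) (LE \<omega>s \<eta> ` F) \<longleftrightarrow> rt s = rt t \<and> (F = {} \<or>
        decode_connected n J N m w R b (inf \<omega>s \<eta> ` F) s t)"
        unfolding J_def N_def m_def w_def R_def b_def
        using F(1) by (intro decoder_eq[OF LV[OF s] LV[OF t] refl] LE) auto
      show ?thesis
      proof (cases "rt s = rt t")
        case False
        then have "\<not> connected_by E s t" using rt_eq_iff[OF s t] by simp
        then have "\<not> connected_by (E - F) s t" using connected_by_mono[of "E - F" s t E] by blast
        then show ?thesis using False dec by simp
      next
        case True
        show ?thesis
        proof (cases "F = {}")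
          case Fe: True
          then show ?thesis using True rt_eq_iff[OF s t] dec by simp
        next
          case Fn: False
          have \<omega>s: "set \<omega>s \<subseteq> set_pmf (round_pmf J N E)" "length \<omega>s = R"
            using supp by (auto simp: M_def set_replicate_pmf)
          have \<eta>: "\<eta> e \<in> vecs b" for e
          proof -
            have "vecs b \<noteq> {}" using vecs_0 by blast
            then have "set_pmf (pmf_of_set (vecs b)) = vecs b" by (intro set_pmf_of_set) auto
            moreover have "\<eta> \<in> PiE_dflt E 0 (set_pmf \<circ> (\<lambda>_. pmf_of_set (vecs b)))"
              using supp unfolding M_def set_pair_pmf set_Pi_pmf[OF finite_E] by simp
            ultimately have "\<eta> \<in> PiE_dflt E 0 (\<lambda>_. vecs b)" by (simp only: o_def)
            then have "(e \<in> E \<longrightarrow> \<eta> e \<in> vecs b) \<and> (e \<notin> E \<longrightarrow> \<eta> e = 0)"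
              unfolding PiE_dflt_def mem_Collect_eq by (rule spec)
            \<comment> \<open>Off \<open>E\<close> the value is the default 0, which also lies in
              \<open>vecs b\<close>.\<close>
            then show ?thesis by (cases "e \<in> E") simp_all
          qed
          interpret Q: faulty_query n E rt P F J N w m R b lo\<^sub>E hi\<^sub>E \<omega>s \<eta>
          proof
            show "w e k \<in> vecs m" if "e \<in> pairs {..<n}" "k < N" for e k
              using edge_code(2)[OF n, of c] that unfolding w_def N_def m_def by (auto simp: image_subset_iff)
            show "snd \<omega>' i < N" if "\<omega>' \<in> set \<omega>s" for \<omega>' i
              using that \<omega>s(1) by (intro B.set_round_pmf) auto
          qed (use F interval \<omega>s \<eta> in auto)
          have info: "Q.info = inf \<omega>s \<eta>"
          proof -
            have "Q.rvec = rv \<omega>s \<eta>" by (intro ext) (simp only: Q.rvec_def rv_def)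
            then show ?thesis by (intro ext) (simp only: Q.info_def inf_def)
          qed
          have "sig_links n Q.Q = H" unfolding H_def by (rule Q.sig_links_eq)
          then have "decode_connected n J N m w R b Q.Q s t \<longleftrightarrow> connected_by (E - F) s t"
            using ok by (intro Q.decode_connected_correct s t True) simp
          then show ?thesis using dec Fn True by (simp add: info)
        qed
      qed
    qed
    have "1 - 1 / real n ^ c \<le> 1 - measure_pmf.prob M {(\<omega>s, \<eta>). B.misdecodes H \<omega>s \<eta>}"
      using fail by simp
    also have "\<dots> = measure_pmf.prob M (- {(\<omega>s, \<eta>). B.misdecodes H \<omega>s \<eta>})"
      using measure_pmf.prob_compl[of "{(\<omega>s, \<eta>). B.misdecodes H \<omega>s \<eta>}" M] by (simp add: Compl_eq_Diff_UNIV)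
    also have "\<dots> \<le> measure_pmf.prob M
        {(\<omega>s, \<eta>). decoder c (LV s) (LV t) (LE \<omega>s \<eta> ` F) \<longleftrightarrow> connected_by (E - F) s t}"
      using correct by (intro prob_le_of_support) auto
    also have "\<dots> = success_prob (decoder c) E Pr s t F"
      by (simp add: success_prob_def Pr_def vimage_def case_prod_unfold)
    finally show ?thesis .
  qed
  then show ?thesis using lengths by blast
qed

section \<open>Transfer to arbitrary vertex sets\<close>

lemma connected_by_image_iff:
  assumes inj: "inj_on f V" and E: "\<And>e. e \<in> E \<Longrightarrow> e \<subseteq> V" and st: "s \<in> V" "t \<in> V"
  shows "connected_by ((`) f ` E) (f s) (f t) \<longleftrightarrow> connected_by E s t"
proof
  let ?g = "inv_into V f"
  have gf: "?g (f v) = v" if "v \<in> V" for v using inj that by simp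
  assume "connected_by ((`) f ` E) (f s) (f t)"
  from connected_by_image[OF this, of ?g] have "connected_by ((`) ?g ` (`) f ` E) s t"
    using st gf by simp
  also have "(`) ?g ` (`) f ` E = E"
  proof -
    have "?g ` f ` e = e" if "e \<in> E" for e
      using E[OF that] gf by (auto simp: image_image subset_iff intro!: image_eqI)
    then show ?thesis by (simp add: image_image)
  qed
  finally show "connected_by E s t" .
qed (rule connected_by_image)

text \<open>The number of a vertex is its position in the preorder of a spanning forest.\<close>

lemma ex_numbering:
  assumes G: "ugraph V E" and n: "card V = n"
  obtains f rt P where "bij_betw f V {..<n}" "numbered_graph n ((`) f ` E) rt P"
proof -
  obtain xs rt P where xs: "set xs = V" "rooted_forest E rt xs P"
    and rt: "\<And>u v. u \<in> V \<Longrightarrow> v \<in> V \<Longrightarrow> rt u = rt v \<longleftrightarrow> connected_by E u v"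
    by (rule ex_rooted_forest[OF G]) (rule that)
  interpret rooted_forest E rt xs P by (rule xs(2))
  have len: "length xs = n" using distinct_card[OF distinct] xs(1) n by simp
  have bij: "bij_betw (nth xs) {..<n} V" using bij_betw_nth[OF distinct] len xs(1) by blast
  define f where "f = inv_into {..<n} (nth xs)"
  have f: "bij_betw f V {..<n}" unfolding f_def by (rule bij_betw_inv_into[OF bij])
  have map: "map f xs = [0..<n]"
  proof (rule nth_equalityI)
    fix i assume "i < length (map f xs)"
    then show "map f xs ! i = [0..<n] ! i"
      using bij len by (simp add: f_def bij_betw_def)
  qed (simp add: len)
  define g where "g = inv_into V f"
  have inj: "inj_on f V" using f by (simp add: bij_betw_def)
  have g: "g u \<in> V" "f (g u) = u" if "u < n" for u
    using f that by (auto simp: g_def bij_betw_def inv_into_into f_inv_into_f)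
  have edge: "e \<subseteq> V" "card e = 2" if "e \<in> E" for e using G that by (auto simp: ugraph_def)
  have "numbered_graph n ((`) f ` E) (f \<circ> rt \<circ> g) (\<lambda>y. (`) f ` P (g y))"
  proof (rule numbered_graph.intro)
    show "rooted_forest ((`) f ` E) (f \<circ> rt \<circ> g) [0..<n] (\<lambda>y. (`) f ` P (g y))"
      using rooted_forest_image[OF xs(2), of f] inj unfolding map xs(1) g_def by blast
    show "(`) f ` E \<subseteq> pairs {..<n}"
    proof
      fix e' assume "e' \<in> (`) f ` E"
      then obtain e where e: "e \<in> E" "e' = f ` e" by blast
      have "card e' = 2" unfolding e(2) using edge[OF e(1)] inj_on_subset[OF inj] by (simp add: card_image)
      moreover have "e' \<subseteq> {..<n}" unfolding e(2) using f image_mono[OF edge(1)[OF e(1)], of f] by (simp add: bij_betw_def)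
      ultimately show "e' \<in> pairs {..<n}" by (simp add: pairs_def)
    qed
    fix u v assume uv: "u < n" "v < n"
    have "rt (g u) \<in> V" "rt (g v) \<in> V" using root_in g uv xs(1) by blast+
    then have "(f \<circ> rt \<circ> g) u = (f \<circ> rt \<circ> g) v \<longleftrightarrow> rt (g u) = rt (g v)"
      using inj by (simp add: inj_on_eq_iff)
    also have "\<dots> \<longleftrightarrow> connected_by E (g u) (g v)" using g uv by (intro rt)
    also have "\<dots> \<longleftrightarrow> connected_by ((`) f ` E) (f (g u)) (f (g v))"
      using g uv edge(1) by (intro connected_by_image_iff[OF inj, symmetric])
    finally show "(f \<circ> rt \<circ> g) u = (f \<circ> rt \<circ> g) v \<longleftrightarrow> connected_by ((`) f ` E) u v"
      using g uv by simp
  qed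
  then show ?thesis using that f by blast
qed

lemma ex_labeling:
  assumes G: "ugraph V E" and n: "card V = n" "2 \<le> n"
  shows "\<exists>Pr :: 'a random_labeling.
    label_lengths V E (vertex_len n) (edge_len c n f) Pr \<and>
    (\<forall>s\<in>V. \<forall>t\<in>V. \<forall>F\<subseteq>E. card F \<le> f \<longrightarrow> success_prob (decoder c) E Pr s t F \<ge> 1 - 1 / real n ^ c)"
proof -
  obtain \<nu> rt P where \<nu>: "bij_betw \<nu> V {..<n}" and num: "numbered_graph n ((`) \<nu> ` E) rt P"
    by (rule ex_numbering[OF G n(1)])
  obtain Q :: "nat random_labeling" where
    "label_lengths {..<n} ((`) \<nu> ` E) (vertex_len n) (edge_len c n f) Q \<and>
      (\<forall>s<n. \<forall>t<n. \<forall>F\<subseteq>(`) \<nu> ` E. card F \<le> f \<longrightarrow>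
        success_prob (decoder c) ((`) \<nu> ` E) Q s t F \<ge> 1 - 1 / real n ^ c)"
    by (rule exE[OF numbered_graph.ex_labeling[OF num n(2)]])
  note Q = this[THEN conjunct1] this[THEN conjunct2, rule_format]
  have inj: "inj_on \<nu> V" and img: "\<And>v. v \<in> V \<Longrightarrow> \<nu> v < n" using \<nu> by (auto simp: bij_betw_def)
  have edge: "e \<subseteq> V" if "e \<in> E" for e using G that by (auto simp: ugraph_def)
  have finE: "finite E"
    using G edge by (auto simp: ugraph_def intro: finite_subset[of E "Pow V"])
  define Pr :: "'a random_labeling" where
    "Pr = map_pmf (\<lambda>(L\<^sub>V, L\<^sub>E). (\<lambda>v. L\<^sub>V (\<nu> v), \<lambda>e. L\<^sub>E (\<nu> ` e))) Q"
  have "label_lengths V E (vertex_len n) (edge_len c n f) Pr"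
    using Q(1) img unfolding label_lengths_def Pr_def by (fastforce simp: case_prod_unfold)
  moreover have "success_prob (decoder c) E Pr s t F \<ge> 1 - 1 / real n ^ c"
    if st: "s \<in> V" "t \<in> V" and F: "F \<subseteq> E" "card F \<le> f" for s t F
  proof -
    let ?F = "(`) \<nu> ` F"
    have "(`) \<nu> ` (E - F) = (`) \<nu> ` E - ?F"
      by (rule inj_on_image_set_diff[OF inj_on_image_Pow[OF inj]]) (use edge F in auto)
    then have conn: "connected_by ((`) \<nu> ` E - ?F) (\<nu> s) (\<nu> t) \<longleftrightarrow> connected_by (E - F) s t"
      using connected_by_image_iff[OF inj, of "E - F" s t] edge st by auto
    have labels: "(\<lambda>e. L (\<nu> ` e)) ` F = L ` ?F" for L :: "nat set \<Rightarrow> label" by (simp add: image_image)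
    have "success_prob (decoder c) E Pr s t F = success_prob (decoder c) ((`) \<nu> ` E) Q (\<nu> s) (\<nu> t) ?F"
      unfolding success_prob_def Pr_def by (simp add: vimage_def case_prod_unfold labels conn)
    moreover have "card ?F \<le> f"
      using card_image_le[of F "(`) \<nu>"] F finite_subset[OF F(1) finE] by simp
    ultimately show ?thesis using Q(2)[of "\<nu> s" "\<nu> t" ?F] img st F(1) by (simp add: image_mono)
  qed
  ultimately show ?thesis by blast
qed

text \<open>High probability means failure at most \<open>1 / n ^ c\<close> for any prescribed
  \<open>c\<close>. The constant, the lengths and the decoder depend on \<open>c\<close> only, so
  they are uniform in graph, faults and query.\<close>

theorem mainTheorem3:
  fixes c :: nat
  shows "\<exists>(C::real) (b\<^sub>V :: nat \<Rightarrow> nat) (b\<^sub>E :: nat \<Rightarrow> nat \<Rightarrow> nat) (D :: decoder).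
    (\<forall>n\<ge>1. real (b\<^sub>V n) \<le> C * log 2 (real n)) \<and>
    (\<forall>n\<ge>1. \<forall>f. real f \<ge> 2 * (log 2 (real n))\<^sup>2 \<longrightarrow>
       real (b\<^sub>E n f) \<le> C * ((log 2 (real n))\<^sup>2 * log 2 (real f / (log 2 (real n))\<^sup>2))) \<and>
    (\<forall>(V :: 'a set) (E :: 'a set set) (n :: nat) (f :: nat).
       ugraph V E \<and> card V = n \<and> real f \<ge> 2 * (log 2 (real n))\<^sup>2 \<longrightarrow>
       (\<exists>P :: 'a random_labeling.
          label_lengths V E (b\<^sub>V n) (b\<^sub>E n f) P \<and>
          (\<forall>s\<in>V. \<forall>t\<in>V. \<forall>F\<subseteq>E. card F \<le> f \<longrightarrow>
             success_prob D E P s t F \<ge> 1 - 1 / real n ^ c)))"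
proof -
  define C where "C = 12 * (16 * real (128 * (3 * (c + 16) + 1) + 64 * c + 69) + 30)"
  have "\<exists>P :: 'a random_labeling. label_lengths V E (vertex_len n) (edge_len c n f) P \<and>
      (\<forall>s\<in>V. \<forall>t\<in>V. \<forall>F\<subseteq>E. card F \<le> f \<longrightarrow> success_prob (decoder c) E P s t F \<ge> 1 - 1 / real n ^ c)"
    if G: "ugraph V E" "card V = n" for V :: "'a set" and E n f
  proof (cases "2 \<le> n")
    case True
    then show ?thesis by (rule ex_labeling[OF G])
  next
    \<comment> \<open>Without vertices there are no queries, and for \<open>n = 1\<close> the
      required probability is 0, so constant labels suffice.\<close>
    case False
    define P :: "'a random_labeling" where
      "P = return_pmf (\<lambda>_. replicate (vertex_len n) False, \<lambda>_. replicate (edge_len c n f) False)"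
    have "label_lengths V E (vertex_len n) (edge_len c n f) P"
      by (simp add: label_lengths_def P_def)
    moreover have "success_prob (decoder c) E P s t F \<ge> 1 - 1 / real n ^ c" if "s \<in> V" for s t F
    proof -
      have "n \<noteq> 0" using that G by (auto simp: ugraph_def card_gt_0_iff)
      then have "n = 1" using False by simp
      then show ?thesis by (simp add: success_prob_def)
    qed
    ultimately show ?thesis by blast
  qed
  moreover have "\<forall>n\<ge>1. real (vertex_len n) \<le> C * log 2 (real n)"
    by (intro allI impI vertex_len_le) (simp_all add: C_def)
  moreover have "\<forall>n\<ge>1. \<forall>f. real f \<ge> 2 * (log 2 (real n))\<^sup>2 \<longrightarrow>
       real (edge_len c n f) \<le> C * ((log 2 (real n))\<^sup>2 * log 2 (real f / (log 2 (real n))\<^sup>2))"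
    by (intro allI impI edge_len_le) (simp_all add: C_def)
  ultimately show ?thesis
    by (intro exI[of _ C] exI[of _ vertex_len] exI[of _ "edge_len c"] exI[of _ "decoder c"]) blast
qed

end
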